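(* Let $\widehat M$ be an irreducible Coxeter matrix of finite type over a set $\widehat I$ with $m=|\widehat I|>2$, and let $\Phi:\mathrm{Br}^+(\widehat M)\to\mathrm{Br}^+(M)$ be an optimal fully supported disjoint standard homomorphism. Suppose that $M$ is of type $A_n$ or $B_n$. (a) If $\widehat M$ is not of type $B$ then $\widehat M$ and $M$ are both of type $A$ and $\Phi$ is an isomorphism. (b) If $\widehat M=B_m$ and $M=B_n$ then $m\le n$ and $\Phi(\widehat T_i)=T_i$ for $i\in[1,m-1]$, $\Phi(\widehat T_m)=T_{w_\circ^{[m,n]}}$. (c) If $\widehat M=B_m$ and $M=A_n$ then $m\le\lceil\frac n2\rceil$ and $\Phi$ is the composition of the homomorphism $\mathrm{Br}^+(B_m)\to\mathrm{Br}^+(B_{\lceil n/2\rceil})$, $\widehat T_i\mapsto T_i$ ($i\in[1,m-1]$), $\widehat T_m\mapsto T_{w_\circ^{[m,\lceil n/2\rceil]}}$, with the standard unfolding $\mathrm{Br}^+(B_{\lceil n/2\rceil})\to\mathrm{Br}^+(A_n)$.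
   Context: A Coxeter matrix over a finite set $I$ is a symmetric matrix $M=(m_{ij})_{i,j\in I}$ with $m_{ii}=1$ and $m_{ij}\in\mathbb Z_{\ge2}\cup\{\infty\}$ for $i\ne j$; $M$ is irreducible if its Coxeter graph is connected, and of finite type if the Coxeter group $W(M)$ is finite. $\mathrm{Br}^+(M)$ is the Artin monoid: generators $T_i$, $i\in I$, relations $T_iT_jT_i\cdots=T_jT_iT_j\cdots$ ($m_{ij}$ factors each) for $i\ne j$, $m_{ij}<\infty$. Generators of $\mathrm{Br}^+(\widehat M)$ are denoted $\widehat T_i$, $i\in\widehat I$. Labelling: $A_n$ is over $[1,n]$ with $m_{i,i+1}=3$, all other off-diagonal entries $2$; $B_n$ ($n\ge2$) is over $[1,n]$ with $m_{i,i+1}=3$ for $i\le n-2$, $m_{n-1,n}=4$, other off-diagonal entries $2$. For $w\in W(M)$ with reduced expression $s_{i_1}\cdots s_{i_k}$, $T_w=T_{i_1}\cdots T_{i_k}$; $w_\circ^J$ is the longest element of the (finite) parabolic subgroup generated by $s_j$, $j\in J$. A homomorphism $\Phi:\mathrm{Br}^+(\widehat M)\to\mathrm{Br}^+(M)$ is standard if $\Phi(\widehat T_i)=T_{w_\circ^{[\Phi](i)}}$ for some subsets $[\Phi](i)\subset I$, $i\in\widehat I$; disjoint if $[\Phi](i)\cap[\Phi](j)=\emptyset$ for $i\neq j$; fully supported if $\bigcup_i[\Phi](i)=I$. For $x,y$ in a monoid let $B(x,y)$ be the set of $k\in\mathbb Z_{>0}$ with $xyx\cdots=yxy\cdots$ ($k$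 factors each). $\Phi$ is optimal if $\widehat m_{ij}=\min B(\Phi(\widehat T_i),\Phi(\widehat T_j))$ whenever $\Phi(\widehat T_i)\ne\Phi(\widehat T_j)$ and $B(\Phi(\widehat T_i),\Phi(\widehat T_j))\neq\emptyset$. The standard unfolding $\mathrm{Br}^+(B_r)\to\mathrm{Br}^+(A_{2r-1})$ is $T_i\mapsto T_iT_{2r-i}$ for $i\in[1,r-1]$, $T_r\mapsto T_r$; the standard unfolding $\mathrm{Br}^+(B_r)\to\mathrm{Br}^+(A_{2r})$ is $T_i\mapsto T_iT_{2r+1-i}$ for $i\in[1,r-1]$, $T_r\mapsto T_rT_{r+1}T_r$. *)

theory Defs
  imports "HOL-Algebra.Algebra" "HOL-Library.Extended_Nat" "HOL-Library.Disjoint_Sets"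
begin

section \<open>Monoids given by generators and relations\<close>

text \<open>Words over the generators \<open>I\<close> are lists; a relation \<open>u = v\<close> is a pair of words.\<close>

inductive_set word_cong :: "'a set \<Rightarrow> ('a list \<times> 'a list) set \<Rightarrow> ('a list \<times> 'a list) set"
  for I R where
  base: "(u, v) \<in> R \<Longrightarrow> u \<in> lists I \<Longrightarrow> v \<in> lists I \<Longrightarrow> (u, v) \<in> word_cong I R"
| refl: "u \<in> lists I \<Longrightarrow> (u, u) \<in> word_cong I R"
| sym: "(u, v) \<in> word_cong I R \<Longrightarrow> (v, u) \<in> word_cong I R"
| trans: "(u, v) \<in> word_cong I R \<Longrightarrow> (v, w) \<in> word_cong I R \<Longrightarrow> (u, w) \<in> word_cong I R"
| mult: "(u, v) \<in> word_cong I R \<Longrightarrow> (u', v') \<in> word_cong I R \<Longrightarrow> (u @ u', v @ v') \<in> word_cong I R"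

definition word_class :: "'a set \<Rightarrow> ('a list \<times> 'a list) set \<Rightarrow> 'a list \<Rightarrow> 'a list set" where
  "word_class I R u = word_cong I R `` {u}"

definition presented_monoid :: "'a set \<Rightarrow> ('a list \<times> 'a list) set \<Rightarrow> 'a list set monoid" where
  "presented_monoid I R =
    \<lparr>carrier = lists I // word_cong I R,
     monoid.mult = (\<lambda>x y. \<Union>u\<in>x. \<Union>v\<in>y. word_class I R (u @ v)),
     monoid.one = word_class I R []\<rparr>"

lemma word_cong_lists:
  "(u, v) \<in> word_cong I R \<Longrightarrow> u \<in> lists I \<and> v \<in> lists I"
  by (induction rule: word_cong.induct) auto

lemma equiv_word_cong: "equiv (lists I) (word_cong I R)"
  by (rule equivI)
     (auto simp: refl_on_def sym_def trans_def dest: word_cong_lists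
           intro: word_cong.refl word_cong.sym word_cong.trans)

lemma word_class_eq_iff:
  assumes "u \<in> lists I" "v \<in> lists I"
  shows "word_class I R u = word_class I R v \<longleftrightarrow> (u, v) \<in> word_cong I R"
  unfolding word_class_def using assms eq_equiv_class_iff[OF equiv_word_cong] by metis

lemma carrier_presented_monoid:
  "carrier (presented_monoid I R) = word_class I R ` lists I"
  by (auto simp: presented_monoid_def quotient_def word_class_def)

lemma one_presented_monoid: "\<one>\<^bsub>presented_monoid I R\<^esub> = word_class I R []"
  by (simp add: presented_monoid_def)

lemma mult_presented_monoid:
  assumes "u \<in> lists I" "v \<in> lists I"
  shows "word_class I R u \<otimes>\<^bsub>presented_monoid I R\<^esub> word_class I R v = word_class I R (u @ v)"
proof -
  have eq: "word_class I R (a @ b) = word_class I R (u @ v)"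
    if "a \<in> word_class I R u" "b \<in> word_class I R v" for a b
  proof -
    have "(u, a) \<in> word_cong I R" "(v, b) \<in> word_cong I R"
      using that by (auto simp: word_class_def)
    then have "(u @ v, a @ b) \<in> word_cong I R" by (rule word_cong.mult)
    then show ?thesis
      using equiv_class_eq[OF equiv_word_cong] unfolding word_class_def by metis
  qed
  have "u \<in> word_class I R u" "v \<in> word_class I R v"
    using assms by (auto simp: word_class_def intro: word_cong.refl)
  then have "(\<Union>a\<in>word_class I R u. \<Union>b\<in>word_class I R v. word_class I R (a @ b))
      = word_class I R (u @ v)"
    using eq by blast
  then show ?thesis by (simp add: presented_monoid_def)
qed

lemma monoid_presented_monoid: "Group.monoid (presented_monoid I R)"
proof (rule Group.monoid.intro, unfold carrier_presented_monoid one_presented_monoid)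
  fix x y z
  assume "x \<in> word_class I R ` lists I" "y \<in> word_class I R ` lists I"
  then show "x \<otimes>\<^bsub>presented_monoid I R\<^esub> y \<in> word_class I R ` lists I"
    by (elim imageE) (simp add: mult_presented_monoid append_in_lists_conv del: in_lists_conv_set)
next
  fix x y z
  assume "x \<in> word_class I R ` lists I" "y \<in> word_class I R ` lists I"
    "z \<in> word_class I R ` lists I"
  then show "x \<otimes>\<^bsub>presented_monoid I R\<^esub> y \<otimes>\<^bsub>presented_monoid I R\<^esub> z
      = x \<otimes>\<^bsub>presented_monoid I R\<^esub> (y \<otimes>\<^bsub>presented_monoid I R\<^esub> z)"
    by (elim imageE) (simp add: mult_presented_monoid append_in_lists_conv del: in_lists_conv_set)
next
  show "word_class I R [] \<in> word_class I R ` lists I" by auto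
next
  fix x
  assume "x \<in> word_class I R ` lists I"
  then show "word_class I R [] \<otimes>\<^bsub>presented_monoid I R\<^esub> x = x"
    and "x \<otimes>\<^bsub>presented_monoid I R\<^esub> word_class I R [] = x"
    using mult_presented_monoid[of "[]" I _ R] mult_presented_monoid[of _ I "[]" R] by auto
qed

definition monoid_hom :: "('a, 'c) monoid_scheme \<Rightarrow> ('b, 'd) monoid_scheme \<Rightarrow> ('a \<Rightarrow> 'b) set" where
  "monoid_hom G H = {h \<in> hom G H. h \<one>\<^bsub>G\<^esub> = \<one>\<^bsub>H\<^esub>}"


section \<open>Coxeter matrices, Coxeter groups and Artin monoids\<close>

definition coxeter_matrix :: "'a set \<Rightarrow> ('a \<Rightarrow> 'a \<Rightarrow> enat) \<Rightarrow> bool" where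
  "coxeter_matrix I M \<longleftrightarrow>
    finite I \<and>
    (\<forall>i\<in>I. M i i = 1) \<and>
    (\<forall>i\<in>I. \<forall>j\<in>I. M i j = M j i) \<and>
    (\<forall>i\<in>I. \<forall>j\<in>I. i \<noteq> j \<longrightarrow> 2 \<le> M i j)"

definition coxeter_graph :: "'a set \<Rightarrow> ('a \<Rightarrow> 'a \<Rightarrow> enat) \<Rightarrow> ('a \<times> 'a) set" where
  "coxeter_graph I M = {(i, j). i \<in> I \<and> j \<in> I \<and> i \<noteq> j \<and> 3 \<le> M i j}"

definition irreducible_coxeter :: "'a set \<Rightarrow> ('a \<Rightarrow> 'a \<Rightarrow> enat) \<Rightarrow> bool" where
  "irreducible_coxeter I M \<longleftrightarrow> I \<noteq> {} \<and> (\<forall>i\<in>I. \<forall>j\<in>I. (i, j) \<in> (coxeter_graph I M)\<^sup>*)"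

text \<open>The relations \<open>(s\<^sub>i s\<^sub>j)\<^sup>m = 1\<close> with \<open>m = m\<^sub>i\<^sub>j < \<infinity>\<close>. For \<open>i = j\<close> they say that the
  generators are involutions, so the monoid presented by them is the group presented by them.\<close>

definition coxeter_relations :: "'a set \<Rightarrow> ('a \<Rightarrow> 'a \<Rightarrow> enat) \<Rightarrow> ('a list \<times> 'a list) set" where
  "coxeter_relations I M =
    {(concat (replicate m [i, j]), []) | m i j. i \<in> I \<and> j \<in> I \<and> M i j = enat m}"

definition coxeter_group :: "'a set \<Rightarrow> ('a \<Rightarrow> 'a \<Rightarrow> enat) \<Rightarrow> 'a list set monoid" where
  "coxeter_group I M = presented_monoid I (coxeter_relations I M)"

definition coxeter_gen :: "'a set \<Rightarrow> ('a \<Rightarrow> 'a \<Rightarrow> enat) \<Rightarrow> 'a \<Rightarrow> 'a list set" where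
  "coxeter_gen I M i = word_class I (coxeter_relations I M) [i]"

lemma group_coxeter_group:
  assumes "coxeter_matrix I M"
  shows "Group.group (coxeter_group I M)"
proof -
  let ?R = "coxeter_relations I M"
  have invol: "([i, i], []) \<in> word_cong I ?R" if "i \<in> I" for i
  proof (rule word_cong.base)
    have "M i i = enat 1" using assms that by (simp add: coxeter_matrix_def one_enat_def)
    moreover have "concat (replicate 1 [i, i]) = [i, i]" by simp
    ultimately show "([i, i], []) \<in> ?R"
      unfolding coxeter_relations_def using that by (metis (mono_tags, lifting) mem_Collect_eq)
  qed (use that in auto)
  have rev: "(rev u @ u, []) \<in> word_cong I ?R" if "u \<in> lists I" for u
    using that
  proof (induction u)
    case Nil
    then show ?case by (auto intro: word_cong.refl)
  next
    case (Cons i u)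
    then have "i \<in> I" "u \<in> lists I" by auto
    then have "(rev u @ ([i, i] @ u), rev u @ ([] @ u)) \<in> word_cong I ?R"
      by (intro word_cong.mult invol word_cong.refl) auto
    then show ?case using Cons.IH by (auto intro: word_cong.trans)
  qed
  show ?thesis
  proof (rule monoid.group_l_invI)
    show "Group.monoid (coxeter_group I M)"
      unfolding coxeter_group_def by (rule monoid_presented_monoid)
  next
    fix x assume "x \<in> carrier (coxeter_group I M)"
    then obtain u where u: "u \<in> lists I" "x = word_class I ?R u"
      unfolding coxeter_group_def carrier_presented_monoid by auto
    moreover have "rev u \<in> lists I" using u(1) by auto
    moreover have "word_class I ?R (rev u @ u) = word_class I ?R []"
      by (subst word_class_eq_iff) (use u(1) rev in auto)
    ultimately show "\<exists>y\<in>carrier (coxeter_group I M).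
        y \<otimes>\<^bsub>coxeter_group I M\<^esub> x = \<one>\<^bsub>coxeter_group I M\<^esub>"
      unfolding coxeter_group_def carrier_presented_monoid one_presented_monoid
      using mult_presented_monoid[of "rev u" I u ?R] by blast
  qed
qed

definition finite_type :: "'a set \<Rightarrow> ('a \<Rightarrow> 'a \<Rightarrow> enat) \<Rightarrow> bool" where
  "finite_type I M \<longleftrightarrow> finite (carrier (coxeter_group I M))"

primrec alternating_word :: "nat \<Rightarrow> 'a \<Rightarrow> 'a \<Rightarrow> 'a list" where
  "alternating_word 0 i j = []"
| "alternating_word (Suc k) i j = i # alternating_word k j i"

definition artin_relations :: "'a set \<Rightarrow> ('a \<Rightarrow> 'a \<Rightarrow> enat) \<Rightarrow> ('a list \<times> 'a list) set" where
  "artin_relations I M =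
    {(alternating_word m i j, alternating_word m j i) | m i j.
       i \<in> I \<and> j \<in> I \<and> i \<noteq> j \<and> M i j = enat m}"

definition artin_monoid :: "'a set \<Rightarrow> ('a \<Rightarrow> 'a \<Rightarrow> enat) \<Rightarrow> 'a list set monoid" where
  "artin_monoid I M = presented_monoid I (artin_relations I M)"

definition artin_gen :: "'a set \<Rightarrow> ('a \<Rightarrow> 'a \<Rightarrow> enat) \<Rightarrow> 'a \<Rightarrow> 'a list set" where
  "artin_gen I M i = word_class I (artin_relations I M) [i]"


section \<open>Reduced expressions and longest elements\<close>

text \<open>An element of the Coxeter group is the set of all words representing it, so its reduced
  expressions are its members of minimal length.\<close>

definition coxeter_length :: "'a list set \<Rightarrow> nat" where
  "coxeter_length w = (LEAST k. \<exists>u\<in>w. length u = k)"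

definition reduced_expression :: "'a list set \<Rightarrow> 'a list \<Rightarrow> bool" where
  "reduced_expression w u \<longleftrightarrow> u \<in> w \<and> length u = coxeter_length w"

text \<open>\<open>T\<^sub>w\<close> does not depend on the reduced expression chosen (Matsumoto's theorem).\<close>

definition artin_lift :: "'a set \<Rightarrow> ('a \<Rightarrow> 'a \<Rightarrow> enat) \<Rightarrow> 'a list set \<Rightarrow> 'a list set" where
  "artin_lift I M w = word_class I (artin_relations I M) (SOME u. reduced_expression w u)"

definition parabolic :: "'a set \<Rightarrow> ('a \<Rightarrow> 'a \<Rightarrow> enat) \<Rightarrow> 'a set \<Rightarrow> 'a list set set" where
  "parabolic I M J = generate (coxeter_group I M) (coxeter_gen I M ` J)"

text \<open>Meaningful only if the parabolic subgroup is finite; the maximum is then attained at exactly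
  one element.\<close>

definition longest_element :: "'a set \<Rightarrow> ('a \<Rightarrow> 'a \<Rightarrow> enat) \<Rightarrow> 'a set \<Rightarrow> 'a list set" where
  "longest_element I M J = (ARG_MAX coxeter_length w. w \<in> parabolic I M J)"


section \<open>Standard homomorphisms\<close>

text \<open>The map \<open>K\<close> is the family of subsets \<open>[\<Phi>](i)\<close> of \<open>I\<close> witnessing that \<open>\<Phi>\<close> is standard.\<close>

definition standard_hom ::
  "'a set \<Rightarrow> ('a \<Rightarrow> 'a \<Rightarrow> enat) \<Rightarrow> 'b set \<Rightarrow> ('b \<Rightarrow> 'b \<Rightarrow> enat) \<Rightarrow>
   ('a list set \<Rightarrow> 'b list set) \<Rightarrow> ('a \<Rightarrow> 'b set) \<Rightarrow> bool" where
  "standard_hom I' M' I M \<Phi> K \<longleftrightarrow>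
    \<Phi> \<in> monoid_hom (artin_monoid I' M') (artin_monoid I M) \<and>
    (\<forall>i\<in>I'. K i \<subseteq> I \<and> finite (parabolic I M (K i)) \<and>
       \<Phi> (artin_gen I' M' i) = artin_lift I M (longest_element I M (K i)))"

primrec alternating_product :: "('a, 'c) monoid_scheme \<Rightarrow> nat \<Rightarrow> 'a \<Rightarrow> 'a \<Rightarrow> 'a" where
  "alternating_product G 0 x y = \<one>\<^bsub>G\<^esub>"
| "alternating_product G (Suc k) x y = x \<otimes>\<^bsub>G\<^esub> alternating_product G k y x"

definition braid_exponents :: "('a, 'c) monoid_scheme \<Rightarrow> 'a \<Rightarrow> 'a \<Rightarrow> nat set" where
  "braid_exponents G x y =
    {k. 0 < k \<and> alternating_product G k x y = alternating_product G k y x}"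

definition optimal_hom ::
  "'a set \<Rightarrow> ('a \<Rightarrow> 'a \<Rightarrow> enat) \<Rightarrow> 'b set \<Rightarrow> ('b \<Rightarrow> 'b \<Rightarrow> enat) \<Rightarrow>
   ('a list set \<Rightarrow> 'b list set) \<Rightarrow> bool" where
  "optimal_hom I' M' I M \<Phi> \<longleftrightarrow>
    (\<forall>i\<in>I'. \<forall>j\<in>I'.
      let x = \<Phi> (artin_gen I' M' i);
          y = \<Phi> (artin_gen I' M' j);
          B = braid_exponents (artin_monoid I M) x y
      in x \<noteq> y \<and> B \<noteq> {} \<longrightarrow> M' i j = enat (LEAST k. k \<in> B))"


section \<open>Types A and B\<close>

text \<open>The entries for \<open>A\<^sub>n\<close> do not depend on \<open>n\<close>.\<close>

definition matrix_A :: "nat \<Rightarrow> nat \<Rightarrow> enat" where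
  "matrix_A i j = (if i = j then 1 else if j = i + 1 \<or> i = j + 1 then 3 else 2)"

definition matrix_B :: "nat \<Rightarrow> nat \<Rightarrow> nat \<Rightarrow> enat" where
  "matrix_B n i j =
    (if i = j then 1
     else if {i, j} = {n - 1, n} then 4
     else if j = i + 1 \<or> i = j + 1 then 3
     else 2)"

text \<open>A labelling identifies a Coxeter matrix over \<open>I\<close> with the standard one over \<open>[1,n]\<close>; the
  identity labelling expresses equality with it.\<close>

definition labelling_A ::
  "nat \<Rightarrow> (nat \<Rightarrow> 'a) \<Rightarrow> 'a set \<Rightarrow> ('a \<Rightarrow> 'a \<Rightarrow> enat) \<Rightarrow> bool" where
  "labelling_A n \<tau> I M \<longleftrightarrow> 1 \<le> n \<and> bij_betw \<tau> {1..n} I \<and>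
    (\<forall>i\<in>{1..n}. \<forall>j\<in>{1..n}. M (\<tau> i) (\<tau> j) = matrix_A i j)"

definition labelling_B ::
  "nat \<Rightarrow> (nat \<Rightarrow> 'a) \<Rightarrow> 'a set \<Rightarrow> ('a \<Rightarrow> 'a \<Rightarrow> enat) \<Rightarrow> bool" where
  "labelling_B n \<tau> I M \<longleftrightarrow> 2 \<le> n \<and> bij_betw \<tau> {1..n} I \<and>
    (\<forall>i\<in>{1..n}. \<forall>j\<in>{1..n}. M (\<tau> i) (\<tau> j) = matrix_B n i j)"

definition type_A :: "'a set \<Rightarrow> ('a \<Rightarrow> 'a \<Rightarrow> enat) \<Rightarrow> bool" where
  "type_A I M \<longleftrightarrow> (\<exists>n \<tau>. labelling_A n \<tau> I M)"

definition type_B :: "'a set \<Rightarrow> ('a \<Rightarrow> 'a \<Rightarrow> enat) \<Rightarrow> bool" where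
  "type_B I M \<longleftrightarrow> (\<exists>n \<tau>. labelling_B n \<tau> I M)"

text \<open>For a labelling \<open>\<sigma>\<close> of \<open>M\<close> as \<open>B\<^sub>m\<close>, and \<open>\<rho>\<close> of \<open>N\<close> as \<open>B\<^sub>r\<close>: the homomorphism
  sending \<open>T\<^sub>i\<close> to \<open>T\<^sub>i\<close> for \<open>i < m\<close> and \<open>T\<^sub>m\<close> to the lift of the longest element of the parabolic
  subgroup on \<open>[m,r]\<close>.\<close>

definition is_B_to_B ::
  "nat \<Rightarrow> (nat \<Rightarrow> 'a) \<Rightarrow> 'a set \<Rightarrow> ('a \<Rightarrow> 'a \<Rightarrow> enat) \<Rightarrow>
   nat \<Rightarrow> (nat \<Rightarrow> 'b) \<Rightarrow> 'b set \<Rightarrow> ('b \<Rightarrow> 'b \<Rightarrow> enat) \<Rightarrow> ('a list set \<Rightarrow> 'b list set) \<Rightarrow> bool" where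
  "is_B_to_B m \<sigma> I M r \<rho> J N \<Psi> \<longleftrightarrow>
    \<Psi> \<in> monoid_hom (artin_monoid I M) (artin_monoid J N) \<and>
    (\<forall>i\<in>{1..m - 1}. \<Psi> (artin_gen I M (\<sigma> i)) = artin_gen J N (\<rho> i)) \<and>
    \<Psi> (artin_gen I M (\<sigma> m)) = artin_lift J N (longest_element J N (\<rho> ` {m..r}))"

text \<open>The two standard unfoldings out of \<open>B\<^sub>r\<close> over \<open>[1,r]\<close>, with \<open>\<tau>\<close> labelling the target as
  \<open>A\<^sub>n\<close>, where \<open>n = 2r - 1\<close> or \<open>n = 2r\<close>.\<close>

definition is_standard_unfolding ::
  "nat \<Rightarrow> nat \<Rightarrow> (nat \<Rightarrow> 'b) \<Rightarrow> 'b set \<Rightarrow> ('b \<Rightarrow> 'b \<Rightarrow> enat) \<Rightarrow>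
   (nat list set \<Rightarrow> 'b list set) \<Rightarrow> bool" where
  "is_standard_unfolding r n \<tau> I M U \<longleftrightarrow>
    (let S = artin_gen {1..r} (matrix_B r);
         G = artin_monoid I M;
         T = (\<lambda>i. artin_gen I M (\<tau> i))
     in U \<in> monoid_hom (artin_monoid {1..r} (matrix_B r)) G \<and>
       (n = 2 * r - 1 \<and>
          (\<forall>i\<in>{1..r - 1}. U (S i) = T i \<otimes>\<^bsub>G\<^esub> T (2 * r - i)) \<and>
          U (S r) = T r
        \<or> n = 2 * r \<and>
          (\<forall>i\<in>{1..r - 1}. U (S i) = T i \<otimes>\<^bsub>G\<^esub> T (2 * r + 1 - i)) \<and>
          U (S r) = T r \<otimes>\<^bsub>G\<^esub> T (r + 1) \<otimes>\<^bsub>G\<^esub> T r))"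

end

theory Submission
  imports Defs "HOL-Combinatorics.Permutations"
begin

text \<open>Label the nodes of \<open>A\<^sub>n\<close> by \<open>1..n\<close> and colour the node \<open>p\<close> by the \<open>i \<in> I'\<close> with \<open>p \<in> [\<Phi>](i)\<close>.
  The element \<open>\<Phi>(T\<^sub>i)\<close> is a diagram of strands that reverses every maximal run of the colour \<open>i\<close>.
  Both the permutation of the strands and the number of crossings of any two of them are invariant
  under the braid relations of \<open>A\<^sub>n\<close>, so the relations between \<open>\<Phi>(T\<^sub>i)\<close> and \<open>\<Phi>(T\<^sub>j)\<close> for
  \<open>m\<^sub>i\<^sub>j \<le> 5\<close> restrict how runs of the colours \<open>i\<close> and \<open>j\<close> may be adjacent, while optimality makes
  every edge of the source visible as an adjacency. The Tits form of a finite Coxeter group is positive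
  definite, which excludes labels above \<open>5\<close>, cycles, and two labels at least \<open>4\<close>. Together these facts
  leave only two colourings: a bijective one, where \<open>\<Phi>\<close> is an isomorphism of type \<open>A\<close>, and a
  palindromic one, where the source is of type \<open>B\<close>.

  A target of type \<open>B\<^sub>n\<close> is unfolded to \<open>A\<^sub>2\<^sub>n\<^sub>-\<^sub>1\<close>, where the colouring is palindromic by
  construction. The two homomorphisms of part (c) agree on generators because a longest word is
  determined up to braid moves by its letters and its descents.\<close>


section \<open>Reduced words\<close>

text \<open>Permutations alone do not control a label 3. If a run of two nodes \<open>p - 1\<close>,
  \<open>p\<close> meets the single node \<open>p + 1\<close>, the two reversals act on the strands
  as the transpositions (p-1, p+1) and (p+1, p+2). These satisfy the braid relation in the symmetric
  group but not in the monoid, and counting crossings detects the difference. For the labels 4 and 5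
  permutations are enough. Types D, E, F and H also have a positive definite form. They are excluded
  by the shape of the target: a node on a path has only two sides, while a label 3 demands the other
  colour beside every node of the first, and a strong label demands the same colour at both ends of
  a run. The longest element is an ARG_MAX and its lift uses SOME, so every statement about \<Phi>
  passes through Matsumoto's theorem, proved for an abstract model that both types instantiate. Type
  B is realised by centrally symmetric permutations of \<open>2 * r\<close> or
  \<open>2 * r + 1\<close> points; this yields a faithful model and both unfoldings at once.\<close>

lemma word_cong_in_context:
  assumes "(u, v) \<in> word_cong I R" "a \<in> lists I" "b \<in> lists I"
  shows "(a @ u @ b, a @ v @ b) \<in> word_cong I R"
  using assms by (intro word_cong.mult word_cong.refl)

lemma word_cong_append_cancel:
  assumes "(v, []) \<in> word_cong I R" "u \<in> lists I"
  shows "(u @ v, u) \<in> word_cong I R"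
  using word_cong.mult[OF word_cong.refl[OF assms(2), of R] assms(1)] by simp

lemma alternating_word_in_lists: "i \<in> I \<Longrightarrow> j \<in> I \<Longrightarrow> alternating_word m i j \<in> lists I"
  by (induction m arbitrary: i j) auto

lemma length_alternating_word [simp]: "length (alternating_word m i j) = m"
  by (induction m arbitrary: i j) auto

lemma set_alternating_word: "2 \<le> m \<Longrightarrow> set (alternating_word m i j) = {i, j}"
proof -
  have sub: "set (alternating_word k i j) \<subseteq> {i, j}" for k i j
    by (induction k arbitrary: i j) fastforce+
  assume "2 \<le> m"
  then obtain k where "m = Suc (Suc k)" by (metis add_2_eq_Suc le_Suc_ex)
  then show ?thesis using sub[of k i j] by auto
qed

lemma alternating_word_add:
  "alternating_word (m + k) i j =
    alternating_word m i j @ (if even m then alternating_word k i j else alternating_word k j i)"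
  by (induction m arbitrary: i j) auto

lemma alternating_word_snoc:
  "alternating_word (Suc m) i j = alternating_word m i j @ [if even m then i else j]"
  using alternating_word_add[of m 1 i j] by auto

lemma rev_alternating_word:
  "rev (alternating_word m i j) = (if even m then alternating_word m j i else alternating_word m i j)"
proof (induction m arbitrary: i j)
  case (Suc m)
  have "rev (alternating_word (Suc m) i j) = (if even m then i else j) # rev (alternating_word m i j)"
    by (subst alternating_word_snoc) simp
  then show ?case using Suc[of i j] by auto
qed simp

text \<open>Reversal inverts a word in a Coxeter group, so this splits the relator (ij)^m into the
  two sides of the braid relation. Both parities of \<open>m\<close> are covered: the reversed word
  starts with the letter that continues the alternation.\<close>

lemma concat_replicate_eq_alternating_word:
  "concat (replicate m [i, j]) = alternating_word m i j @ rev (alternating_word m j i)"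
proof -
  have "concat (replicate m [i, j]) = alternating_word (m + m) i j"
    by (induction m) auto
  then show ?thesis by (simp add: alternating_word_add rev_alternating_word)
qed

lemma coxeter_relation_square:
  assumes "coxeter_matrix I M" "i \<in> I"
  shows "([i, i], []) \<in> word_cong I (coxeter_relations I M)"
proof (rule word_cong.base)
  have "M i i = enat 1" using assms by (simp add: coxeter_matrix_def one_enat_def)
  moreover have "concat (replicate 1 [i, i]) = [i, i]" by simp
  ultimately show "([i, i], []) \<in> coxeter_relations I M"
    unfolding coxeter_relations_def using assms(2) by (metis (mono_tags, lifting) mem_Collect_eq)
qed (use assms in auto)

lemma coxeter_rev_append:
  assumes "coxeter_matrix I M" "u \<in> lists I"
  shows "(rev u @ u, []) \<in> word_cong I (coxeter_relations I M)"
  using assms(2)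
proof (induction u)
  case Nil
  then show ?case by (auto intro: word_cong.refl)
next
  case (Cons i u)
  then have "i \<in> I" "u \<in> lists I" by auto
  then have "(rev u @ [i, i] @ u, rev u @ [] @ u) \<in> word_cong I (coxeter_relations I M)"
    by (intro word_cong_in_context coxeter_relation_square assms) auto
  then show ?case using Cons.IH by (auto intro: word_cong.trans)
qed

text \<open>For a braid relation \<open>u = v\<close> the word \<open>u @ rev v\<close> is a Coxeter
  relator; multiplying by \<open>v\<close> on the right and cancelling \<open>rev v @ v\<close>
  gives the claim.\<close>

lemma artin_cong_imp_coxeter_cong:
  assumes cox: "coxeter_matrix I M" and "(u, v) \<in> word_cong I (artin_relations I M)"
  shows "(u, v) \<in> word_cong I (coxeter_relations I M)"
  using assms(2)
proof induction
  case (base u v)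
  then obtain m i j where m: "u = alternating_word m i j" "v = alternating_word m j i"
      "i \<in> I" "j \<in> I" "M i j = enat m"
    by (auto simp: artin_relations_def)
  have "(u @ rev v, []) \<in> coxeter_relations I M"
    unfolding coxeter_relations_def m(1,2) concat_replicate_eq_alternating_word[symmetric]
    using m by blast
  then have uv: "(u @ rev v, []) \<in> word_cong I (coxeter_relations I M)"
    using base by (intro word_cong.base) auto
  have "(u @ rev v @ v, u @ []) \<in> word_cong I (coxeter_relations I M)"
    using base by (intro word_cong.mult coxeter_rev_append cox word_cong.refl) auto
  moreover have "((u @ rev v) @ v, [] @ v) \<in> word_cong I (coxeter_relations I M)"
    using base uv by (intro word_cong.mult word_cong.refl) auto
  ultimately show ?case
    using word_cong.trans[OF word_cong.sym] by simp
qed (blast intro: word_cong.intros)+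

text \<open>Both sides of a braid relation have \<open>m\<close> letters and, because
  \<open>2 \<le> m\<close>, contain both generators. The invariant support later separates images
  under \<Phi>; the invariant length drives inductions on words.\<close>

lemma artin_cong_length_set:
  assumes "coxeter_matrix I M" "(u, v) \<in> word_cong I (artin_relations I M)"
  shows "length u = length v \<and> set u = set v"
  using assms(2)
proof induction
  case (base u v)
  then obtain m i j where m: "u = alternating_word m i j" "v = alternating_word m j i"
      "i \<in> I" "j \<in> I" "i \<noteq> j" "M i j = enat m"
    by (auto simp: artin_relations_def)
  moreover have "2 \<le> m" using assms(1) m unfolding coxeter_matrix_def
    by (metis enat_ord_simps(1) numeral_eq_enat)
  ultimately show ?case by (simp add: set_alternating_word insert_commute)
qed auto

section \<open>Models of Coxeter groups and Matsumoto's theorem\<close>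

text \<open>The states are the elements of a faithful image of the Coxeter group, and \<open>asc w i\<close> says
  that \<open>i\<close> is not a right descent of \<open>w\<close>.\<close>

locale braid_model =
  fixes I :: "'b set" and M :: "'b \<Rightarrow> 'b \<Rightarrow> enat"
    and S :: "'w set" and e :: 'w and act :: "'w \<Rightarrow> 'b \<Rightarrow> 'w" and asc :: "'w \<Rightarrow> 'b \<Rightarrow> bool"
    and \<mu> :: "'w \<Rightarrow> nat"
  assumes coxeter: "coxeter_matrix I M"
    and e_in_S: "e \<in> S"
    and act_in_S: "w \<in> S \<Longrightarrow> i \<in> I \<Longrightarrow> act w i \<in> S"
    and act_act: "w \<in> S \<Longrightarrow> i \<in> I \<Longrightarrow> act (act w i) i = w"
    and asc_act: "w \<in> S \<Longrightarrow> i \<in> I \<Longrightarrow> asc (act w i) i \<longleftrightarrow> \<not> asc w i"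
    and decreasing: "w \<in> S \<Longrightarrow> i \<in> I \<Longrightarrow> \<not> asc w i \<Longrightarrow> \<mu> (act w i) < \<mu> w"
    and asc_e: "i \<in> I \<Longrightarrow> asc e i"
    and all_asc_imp_e: "w \<in> S \<Longrightarrow> (\<And>i. i \<in> I \<Longrightarrow> asc w i) \<Longrightarrow> w = e"
    and braid: "w \<in> S \<Longrightarrow> i \<in> I \<Longrightarrow> j \<in> I \<Longrightarrow> i \<noteq> j \<Longrightarrow> M i j = enat m \<Longrightarrow>
      foldl act w (alternating_word m i j) = foldl act w (alternating_word m j i)"
    and dihedral: "w \<in> S \<Longrightarrow> i \<in> I \<Longrightarrow> j \<in> I \<Longrightarrow> i \<noteq> j \<Longrightarrow> \<not> asc w i \<Longrightarrow> \<not> asc w j \<Longrightarrow>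
      \<exists>m. M i j = enat m \<and>
        (\<forall>k<m. \<not> asc (foldl act w (alternating_word k i j)) (if even k then i else j))"
begin

text \<open>Every letter is an ascent when it is read. That \<open>red u\<close> means reduced in
  the Coxeter group is a theorem: see \<open>coxeter_length_red\<close> and
  \<open>reduced_expression_imp_red\<close>.\<close>

primrec red_from :: "'w \<Rightarrow> 'b list \<Rightarrow> bool" where
  "red_from w [] = True"
| "red_from w (i # u) \<longleftrightarrow> asc w i \<and> red_from (act w i) u"

abbreviation red :: "'b list \<Rightarrow> bool" where "red \<equiv> red_from e"
abbreviation state :: "'b list \<Rightarrow> 'w" where "state \<equiv> foldl act e"
abbreviation acong :: "('b list \<times> 'b list) set" where
  "acong \<equiv> word_cong I (artin_relations I M)"
abbreviation ccong :: "('b list \<times> 'b list) set" where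
  "ccong \<equiv> word_cong I (coxeter_relations I M)"

lemma red_from_append: "red_from w (u @ v) \<longleftrightarrow> red_from w u \<and> red_from (foldl act w u) v"
  by (induction u arbitrary: w) auto

lemma foldl_act_in_S: "w \<in> S \<Longrightarrow> u \<in> lists I \<Longrightarrow> foldl act w u \<in> S"
  by (induction u arbitrary: w) (auto simp: act_in_S)

lemma foldl_act_rev: "w \<in> S \<Longrightarrow> u \<in> lists I \<Longrightarrow> foldl act (foldl act w u) (rev u) = w"
  by (induction u arbitrary: w) (auto simp: act_in_S act_act)

text \<open>A walk down through descents, read backwards from its end, is a walk up through
  ascents.\<close>

lemma red_from_rev:
  assumes "w \<in> S" "u \<in> lists I" "\<And>k. k < length u \<Longrightarrow> \<not> asc (foldl act w (take k u)) (u ! k)"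
  shows "red_from (foldl act w u) (rev u)"
  using assms
proof (induction u arbitrary: w)
  case (Cons i u)
  have i: "i \<in> I" and u: "u \<in> lists I" using Cons.prems by auto
  have "\<not> asc w i" using Cons.prems(3)[of 0] by simp
  moreover have "red_from (foldl act (act w i) u) (rev u)"
    using Cons.prems(3)[of "Suc k" for k] Cons.prems(1) i u
    by (intro Cons.IH act_in_S) (auto simp: act_in_S)
  ultimately show ?case
    using Cons.prems i u by (simp add: red_from_append foldl_act_rev act_in_S asc_act)
qed simp

lemma red_snocD:
  assumes "red (u @ [i])" "u @ [i] \<in> lists I"
  shows "red u" "\<not> asc (state (u @ [i])) i" "act (state (u @ [i])) i = state u"
  using assms by (auto simp: red_from_append foldl_act_in_S e_in_S asc_act act_act)

lemma red_state_e:
  assumes "red u" "u \<in> lists I" "state u = e"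
  shows "u = []"
  using assms
proof (cases u rule: rev_cases)
  case (snoc v i)
  then show ?thesis using red_snocD(2)[of v i] assms asc_e by auto
qed auto

text \<open>Strip descents from the right; \<open>\<mu>\<close> bounds the number of steps, and
  \<open>e\<close> is the only state left without a descent.\<close>

lemma ex_red:
  assumes "w \<in> S"
  obtains u where "u \<in> lists I" "red u" "state u = w"
proof -
  have "\<exists>u\<in>lists I. red u \<and> state u = w"
    using assms
  proof (induction w rule: measure_induct_rule[of \<mu>])
    case (less w)
    show ?case
    proof (cases "\<forall>i\<in>I. asc w i")
      case True
      then have "w = e" using less by (intro all_asc_imp_e) auto
      then show ?thesis by (intro bexI[of _ "[]"]) auto
    next
      case False
      then obtain i where i: "i \<in> I" "\<not> asc w i" by auto
      then obtain u where "u \<in> lists I" "red u" "state u = act w i"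
        using less.IH[of "act w i"] less.prems by (auto simp: decreasing act_in_S)
      then show ?thesis using i less.prems
        by (intro bexI[of _ "u @ [i]"]) (auto simp: red_from_append act_act asc_act)
    qed
  qed
  then show thesis using that by auto
qed

text \<open>If the last letters \<open>i\<close>, \<open>j\<close> differ, both are descents of the
  common state \<open>w\<close>, so \<open>dihedral\<close> strips a full alternating word of length
  \<open>m\<close> from \<open>w\<close>. Put back onto a reduced word \<open>t\<close> of the rest
  \<open>w'\<close>, it yields reduced words of \<open>w\<close> ending in \<open>i\<close> and in
  \<open>j\<close> that differ by one braid relation; induction compares them with \<open>u\<close>
  and \<open>v\<close>.\<close>

theorem matsumoto:
  assumes "u \<in> lists I" "v \<in> lists I" "red u" "red v" "state u = state v"
  shows "(u, v) \<in> acong"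
  using assms
proof (induction u arbitrary: v rule: length_induct)
  case (1 u)
  note IH = 1(1)[rule_format] and uv = 1(2-)
  have IH': "(x, y) \<in> acong" if "x \<in> lists I" "y \<in> lists I" "red x" "red y" "state x = state y"
    "length x < length u" for x y using IH that by blast
  show ?case
  proof (cases u rule: rev_cases)
    case Nil
    then have "v = []" using red_state_e[of v] uv by simp
    then show ?thesis using Nil by (auto intro: word_cong.refl)
  next
    case (snoc u' i)
    have "v \<noteq> []" using red_state_e[of u] uv snoc by auto
    then obtain v' j where v: "v = v' @ [j]" by (cases v rule: rev_cases) auto
    have mem: "u' \<in> lists I" "i \<in> I" "v' \<in> lists I" "j \<in> I" using uv snoc v by auto
    define w where "w = state u"
    have w: "w \<in> S" "state v = w" using uv by (auto simp: w_def foldl_act_in_S e_in_S)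
    have u': "red u'" "\<not> asc w i" "state u' = act w i"
      using red_snocD[of u' i, folded snoc] uv by (auto simp: w_def)
    have v': "red v'" "\<not> asc w j" "state v' = act w j"
      using red_snocD[of v' j, folded v] uv w by auto
    show ?thesis
    proof (cases "i = j")
      case True
      then have "(u', v') \<in> acong" using mem u' v' snoc by (intro IH') auto
      then show ?thesis unfolding snoc v True using mem
        by (intro word_cong.mult word_cong.refl) auto
    next
      case False
      obtain m where m: "M i j = enat m"
        and desc_ij: "\<And>k. k < m \<Longrightarrow> \<not> asc (foldl act w (alternating_word k i j)) (if even k then i else j)"
        using dihedral[of w i j] w mem u' v' False by blast
      have mji: "M j i = enat m" using m coxeter mem by (auto simp: coxeter_matrix_def)
      then have desc_ji:
        "\<And>k. k < m \<Longrightarrow> \<not> asc (foldl act w (alternating_word k j i)) (if even k then j else i)"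
        using dihedral[of w j i] w mem u' v' False by force
      have "2 \<le> m" using coxeter m mem False unfolding coxeter_matrix_def
        by (metis enat_ord_simps(1) numeral_eq_enat)
      then obtain l where l: "m = Suc l" by (cases m) auto
      let ?a = "alternating_word m i j" and ?b = "alternating_word m j i"
      have ab: "?a \<in> lists I" "?b \<in> lists I" by (rule alternating_word_in_lists; fact)+
      \<comment> \<open>Both alternating words lead down to the same state \<open>w'\<close>, which
        lets one word \<open>t\<close> serve both sides.\<close>
      define w' where "w' = foldl act w ?a"
      have w'b: "w' = foldl act w ?b"
        unfolding w'_def using braid w mem m False by blast
      have w'S: "w' \<in> S" using w ab by (auto simp: w'_def foldl_act_in_S)
      have take: "take k (alternating_word m i j) = alternating_word k i j"
        "k < m \<Longrightarrow> alternating_word m i j ! k = (if even k then i else j)" if "k \<le> m" for k i j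
      proof -
        show tk: "take k (alternating_word m i j) = alternating_word k i j"
          using that alternating_word_add[of k "m - k" i j] by simp
        show "k < m \<Longrightarrow> alternating_word m i j ! k = (if even k then i else j)"
          using alternating_word_add[of k "Suc (m - k - 1)" i j] by (auto simp: nth_append)
      qed
      have ra: "red_from w' (rev ?a)" unfolding w'_def
        using w ab desc_ij by (intro red_from_rev) (auto simp: take)
      have rb: "red_from w' (rev ?b)" unfolding w'b
        using w ab desc_ji by (intro red_from_rev) (auto simp: take)
      obtain t where t: "t \<in> lists I" "red t" "state t = w'" using ex_red w'S by blast
      define a' b' where "a' = rev (alternating_word l j i)" and "b' = rev (alternating_word l i j)"
      have reva: "rev ?a = a' @ [i]" and revb: "rev ?b = b' @ [j]"
        by (auto simp: a'_def b'_def l)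
      have ab': "a' \<in> lists I" "b' \<in> lists I"
        using mem alternating_word_in_lists[of j I i l] alternating_word_in_lists[of i I j l]
        by (auto simp: a'_def b'_def)
      have sa: "foldl act w' (rev ?a) = w" unfolding w'_def using w ab by (intro foldl_act_rev)
      have sb: "foldl act w' (rev ?b) = w" unfolding w'b using w ab by (intro foldl_act_rev)
      have ta: "red (t @ a' @ [i])" "state (t @ a' @ [i]) = w"
        using t ra sa by (simp_all add: reva red_from_append)
      have tb: "red (t @ b' @ [j])" "state (t @ b' @ [j]) = w"
        using t rb sb by (simp_all add: revb red_from_append)
      have ta': "red (t @ a')" "state (t @ a') = act w i"
        using red_snocD[of "t @ a'" i] ta t(1) ab' mem by auto
      have tb': "red (t @ b')" "state (t @ b') = act w j"
        using red_snocD[of "t @ b'" j] tb t(1) ab' mem by auto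
      have "(u', t @ a') \<in> acong"
        using mem u' ta' t(1) ab' snoc by (intro IH') auto
      then have ua: "(u' @ [i], (t @ a') @ [i]) \<in> acong"
        using mem by (intro word_cong.mult word_cong.refl) auto
      \<comment> \<open>The length of \<open>v\<close> is not known to agree with that of
        \<open>u\<close>. The first comparison bounds \<open>t @ b'\<close>, so that the induction
        hypothesis, which measures its first word only, applies to it.\<close>
      then have "length u = length (t @ a' @ [i])"
        using artin_cong_length_set[OF coxeter] snoc by fastforce
      then have "length (t @ b') < length u" by (simp add: a'_def b'_def)
      then have "(t @ b', v') \<in> acong"
        using mem v' tb' t(1) ab' by (intro IH') auto
      then have vb: "((t @ b') @ [j], v' @ [j]) \<in> acong"
        using mem by (intro word_cong.mult word_cong.refl) auto
      have "(rev ?a, rev ?b) \<in> acong"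
      proof -
        have "(?a, ?b) \<in> acong" using ab m mem False
          by (intro word_cong.base) (auto simp: artin_relations_def)
        then show ?thesis by (auto simp: rev_alternating_word intro: word_cong.sym)
      qed
      then have "(t @ rev ?a, t @ rev ?b) \<in> acong"
        using t by (intro word_cong.mult word_cong.refl)
      then show ?thesis unfolding snoc v
        using word_cong.trans[OF ua word_cong.trans[OF _ vb]] unfolding reva revb by simp
    qed
  qed
qed

lemma foldl_act_ccong:
  assumes "(u, v) \<in> ccong" "w \<in> S"
  shows "foldl act w u = foldl act w v"
  using assms
proof (induction arbitrary: w)
  case (base u v)
  then obtain m i j where m: "u = concat (replicate m [i, j])" "v = []"
      "i \<in> I" "j \<in> I" "M i j = enat m"
    by (auto simp: coxeter_relations_def)
  show ?case
  proof (cases "i = j")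
    case True
    then have "m = 1" using m coxeter by (auto simp: coxeter_matrix_def one_enat_def)
    then show ?thesis using m True base by (simp add: act_act)
  next
    case False
    then have "foldl act w (alternating_word m i j) = foldl act w (alternating_word m j i)"
      using braid base m by blast
    then show ?thesis
      unfolding m(1,2) concat_replicate_eq_alternating_word
      using foldl_act_rev[OF base.prems, of "alternating_word m j i"] m
      by (auto simp: alternating_word_in_lists)
  qed
next
  case (mult u v u' v')
  then show ?case using word_cong_lists[of u v] by (auto simp: foldl_act_in_S)
qed auto

text \<open>If the next letter is a descent of the reduced word \<open>r\<close>, Matsumoto's
  theorem moves that letter to the end of \<open>r\<close>, where it cancels. Braid moves keep the
  set of letters, so the result stays over \<open>J\<close>; the alternative in the conclusion
  identifies \<open>red\<close> words as those of minimal length.\<close>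

lemma reduce:
  assumes "u \<in> lists J" "J \<subseteq> I"
  shows "\<exists>r\<in>lists J. red r \<and> (u, r) \<in> ccong \<and> (red u \<and> length r = length u \<or> length r < length u)"
  using assms(1)
proof (induction u rule: rev_induct)
  case Nil
  then show ?case by (auto intro: word_cong.refl)
next
  case (snoc i u)
  then obtain r where r: "r \<in> lists J" "red r" "(u, r) \<in> ccong"
      "red u \<and> length r = length u \<or> length r < length u" by auto
  have i: "i \<in> J" "i \<in> I" using snoc assms by auto
  have rI: "r \<in> lists I" using r(1) assms by auto
  have st: "state u = state r" using r e_in_S by (intro foldl_act_ccong)
  have ur: "(u @ [i], r @ [i]) \<in> ccong" using r i by (intro word_cong.mult word_cong.refl) auto
  show ?case
  proof (cases "asc (state r) i")
    case True
    then show ?thesis using r i ur st by (intro bexI[of _ "r @ [i]"]) (auto simp: red_from_append)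
  next
    case False
    have rS: "state r \<in> S" using rI e_in_S by (intro foldl_act_in_S)
    then obtain t where t: "t \<in> lists I" "red t" "state t = act (state r) i"
      using ex_red act_in_S i by blast
    then have ti: "(t @ [i], r) \<in> acong"
      using rS i rI r False by (intro matsumoto) (auto simp: red_from_append asc_act act_act)
    then have "set (t @ [i]) = set r" "length (t @ [i]) = length r"
      using artin_cong_length_set[OF coxeter ti] by auto
    moreover have "(u @ [i], t) \<in> ccong"
    proof -
      have "((t @ [i]) @ [i], r @ [i]) \<in> ccong"
        using ti i by (intro word_cong.mult artin_cong_imp_coxeter_cong coxeter word_cong.refl) auto
      moreover have "(t @ [i, i], t) \<in> ccong"
        using t i by (intro word_cong_append_cancel coxeter_relation_square coxeter)
      ultimately show ?thesis
        using word_cong.trans[OF word_cong.trans[OF ur word_cong.sym]] by simp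
    qed
    ultimately have "t \<in> lists J" "red t" "(u @ [i], t) \<in> ccong" "length t < length (u @ [i])"
      using t r by auto
    then show ?thesis by (intro bexI[of _ t] conjI disjI2)
  qed
qed

lemma red_ccong_imp_acong:
  assumes "(u, v) \<in> ccong" "red u" "red v"
  shows "(u, v) \<in> acong"
  using assms word_cong_lists[OF assms(1)] foldl_act_ccong[OF assms(1) e_in_S]
  by (intro matsumoto) auto

lemma coxeter_length_red:
  assumes "r \<in> lists I" "red r"
  shows "coxeter_length (word_class I (coxeter_relations I M) r) = length r"
  unfolding coxeter_length_def
proof (rule Least_equality)
  show "\<exists>u\<in>word_class I (coxeter_relations I M) r. length u = length r"
    using assms by (intro bexI[of _ r]) (auto simp: word_class_def intro: word_cong.refl)
next
  fix k assume "\<exists>u\<in>word_class I (coxeter_relations I M) r. length u = k"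
  then obtain u where u: "(r, u) \<in> ccong" "length u = k" by (auto simp: word_class_def)
  then obtain r' where r': "red r'" "(u, r') \<in> ccong" "length r' \<le> length u"
    using reduce[of u I] word_cong_lists[OF u(1)] by auto
  then have "(r, r') \<in> acong" using assms u
    by (intro red_ccong_imp_acong) (auto intro: word_cong.trans)
  then show "length r \<le> k" using r' u artin_cong_length_set[OF coxeter] by fastforce
qed

lemma reduced_expression_imp_red:
  assumes "r \<in> lists I" "red r" "reduced_expression (word_class I (coxeter_relations I M) r) u"
  shows "red u" "(r, u) \<in> ccong"
proof -
  show ru: "(r, u) \<in> ccong" using assms by (auto simp: reduced_expression_def word_class_def)
  have len: "length u = length r"
    using assms coxeter_length_red by (auto simp: reduced_expression_def)
  obtain r' where r': "red r'" "(u, r') \<in> ccong" "red u \<or> length r' < length u"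
    using reduce[of u I] word_cong_lists[OF ru] by auto
  then have "(r, r') \<in> acong" using assms ru
    by (intro red_ccong_imp_acong) (auto intro: word_cong.trans)
  then show "red u" using r' len artin_cong_length_set[OF coxeter] by fastforce
qed

text \<open>The reduced expression picked by SOME is \<open>red\<close> and represents the same
  group element as \<open>r\<close>, so Matsumoto's theorem makes the choice immaterial.\<close>

lemma artin_lift_red:
  assumes "r \<in> lists I" "red r"
  shows "artin_lift I M (word_class I (coxeter_relations I M) r) = word_class I (artin_relations I M) r"
proof -
  let ?w = "word_class I (coxeter_relations I M) r"
  have "reduced_expression ?w r" using assms coxeter_length_red
    by (auto simp: reduced_expression_def word_class_def intro: word_cong.refl)
  then have *: "reduced_expression ?w (SOME u. reduced_expression ?w u)" by (rule someI)
  note ** = reduced_expression_imp_red[OF assms *]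
  show ?thesis unfolding artin_lift_def
    using word_cong_lists[OF **(2)] red_ccong_imp_acong[OF **(2) assms(2) **(1)] assms
    by (subst word_class_eq_iff) (auto intro: word_cong.sym)
qed

text \<open>The generators are involutions, so inverses add nothing to the words over
  \<open>J\<close>.\<close>

lemma parabolic_eq:
  assumes "J \<subseteq> I"
  shows "parabolic I M J = word_class I (coxeter_relations I M) ` lists J"
proof -
  interpret group "coxeter_group I M" by (rule group_coxeter_group[OF coxeter])
  let ?c = "word_class I (coxeter_relations I M)"
  have mul: "?c u \<otimes>\<^bsub>coxeter_group I M\<^esub> ?c v = ?c (u @ v)" if "u \<in> lists I" "v \<in> lists I" for u v
    unfolding coxeter_group_def by (rule mult_presented_monoid[OF that])
  have one_eq: "\<one>\<^bsub>coxeter_group I M\<^esub> = ?c []" unfolding coxeter_group_def by (rule one_presented_monoid)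
  have carr: "?c u \<in> carrier (coxeter_group I M)" if "u \<in> lists I" for u
    using that by (auto simp: coxeter_group_def carrier_presented_monoid)
  have inv_eq: "inv\<^bsub>coxeter_group I M\<^esub> (?c [i]) = ?c [i]" if "i \<in> I" for i
  proof (rule inv_equality)
    show "?c [i] \<otimes>\<^bsub>coxeter_group I M\<^esub> ?c [i] = \<one>\<^bsub>coxeter_group I M\<^esub>"
      using that coxeter_relation_square[OF coxeter that]
      by (simp add: mul one_eq word_class_eq_iff)
  qed (use that carr in auto)
  have lists: "lists J \<subseteq> lists I" using assms by auto
  have "w \<in> ?c ` lists J" if "w \<in> generate (coxeter_group I M) (coxeter_gen I M ` J)" for w
    using that
  proof induction
    case one
    show ?case unfolding one_eq by blast
  next
    case (incl h)
    then show ?case by (auto simp: coxeter_gen_def)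
  next
    case (inv h)
    then show ?case using inv_eq assms
      by (auto simp: coxeter_gen_def subset_iff)
  next
    case (eng h1 h2)
    then obtain u v where "h1 = ?c u" "u \<in> lists J" "h2 = ?c v" "v \<in> lists J" by auto
    then show ?case using mul[of u v] lists by (intro image_eqI[of _ _ "u @ v"]) auto
  qed
  moreover have "?c u \<in> generate (coxeter_group I M) (coxeter_gen I M ` J)" if "u \<in> lists J" for u
    using that
  proof (induction u)
    case Nil
    then show ?case using generate.one[of "coxeter_group I M"] one_eq by simp
  next
    case (Cons i u)
    then have "?c ([i] @ u) = ?c [i] \<otimes>\<^bsub>coxeter_group I M\<^esub> ?c u"
      using assms by (subst mul) auto
    moreover have "?c [i] \<in> generate (coxeter_group I M) (coxeter_gen I M ` J)"
      using Cons by (intro generate.incl) (auto simp: coxeter_gen_def)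
    ultimately show ?case using Cons by (auto intro: generate.eng)
  qed
  ultimately show ?thesis unfolding parabolic_def by blast
qed

text \<open>An element of maximal length in the parabolic subgroup admits no ascent in
  \<open>J\<close>: appending one would stay in the subgroup and be longer.\<close>

lemma longest_element_word:
  assumes "J \<subseteq> I" "finite (parabolic I M J)"
  obtains u where "u \<in> lists J" "red u" "\<And>j. j \<in> J \<Longrightarrow> \<not> asc (state u) j"
    "artin_lift I M (longest_element I M J) = word_class I (artin_relations I M) u"
proof -
  let ?c = "word_class I (coxeter_relations I M)"
  define w where "w = longest_element I M J"
  have lists: "lists J \<subseteq> lists I" using assms by auto
  have "w \<in> parabolic I M J \<and> (\<forall>y. y \<in> parabolic I M J \<longrightarrow> coxeter_length y \<le> coxeter_length w)"
    unfolding w_def longest_element_def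
  proof (rule arg_max_nat_lemma)
    show "?c [] \<in> parabolic I M J" using assms by (auto simp: parabolic_eq)
    \<comment> \<open>Finiteness enters here: it bounds the lengths, so that ARG_MAX is
      attained.\<close>
    show "\<forall>y. y \<in> parabolic I M J \<longrightarrow>
        coxeter_length y < Suc (Max (coxeter_length ` parabolic I M J))"
      using assms by (auto simp: less_Suc_eq_le)
  qed
  then have w: "w \<in> ?c ` lists J" and
    max: "\<And>y. y \<in> lists J \<Longrightarrow> coxeter_length (?c y) \<le> coxeter_length w"
    using assms by (auto simp: parabolic_eq)
  then obtain v where v: "v \<in> lists J" "w = ?c v" by auto
  obtain u where u: "u \<in> lists J" "red u" "(v, u) \<in> ccong" using reduce[OF v(1) assms(1)] by auto
  have uI: "u \<in> lists I" using u lists by auto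
  have wu: "w = ?c u" using u v lists by (auto simp: word_class_eq_iff subset_iff)
  have "\<not> asc (state u) j" if "j \<in> J" for j
  proof
    assume "asc (state u) j"
    then have "red (u @ [j])" using u by (simp add: red_from_append)
    then have "coxeter_length (?c (u @ [j])) = Suc (length u)"
      using uI that assms by (subst coxeter_length_red) auto
    moreover have "coxeter_length w = length u" unfolding wu
      using uI u by (intro coxeter_length_red)
    ultimately show False using max[of "u @ [j]"] u that by auto
  qed
  moreover have "artin_lift I M w = word_class I (artin_relations I M) u"
    unfolding wu using uI u by (intro artin_lift_red)
  ultimately show thesis using that u unfolding w_def by blast
qed

end


section \<open>Permutation models of types \<open>A\<close> and \<open>B\<close>\<close>

lemma alternating_word_numeral:
  "alternating_word 2 i j = [i, j]" "alternating_word 3 i j = [i, j, i]"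
  "alternating_word 4 i j = [i, j, i, j]"
  by (simp_all add: eval_nat_numeral)

lemma permutes_increasing_imp_id:
  fixes w :: "nat \<Rightarrow> nat"
  assumes "w permutes {1..N}" "\<And>i. 1 \<le> i \<Longrightarrow> i < N \<Longrightarrow> w i < w (Suc i)"
  shows "w = id"
proof (rule permutes_natset_ge[OF assms(1)], rule ballI)
  have "i \<le> N \<Longrightarrow> i \<le> w i" if "1 \<le> i" for i
    using that
  proof (induction i rule: nat_induct_at_least)
    case base
    then show ?case using permutes_in_image[OF assms(1), of 1] by auto
  next
    case (Suc i)
    then show ?case using assms(2)[of i] by simp
  qed
  then show "i \<le> w i" if "i \<in> {1..N}" for i using that by simp
qed

text \<open>The weights \<open>N - p\<close> decrease with the position, so moving a larger value to
  the right lowers the sum. In contrast to the number of inversions, only two summands change under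
  the transposition of two arbitrary positions.\<close>

definition disorder :: "nat \<Rightarrow> (nat \<Rightarrow> nat) \<Rightarrow> nat" where
  "disorder N w = (\<Sum>p\<in>{1..N}. (N - p) * w p)"

lemma disorder_transpose:
  assumes "1 \<le> i" "i < k" "k \<le> N" "w k < w i"
  shows "disorder N (w \<circ> transpose i k) < disorder N w"
proof -
  have split: "disorder N v = (N - i) * v i + ((N - k) * v k + (\<Sum>p\<in>{1..N} - {i} - {k}. (N - p) * v p))"
    for v :: "nat \<Rightarrow> nat"
    unfolding disorder_def using assms
    by (subst sum.remove[of _ i], simp, simp, subst sum.remove[of _ k]) auto
  have same: "(\<Sum>p\<in>{1..N} - {i} - {k}. (N - p) * (w \<circ> transpose i k) p)
      = (\<Sum>p\<in>{1..N} - {i} - {k}. (N - p) * w p)"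
    by (intro sum.cong) auto
  obtain d where d: "N - i = (N - k) + d" "d > 0"
    using assms by (metis diff_less_mono2 less_imp_add_positive order_less_le_trans)
  have "d * w k < d * w i" using d assms by simp
  then have "(N - i) * w k + (N - k) * w i < (N - i) * w i + (N - k) * w k"
    unfolding d by (simp add: algebra_simps)
  then show ?thesis unfolding split same by simp
qed

abbreviation adj :: "nat \<Rightarrow> nat \<Rightarrow> nat" where "adj i \<equiv> transpose i (Suc i)"

text \<open>\<open>i\<close>, \<open>Suc i\<close>, \<open>z\<close>, \<open>Suc z\<close> play the
  role of two points and their mirror images; on them the two involutions generate the group of
  signed permutations of two points, of order 8.\<close>

lemma adj_braid_4:
  assumes "Suc i < z"
  shows "(adj i \<circ> adj z) \<circ> transpose (Suc i) z \<circ> (adj i \<circ> adj z) \<circ> transpose (Suc i) z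
    = transpose (Suc i) z \<circ> (adj i \<circ> adj z) \<circ> transpose (Suc i) z \<circ> (adj i \<circ> adj z)"
proof
  fix x
  consider "x = i" | "x = Suc i" | "x = z" | "x = Suc z" | "x \<noteq> i" "x \<noteq> Suc i" "x \<noteq> z" "x \<noteq> Suc z"
    by blast
  then show "((adj i \<circ> adj z) \<circ> transpose (Suc i) z \<circ> (adj i \<circ> adj z) \<circ> transpose (Suc i) z) x
    = (transpose (Suc i) z \<circ> (adj i \<circ> adj z) \<circ> transpose (Suc i) z \<circ> (adj i \<circ> adj z)) x"
    using assms by cases simp_all
qed

lemma adj_braid_3:
  assumes "Suc (Suc i) < z"
  shows "(adj i \<circ> adj (Suc z)) \<circ> (adj (Suc i) \<circ> adj z) \<circ> (adj i \<circ> adj (Suc z))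
    = (adj (Suc i) \<circ> adj z) \<circ> (adj i \<circ> adj (Suc z)) \<circ> (adj (Suc i) \<circ> adj z)"
proof
  fix x
  consider "x = i" | "x = Suc i" | "x = Suc (Suc i)" | "x = z" | "x = Suc z" | "x = Suc (Suc z)"
    | "x \<noteq> i" "x \<noteq> Suc i" "x \<noteq> Suc (Suc i)" "x \<noteq> z" "x \<noteq> Suc z" "x \<noteq> Suc (Suc z)" by blast
  then show "((adj i \<circ> adj (Suc z)) \<circ> (adj (Suc i) \<circ> adj z) \<circ> (adj i \<circ> adj (Suc z))) x
    = ((adj (Suc i) \<circ> adj z) \<circ> (adj i \<circ> adj (Suc z)) \<circ> (adj (Suc i) \<circ> adj z)) x"
    using assms by cases simp_all
qed

lemma adj_commute:
  assumes "Suc i < j" "Suc j < z" "Suc z < k"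
  shows "(adj i \<circ> adj k) \<circ> (adj j \<circ> adj z) = (adj j \<circ> adj z) \<circ> (adj i \<circ> adj k)"
proof
  fix x
  consider "x = i" | "x = Suc i" | "x = j" | "x = Suc j" | "x = z" | "x = Suc z" | "x = k" | "x = Suc k"
    | "x \<noteq> i" "x \<noteq> Suc i" "x \<noteq> j" "x \<noteq> Suc j" "x \<noteq> z" "x \<noteq> Suc z" "x \<noteq> k" "x \<noteq> Suc k"
    by blast
  then show "((adj i \<circ> adj k) \<circ> (adj j \<circ> adj z)) x = ((adj j \<circ> adj z) \<circ> (adj i \<circ> adj k)) x"
    using assms by cases simp_all
qed

lemma adj_commute_transpose:
  assumes "Suc i < j" "j < z" "z < k"
  shows "(adj i \<circ> adj k) \<circ> transpose j z = transpose j z \<circ> (adj i \<circ> adj k)"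
proof
  fix x
  consider "x = i" | "x = Suc i" | "x = j" | "x = z" | "x = k" | "x = Suc k"
    | "x \<noteq> i" "x \<noteq> Suc i" "x \<noteq> j" "x \<noteq> z" "x \<noteq> k" "x \<noteq> Suc k"
    by blast
  then show "((adj i \<circ> adj k) \<circ> transpose j z) x = (transpose j z \<circ> (adj i \<circ> adj k)) x"
    using assms by cases simp_all
qed

text \<open>The generators of \<open>B_r\<close> as permutations commuting with the mirror map
  \<open>x \<mapsto> Suc N - x\<close>: two mirrored adjacent swaps, and for \<open>i = r\<close>
  the swap of \<open>r\<close> with its mirror image, which skips the fixed middle point
  \<open>Suc r\<close> when \<open>N\<close> is odd.\<close>

definition flip :: "nat \<Rightarrow> nat \<Rightarrow> nat \<Rightarrow> nat \<Rightarrow> nat" where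
  "flip r N i = (if i = r then transpose r (Suc N - r) else adj i \<circ> adj (N - i))"

section \<open>Type A: permutations of positions\<close>

locale labelled_A =
  fixes I :: "'b set" and M :: "'b \<Rightarrow> 'b \<Rightarrow> enat" and n :: nat and \<iota> :: "'b \<Rightarrow> nat"
  assumes coxeter_A: "coxeter_matrix I M"
    and bij: "bij_betw \<iota> I {1..n}"
    and M_eq: "a \<in> I \<Longrightarrow> b \<in> I \<Longrightarrow> M a b = matrix_A (\<iota> a) (\<iota> b)"
begin

lemma label_range: "a \<in> I \<Longrightarrow> 1 \<le> \<iota> a \<and> \<iota> a \<le> n"
  using bij by (auto simp: bij_betw_def)

lemma label_eq_iff: "a \<in> I \<Longrightarrow> b \<in> I \<Longrightarrow> \<iota> a = \<iota> b \<longleftrightarrow> a = b"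
  using bij by (auto simp: bij_betw_def inj_on_def)

lemma label_cases:
  assumes "a \<in> I" "b \<in> I" "a \<noteq> b"
  obtains "M a b = enat 3" "\<iota> b = Suc (\<iota> a)" | "M a b = enat 3" "\<iota> a = Suc (\<iota> b)"
    | "M a b = enat 2" "\<iota> b \<noteq> Suc (\<iota> a)" "\<iota> a \<noteq> Suc (\<iota> b)" "\<iota> a \<noteq> \<iota> b"
  using assms M_eq[of a b] label_eq_iff[of a b]
  by (auto simp: matrix_A_def numeral_eq_enat split: if_splits)

sublocale braid_model I M "{w. w permutes {1..Suc n}}" id
  "\<lambda>w b. w \<circ> adj (\<iota> b)" "\<lambda>w b. w (\<iota> b) < w (Suc (\<iota> b))" "disorder (Suc n)"
proof
  show "coxeter_matrix I M" by (rule coxeter_A)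
  fix w :: "nat \<Rightarrow> nat" and i assume w: "w \<in> {w. w permutes {1..Suc n}}" and i: "i \<in> I"
  show "w \<circ> adj (\<iota> i) \<in> {w. w permutes {1..Suc n}}"
    using w label_range[OF i] by (auto intro!: permutes_compose permutes_swap_id)
  show "w \<circ> adj (\<iota> i) \<circ> adj (\<iota> i) = w" by (simp add: comp_assoc)
  have "inj w" using w permutes_inj by blast
  then have "w (\<iota> i) \<noteq> w (Suc (\<iota> i))" by (simp add: inj_eq)
  then show "(w \<circ> adj (\<iota> i)) (\<iota> i) < (w \<circ> adj (\<iota> i)) (Suc (\<iota> i))
      \<longleftrightarrow> \<not> w (\<iota> i) < w (Suc (\<iota> i))" by auto
  then show "disorder (Suc n) (w \<circ> adj (\<iota> i)) < disorder (Suc n) w"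
    if "\<not> w (\<iota> i) < w (Suc (\<iota> i))"
    using that label_range[OF i] by (intro disorder_transpose) auto
  fix j assume j: "j \<in> I" and ij: "i \<noteq> j"
  show "foldl (\<lambda>w b. w \<circ> adj (\<iota> b)) w (alternating_word m i j) =
      foldl (\<lambda>w b. w \<circ> adj (\<iota> b)) w (alternating_word m j i)" if "M i j = enat m" for m
    using i j ij
  proof (cases rule: label_cases)
    case 1
    then have m: "m = 3" using that by simp
    have "adj (\<iota> i) \<circ> adj (\<iota> j) \<circ> adj (\<iota> i) = adj (\<iota> j) \<circ> adj (\<iota> i) \<circ> adj (\<iota> j)"
      unfolding 1 by (auto simp: fun_eq_iff transpose_def)
    then show ?thesis unfolding m by (simp add: alternating_word_numeral comp_assoc)
  next
    case 2
    then have m: "m = 3" using that by simp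
    have "adj (\<iota> i) \<circ> adj (\<iota> j) \<circ> adj (\<iota> i) = adj (\<iota> j) \<circ> adj (\<iota> i) \<circ> adj (\<iota> j)"
      unfolding 2 by (auto simp: fun_eq_iff transpose_def)
    then show ?thesis unfolding m by (simp add: alternating_word_numeral comp_assoc)
  next
    case 3
    then have m: "m = 2" using that by simp
    have "adj (\<iota> i) \<circ> adj (\<iota> j) = adj (\<iota> j) \<circ> adj (\<iota> i)"
      using 3 by (auto simp: fun_eq_iff transpose_def)
    then show ?thesis unfolding m by (simp add: alternating_word_numeral comp_assoc)
  qed
  assume d: "\<not> w (\<iota> i) < w (Suc (\<iota> i))" "\<not> w (\<iota> j) < w (Suc (\<iota> j))"
  show "\<exists>m. M i j = enat m \<and>
      (\<forall>k<m. \<not> foldl (\<lambda>w b. w \<circ> adj (\<iota> b)) w (alternating_word k i j) (\<iota> (if even k then i else j))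
        < foldl (\<lambda>w b. w \<circ> adj (\<iota> b)) w (alternating_word k i j) (Suc (\<iota> (if even k then i else j))))"
    using i j ij
  proof (cases rule: label_cases)
    case 1
    then show ?thesis using d by (intro exI[of _ 3]) (auto simp: numeral_3_eq_3 less_Suc_eq)
  next
    case 2
    then show ?thesis using d by (intro exI[of _ 3]) (auto simp: numeral_3_eq_3 less_Suc_eq)
  next
    case 3
    then show ?thesis using d by (intro exI[of _ 2]) (auto simp: numeral_2_eq_2 less_Suc_eq)
  qed
next
  fix w :: "nat \<Rightarrow> nat"
  assume w: "w \<in> {w. w permutes {1..Suc n}}" and asc: "\<And>i. i \<in> I \<Longrightarrow> w (\<iota> i) < w (Suc (\<iota> i))"
  show "w = id"
  proof (rule permutes_increasing_imp_id)
    show "w permutes {1..Suc n}" using w by simp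
    fix p assume "1 \<le> p" "p < Suc n"
    then have "p \<in> \<iota> ` I" using bij by (auto simp: bij_betw_def)
    then show "w p < w (Suc p)" using asc by auto
  qed
qed (auto simp: permutes_id)

end

section \<open>Type B: centrally symmetric permutations\<close>

lemma matrix_B_entries:
  "2 \<le> r \<Longrightarrow> matrix_B r (r - 1) r = enat 4" "2 \<le> r \<Longrightarrow> matrix_B r r (r - 1) = enat 4"
  "Suc p < r \<Longrightarrow> matrix_B r p (Suc p) = enat 3" "Suc p < r \<Longrightarrow> matrix_B r (Suc p) p = enat 3"
  "Suc p < q \<Longrightarrow> matrix_B r p q = enat 2" "Suc p < q \<Longrightarrow> matrix_B r q p = enat 2"
  by (auto simp: matrix_B_def numeral_eq_enat doubleton_eq_iff)

lemma comp_braid: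
  "f \<circ> g = g \<circ> f \<Longrightarrow> w \<circ> f \<circ> g = w \<circ> g \<circ> f"
  "f \<circ> g \<circ> f = g \<circ> f \<circ> g \<Longrightarrow> w \<circ> f \<circ> g \<circ> f = w \<circ> g \<circ> f \<circ> g"
  "f \<circ> g \<circ> f \<circ> g = g \<circ> f \<circ> g \<circ> f \<Longrightarrow> w \<circ> f \<circ> g \<circ> f \<circ> g = w \<circ> g \<circ> f \<circ> g \<circ> f"
  by (metis comp_assoc)+

text \<open>Both values of \<open>N\<close> give a faithful model of the same group.
  \<open>N - 1\<close> is the number of nodes of the unfolded diagram: \<open>2 * r\<close> leads to
  \<open>A_{2r-1}\<close>, \<open>Suc (2 * r)\<close> to \<open>A_{2r}\<close>.\<close>

locale labelled_B =
  fixes I :: "'b set" and M :: "'b \<Rightarrow> 'b \<Rightarrow> enat" and r N :: nat and \<iota> :: "'b \<Rightarrow> nat"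
  assumes coxeter_B: "coxeter_matrix I M"
    and bij: "bij_betw \<iota> I {1..r}"
    and M_eq: "a \<in> I \<Longrightarrow> b \<in> I \<Longrightarrow> M a b = matrix_B r (\<iota> a) (\<iota> b)"
    and r: "2 \<le> r" and N: "N = 2 * r \<or> N = Suc (2 * r)"
begin

lemma label_range: "a \<in> I \<Longrightarrow> 1 \<le> \<iota> a \<and> \<iota> a \<le> r"
  using bij by (auto simp: bij_betw_def)

lemma label_eq_iff: "a \<in> I \<Longrightarrow> b \<in> I \<Longrightarrow> \<iota> a = \<iota> b \<longleftrightarrow> a = b"
  using bij by (auto simp: bij_betw_def inj_on_def)

abbreviation bact :: "(nat \<Rightarrow> nat) \<Rightarrow> 'b \<Rightarrow> nat \<Rightarrow> nat" where "bact w b \<equiv> w \<circ> flip r N (\<iota> b)"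
abbreviation basc :: "(nat \<Rightarrow> nat) \<Rightarrow> 'b \<Rightarrow> bool" where
  "basc w b \<equiv> w (\<iota> b) < w (if \<iota> b = r then Suc N - r else Suc (\<iota> b))"
abbreviation bstates :: "(nat \<Rightarrow> nat) set" where
  "bstates \<equiv> {w. w permutes {1..N} \<and> (\<forall>x\<in>{1..N}. w (Suc N - x) = Suc N - w x)}"

lemma label_cases:
  assumes "a \<in> I" "b \<in> I" "a \<noteq> b"
  obtains "M a b = enat 4" "Suc (\<iota> a) = r" "\<iota> b = r"
    | "M a b = enat 4" "Suc (\<iota> b) = r" "\<iota> a = r"
    | "M a b = enat 3" "\<iota> b = Suc (\<iota> a)" "Suc (\<iota> a) < r"
    | "M a b = enat 3" "\<iota> a = Suc (\<iota> b)" "Suc (\<iota> b) < r"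
    | "M a b = enat 2" "Suc (\<iota> a) < \<iota> b" | "M a b = enat 2" "Suc (\<iota> b) < \<iota> a"
proof -
  have *: "\<iota> a \<noteq> \<iota> b" using label_eq_iff assms by auto
  have m4: "M a b = enat 4" if "\<iota> a = r - 1 \<and> \<iota> b = r \<or> \<iota> b = r - 1 \<and> \<iota> a = r"
    using that M_eq[OF assms(1,2)] * matrix_B_entries(1,2)[OF r] by auto
  have m3: "M a b = enat 3" if
    "\<iota> b = Suc (\<iota> a) \<and> Suc (\<iota> a) < r \<or> \<iota> a = Suc (\<iota> b) \<and> Suc (\<iota> b) < r"
    using that M_eq[OF assms(1,2)] by (auto simp: matrix_B_entries)
  have m2: "M a b = enat 2" if "Suc (\<iota> a) < \<iota> b \<or> Suc (\<iota> b) < \<iota> a"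
    using that M_eq[OF assms(1,2)] by (auto simp: matrix_B_entries)
  consider "Suc (\<iota> a) < \<iota> b" | "Suc (\<iota> b) < \<iota> a"
    | "\<iota> b = Suc (\<iota> a)" "\<iota> b = r" | "\<iota> b = Suc (\<iota> a)" "\<iota> b < r"
    | "\<iota> a = Suc (\<iota> b)" "\<iota> a = r" | "\<iota> a = Suc (\<iota> b)" "\<iota> a < r"
    using * label_range[OF assms(1)] label_range[OF assms(2)] by linarith
  then show thesis
  proof cases
    case 1 then show thesis by (intro that(5) m2) auto
  next
    case 2 then show thesis by (intro that(6) m2) auto
  next
    case 3 then show thesis by (intro that(1) m4) auto
  next
    case 4 then show thesis by (intro that(3) m3) auto
  next
    case 5 then show thesis by (intro that(2) m4) auto
  next
    case 6 then show thesis by (intro that(4) m3) auto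
  qed
qed

lemma flip_cases:
  assumes "1 \<le> i" "i \<le> r"
  obtains "i = r" "flip r N i = transpose r (Suc N - r)" "r < Suc N - r" "Suc N - r \<le> N"
  | z where "i < r" "flip r N i = adj i \<circ> adj z" "N = i + z" "Suc i < z" "r < z" "z < N"
proof (cases "i = r")
  case True
  then show thesis using that(1) N r by (auto simp: flip_def)
next
  case False
  then have "i < r" "N = i + (N - i)" "Suc i < N - i" "r < N - i" "N - i < N" using assms N by auto
  then show thesis using that(2)[of "N - i"] by (simp add: flip_def)
qed

lemma flip_mirror:
  assumes "1 \<le> i" "i \<le> r" "x \<in> {1..N}"
  shows "flip r N i (Suc N - x) = Suc N - flip r N i x"
  using assms(1,2)
proof (cases rule: flip_cases)
  case 1
  consider "x = r" | "x = Suc N - r" | "x \<noteq> r" "x \<noteq> Suc N - r" by blast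
  then show ?thesis
  proof cases
    case 3
    then have "Suc N - x \<noteq> r" "Suc N - x \<noteq> Suc N - r" using assms 1 by auto
    then show ?thesis using 1 3 by simp
  qed (use 1 in \<open>simp_all\<close>)
next
  case (2 z)
  consider "x = i" | "x = Suc i" | "x = z" | "x = Suc z" | "x \<noteq> i" "x \<noteq> Suc i" "x \<noteq> z" "x \<noteq> Suc z"
    by blast
  then show ?thesis
  proof cases
    case 5
    have "Suc N - x \<noteq> i" using 2(3) 5(4) assms(1) by linarith
    moreover have "Suc N - x \<noteq> Suc i" using 2(3) 5(3) assms(1) by linarith
    moreover have "Suc N - x \<noteq> z" using 2(3,4) 5(2) assms(1) by linarith
    moreover have "Suc N - x \<noteq> Suc z" using 2(3,4) 5(1) assms(1) by linarith
    ultimately show ?thesis unfolding 2(2) using 5 by simp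
  next
    case 1
    have "Suc N - i = Suc z" using 2(3) by simp
    then show ?thesis unfolding 2(2) using 1 2(4) by simp
  next
    case c2: 2
    have "Suc N - Suc i = z" "Suc N - i = Suc z" using 2(3) by auto
    then show ?thesis unfolding 2(2) using c2 2(4) by simp
  next
    case 3
    have "Suc N - z = Suc i" "Suc N - Suc z = i" using 2(3) by auto
    then show ?thesis unfolding 2(2) using 3 2(4) by simp
  next
    case 4
    have "Suc N - Suc z = i" "Suc N - z = Suc i" using 2(3) by auto
    then show ?thesis unfolding 2(2) using 4 2(4) by simp
  qed
qed

lemma flip_at:
  "1 \<le> i \<Longrightarrow> i < r \<Longrightarrow> flip r N i i = Suc i" "1 \<le> i \<Longrightarrow> i < r \<Longrightarrow> flip r N i (Suc i) = i"
  "1 \<le> i \<Longrightarrow> i < r \<Longrightarrow> x \<le> r \<Longrightarrow> x \<noteq> i \<Longrightarrow> x \<noteq> Suc i \<Longrightarrow> flip r N i x = x"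
  "flip r N r r = Suc N - r" "flip r N r (Suc N - r) = r" "x < r \<Longrightarrow> flip r N r x = x"
proof -
  assume i: "1 \<le> i" "i < r"
  obtain z where z: "flip r N i = adj i \<circ> adj z" "Suc i < z" "r < z"
    using flip_cases[of i] i by (metis less_imp_le_nat less_not_refl)
  show "flip r N i i = Suc i" "flip r N i (Suc i) = i" using z by simp_all
  show "x \<le> r \<Longrightarrow> x \<noteq> i \<Longrightarrow> x \<noteq> Suc i \<Longrightarrow> flip r N i x = x" using z by simp
next
  have "r < Suc N - r" using N by auto
  then show "flip r N r r = Suc N - r" "flip r N r (Suc N - r) = r" "x < r \<Longrightarrow> flip r N r x = x"
    by (simp_all add: flip_def)
qed

lemma flip_permutes:
  assumes "1 \<le> i" "i \<le> r"
  shows "flip r N i permutes {1..N}"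
  using assms
proof (cases rule: flip_cases)
  case 1
  then show ?thesis using r by (auto intro: permutes_swap_id)
next
  case (2 z)
  then show ?thesis unfolding 2(2) using assms by (intro permutes_compose permutes_swap_id) auto
qed

lemma flip_flip:
  assumes "1 \<le> i" "i \<le> r"
  shows "flip r N i \<circ> flip r N i = id"
  using assms
proof (cases rule: flip_cases)
  case 1
  then show ?thesis by simp
next
  case (2 z)
  have "adj i (adj z (adj i (adj z x))) = x" for x
    using 2(4) by (cases "x = i"; cases "x = Suc i"; cases "x = z"; cases "x = Suc z") simp_all
  then show ?thesis unfolding 2(2) by (simp add: fun_eq_iff)
qed

lemma flip_braid_4:
  assumes "Suc i = r" "1 \<le> i"
  shows "flip r N i \<circ> flip r N r \<circ> flip r N i \<circ> flip r N r
    = flip r N r \<circ> flip r N i \<circ> flip r N r \<circ> flip r N i"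
proof -
  define z where "z = N - i"
  have z: "N = i + z" "Suc i < z" using assms N by (auto simp: z_def)
  show ?thesis using adj_braid_4[OF z(2)] z unfolding assms(1)[symmetric] flip_def by simp
qed

lemma flip_braid_3:
  assumes "Suc i < r" "1 \<le> i"
  shows "flip r N i \<circ> flip r N (Suc i) \<circ> flip r N i = flip r N (Suc i) \<circ> flip r N i \<circ> flip r N (Suc i)"
proof -
  define z where "z = N - Suc i"
  have z: "N = Suc (i + z)" "Suc (Suc i) < z" using assms N by (auto simp: z_def)
  show ?thesis using adj_braid_3[OF z(2)] z assms unfolding flip_def by simp
qed

lemma flip_commute:
  assumes "Suc i < j" "1 \<le> i" "j \<le> r"
  shows "flip r N i \<circ> flip r N j = flip r N j \<circ> flip r N i"
proof -
  define z where "z = N - j"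
  have z: "N = j + z" "i < r" "j \<le> z" using assms N by (auto simp: z_def)
  show ?thesis
  proof (cases "j = r")
    case True
    have "j + z - i > Suc z" using assms z by simp
    then have "(adj i \<circ> adj (j + z - i)) \<circ> transpose j (Suc z) = transpose j (Suc z) \<circ> (adj i \<circ> adj (j + z - i))"
      using assms z by (intro adj_commute_transpose) auto
    moreover have "flip r N i = adj i \<circ> adj (j + z - i)" "flip r N j = transpose j (Suc z)"
      using True z by (simp_all add: flip_def)
    ultimately show ?thesis by (simp only:)
  next
    case False
    then have "(adj i \<circ> adj (j + z - i)) \<circ> (adj j \<circ> adj z) = (adj j \<circ> adj z) \<circ> (adj i \<circ> adj (j + z - i))"
      using assms z N by (intro adj_commute) auto
    moreover have "flip r N i = adj i \<circ> adj (j + z - i)" "flip r N j = adj j \<circ> adj z"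
      using False z by (simp_all add: flip_def)
    ultimately show ?thesis by (simp only:)
  qed
qed

lemma bstates_mid:
  assumes "w \<in> bstates" "N = Suc (2 * r)"
  shows "w (Suc r) = Suc r"
proof -
  have "Suc r \<in> {1..N}" using assms(2) by simp
  then have "w (Suc N - Suc r) = Suc N - w (Suc r)" "w (Suc r) \<le> N"
    using assms(1) permutes_in_image[of w "{1..N}" "Suc r"] by (blast, simp)
  then show ?thesis using assms(2) by (simp add: mult_2)
qed

lemma bstates_mirror_less:
  assumes "w \<in> bstates" "x \<in> {1..N}" "y \<in> {1..N}"
  shows "w (Suc N - x) < w (Suc N - y) \<longleftrightarrow> w y < w x"
proof -
  have "w x \<in> {1..N}" "w y \<in> {1..N}"
    using permutes_in_image[of w "{1..N}"] assms by auto
  then show ?thesis using assms by auto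
qed

sublocale braid_model I M bstates id bact basc "disorder N"
proof
  show "coxeter_matrix I M" by (rule coxeter_B)
  show "id \<in> bstates" by simp
  show "basc id i" if "i \<in> I" for i using label_range[OF that] N by auto
  fix w :: "nat \<Rightarrow> nat" and i assume w: "w \<in> bstates" and i: "i \<in> I"
  note ri = label_range[OF i]
  have rng: "flip r N (\<iota> i) x \<in> {1..N}" if "x \<in> {1..N}" for x
    using permutes_in_image[OF flip_permutes] ri that by blast
  show st: "bact w i \<in> bstates"
    using w ri flip_permutes[of "\<iota> i"] rng by (auto intro!: permutes_compose simp: flip_mirror)
  show "bact (bact w i) i = w" using ri by (simp add: comp_assoc flip_flip)
  have "inj w" using w permutes_inj by blast
  then have inj: "w x = w y \<longleftrightarrow> x = y" for x y by (simp add: inj_eq)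
  have ne: "Suc N - r \<noteq> r" "N - r \<noteq> r \<or> N = 2 * r" using N r by auto
  show asc: "basc (bact w i) i \<longleftrightarrow> \<not> basc w i"
  proof (cases "\<iota> i = r")
    case True
    then show ?thesis using ne inj[of r "Suc N - r"] by (auto simp: flip_def)
  next
    case False
    then have "flip r N (\<iota> i) (\<iota> i) = Suc (\<iota> i)" "flip r N (\<iota> i) (Suc (\<iota> i)) = \<iota> i"
      using ri N by (auto simp: flip_def transpose_def)
    then show ?thesis using False inj[of "\<iota> i" "Suc (\<iota> i)"] by auto
  qed
  show "disorder N (bact w i) < disorder N w" if "\<not> basc w i"
  proof (cases "\<iota> i = r")
    case True
    then show ?thesis unfolding flip_def using that ri N ne inj[of r "Suc N - r"]
      by (auto intro!: disorder_transpose)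
  next
    case False
    have 1: "w (Suc (\<iota> i)) < w (\<iota> i)"
      using that False inj[of "\<iota> i" "Suc (\<iota> i)"] by auto
    define z where "z = N - \<iota> i"
    have z: "N - \<iota> i = z" "Suc N - \<iota> i = Suc z" "Suc N - Suc (\<iota> i) = z"
      "Suc (\<iota> i) < z" "Suc z \<le> N" "1 \<le> z" "Suc (\<iota> i) \<in> {1..N}" "\<iota> i \<in> {1..N}"
      using ri N False by (auto simp: z_def)
    \<comment> \<open>The mirror image of a descent is a descent, so the two adjacent swaps that
      make up the flip lower the disorder one after the other.\<close>
    have "w (Suc z) < w z"
      using 1 bstates_mirror_less[OF w z(8,7)] unfolding z by simp
    then have "(w \<circ> adj (\<iota> i)) (Suc z) < (w \<circ> adj (\<iota> i)) z" using z(4) by simp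
    then have "disorder N (w \<circ> adj (\<iota> i) \<circ> adj z) < disorder N (w \<circ> adj (\<iota> i))"
      using z(5,6) by (intro disorder_transpose) auto
    also have "\<dots> < disorder N w" using 1 z(7,8) by (intro disorder_transpose) auto
    finally show ?thesis using False z(1) by (simp add: flip_def comp_assoc)
  qed
  fix j assume j: "j \<in> I" and ij: "i \<noteq> j"
  note rj = label_range[OF j]
  show "foldl bact w (alternating_word m i j) = foldl bact w (alternating_word m j i)"
    if "M i j = enat m" for m
    using i j ij
  proof (cases rule: label_cases)
    case 1
    then have m: "m = 4" using that by simp
    show ?thesis unfolding m alternating_word_numeral foldl.simps
      using flip_braid_4[of "\<iota> i"] 1 ri by (intro comp_braid) simp
  next
    case 2
    then have m: "m = 4" using that by simp
    show ?thesis unfolding m alternating_word_numeral foldl.simps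
      using flip_braid_4[of "\<iota> j"] 2 rj by (intro comp_braid) simp
  next
    case 3
    then have m: "m = 3" using that by simp
    show ?thesis unfolding m alternating_word_numeral foldl.simps
      using flip_braid_3[of "\<iota> i"] 3 ri by (intro comp_braid) simp
  next
    case 4
    then have m: "m = 3" using that by simp
    show ?thesis unfolding m alternating_word_numeral foldl.simps
      using flip_braid_3[of "\<iota> j"] 4 rj by (intro comp_braid) simp
  next
    case 5
    then have m: "m = 2" using that by simp
    show ?thesis unfolding m alternating_word_numeral foldl.simps
      using flip_commute[of "\<iota> i" "\<iota> j"] 5 ri rj by (intro comp_braid) blast
  next
    case 6
    then have m: "m = 2" using that by simp
    show ?thesis unfolding m alternating_word_numeral foldl.simps
      using flip_commute[of "\<iota> j" "\<iota> i"] 6 ri rj by (intro comp_braid) metis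
  qed
  assume d: "\<not> basc w i" "\<not> basc w j"
  show "\<exists>m. M i j = enat m \<and>
      (\<forall>k<m. \<not> basc (foldl bact w (alternating_word k i j)) (if even k then i else j))"
    using i j ij
  proof (cases rule: label_cases)
    case 1
    define p where "p = \<iota> i"
    have p: "\<iota> i = p" "\<iota> j = r" "Suc p = r" "p \<noteq> r" "1 \<le> p" "p < r" "1 \<le> r"
      "p \<in> {1..N}" "r \<in> {1..N}"
      using 1 ri rj N r by (auto simp: p_def)
    \<comment> \<open>Two descents and their mirror images make \<open>w\<close> non-increasing
      along \<open>p\<close>, \<open>r\<close>, \<open>Suc N - r\<close>, \<open>Suc N - p\<close>;
      hence all four steps of the alternating word are descents.\<close>
    have le: "w r \<le> w p" "w (Suc N - r) \<le> w r" using d p by auto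
    then have le': "w (Suc N - p) \<le> w (Suc N - r)"
      using bstates_mirror_less[OF w p(9,8)] by (simp flip: not_less)
    have fl: "flip r N p p = r" "flip r N p r = p" "flip r N r r = Suc N - r"
      "flip r N r (Suc N - r) = r" "flip r N r p = p" "flip r N p (Suc N - r) = Suc N - p"
      "flip r N r (Suc N - p) = Suc N - p" "flip r N p (Suc N - p) = Suc N - r"
      using p(3-9) flip_at(1,2)[of p] flip_at(4,5) flip_at(6)[of p] flip_mirror[of p r] flip_mirror[of p p]
        flip_mirror[of r p] by simp_all
    have "\<forall>k<4. \<not> basc (foldl bact w (alternating_word k i j)) (if even k then i else j)"
    proof (intro allI impI)
      fix k :: nat assume "k < 4"
      then have "k = 0 \<or> k = 1 \<or> k = 2 \<or> k = 3" by arith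
      then show "\<not> basc (foldl bact w (alternating_word k i j)) (if even k then i else j)"
        using le le' by (elim disjE) (simp_all add: alternating_word_numeral p(1-4) fl)
    qed
    with 1(1) show ?thesis by blast
  next
    case 2
    define p where "p = \<iota> j"
    have p: "\<iota> j = p" "\<iota> i = r" "Suc p = r" "p \<noteq> r" "1 \<le> p" "p < r" "1 \<le> r"
      "p \<in> {1..N}" "r \<in> {1..N}"
      using 2 ri rj N r by (auto simp: p_def)
    have le: "w r \<le> w p" "w (Suc N - r) \<le> w r" using d p by auto
    then have le': "w (Suc N - p) \<le> w (Suc N - r)"
      using bstates_mirror_less[OF w p(9,8)] by (simp flip: not_less)
    have fl: "flip r N p p = r" "flip r N p r = p" "flip r N r r = Suc N - r"
      "flip r N r (Suc N - r) = r" "flip r N r p = p" "flip r N p (Suc N - r) = Suc N - p"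
      "flip r N r (Suc N - p) = Suc N - p" "flip r N p (Suc N - p) = Suc N - r"
      using p(3-9) flip_at(1,2)[of p] flip_at(4,5) flip_at(6)[of p] flip_mirror[of p r] flip_mirror[of p p]
        flip_mirror[of r p] by simp_all
    have "\<forall>k<4. \<not> basc (foldl bact w (alternating_word k i j)) (if even k then i else j)"
    proof (intro allI impI)
      fix k :: nat assume "k < 4"
      then have "k = 0 \<or> k = 1 \<or> k = 2 \<or> k = 3" by arith
      then show "\<not> basc (foldl bact w (alternating_word k i j)) (if even k then i else j)"
        using le le' by (elim disjE) (simp_all add: alternating_word_numeral p(1-4) fl)
    qed
    with 2(1) show ?thesis by blast
  next
    case 3
    then have "\<iota> i < r" "Suc (\<iota> i) < r" "Suc (Suc (\<iota> i)) \<le> r" "1 \<le> \<iota> i" using ri rj by auto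
    then have "\<forall>k<3. \<not> basc (foldl bact w (alternating_word k i j)) (if even k then i else j)"
      using d 3(2) by (auto simp: numeral_3_eq_3 less_Suc_eq flip_at)
    with 3(1) show ?thesis by blast
  next
    case 4
    then have "\<iota> j < r" "Suc (\<iota> j) < r" "Suc (Suc (\<iota> j)) \<le> r" "1 \<le> \<iota> j" using ri rj by auto
    then have "\<forall>k<3. \<not> basc (foldl bact w (alternating_word k i j)) (if even k then i else j)"
      using d 4(2) by (auto simp: numeral_3_eq_3 less_Suc_eq flip_at)
    with 4(1) show ?thesis by blast
  next
    case 5
    then have "\<iota> i < r" "\<iota> j \<le> r" "1 \<le> \<iota> i" using ri rj by auto
    moreover have "flip r N (\<iota> i) (Suc N - r) = Suc N - r" if "\<iota> j = r"
      using 5(2) that ri rj N by (subst flip_mirror) (auto simp: flip_at)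
    ultimately have "\<forall>k<2. \<not> basc (foldl bact w (alternating_word k i j)) (if even k then i else j)"
      using d 5(2) by (auto simp: numeral_2_eq_2 less_Suc_eq flip_at)
    with 5(1) show ?thesis by blast
  next
    case 6
    then have "\<iota> j < r" "\<iota> i \<le> r" "1 \<le> \<iota> j" using ri rj by auto
    moreover have "flip r N (\<iota> j) (Suc N - r) = Suc N - r" if "\<iota> i = r"
      using 6(2) that ri rj N by (subst flip_mirror) (auto simp: flip_at)
    ultimately have "\<forall>k<2. \<not> basc (foldl bact w (alternating_word k i j)) (if even k then i else j)"
      using d 6(2) by (auto simp: numeral_2_eq_2 less_Suc_eq flip_at)
    with 6(1) show ?thesis by blast
  qed
next
  fix w :: "nat \<Rightarrow> nat"
  assume w: "w \<in> bstates" and asc: "\<And>i. i \<in> I \<Longrightarrow> basc w i"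
  have lo: "w p < w (Suc p)" if "1 \<le> p" "p < r" for p
  proof -
    have "p \<in> \<iota> ` I" using bij that by (auto simp: bij_betw_def)
    then show ?thesis using asc that by force
  qed
  have mid: "w r < w (Suc N - r)"
  proof -
    have "r \<in> \<iota> ` I" using bij r by (auto simp: bij_betw_def)
    then show ?thesis using asc by force
  qed
  have hi: "w p < w (Suc p)" if "Suc N - r \<le> p" "p < N" for p
  proof -
    define q where "q = N - p"
    have q: "p = Suc N - Suc q" "Suc p = Suc N - q" "1 \<le> q" "q < r" "q \<in> {1..N}" "Suc q \<in> {1..N}"
      using that N r by (auto simp: q_def)
    have "w (Suc N - Suc q) < w (Suc N - q)"
      unfolding bstates_mirror_less[OF w q(6,5)] by (rule lo[OF q(3,4)])
    then show ?thesis unfolding q(1,2)[symmetric] .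
  qed
  show "w = id"
  proof (rule permutes_increasing_imp_id)
    show "w permutes {1..N}" using w by simp
    fix p assume p: "1 \<le> p" "p < N"
    show "w p < w (Suc p)"
    proof (cases "p < r \<or> Suc N - r \<le> p")
      case True
      then show ?thesis using lo hi p by blast
    next
      case False
      show ?thesis
      proof (cases "N = 2 * r")
        case True
        then have "p = r" "Suc p = Suc N - r" using False p by auto
        then show ?thesis using mid by simp
      next
        case odd: False
        then have pr: "p = r \<or> p = Suc r" "N = Suc (2 * r)" using N False p by auto
        \<comment> \<open>For odd \<open>N\<close> the middle point is fixed, and
          \<open>w r < Suc N - w r\<close> puts \<open>w r\<close> below it and the mirror image
          above it.\<close>
        have "w (Suc N - r) = Suc N - w r" "w r \<le> N"
          using w r N permutes_in_image[of w "{1..N}" r] by auto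
        then show ?thesis using mid pr bstates_mid[OF w] by auto
      qed
    qed
  qed
qed

end


section \<open>Finite Coxeter groups and the Tits form\<close>

text \<open>Minus the off-diagonal entry of the Tits form; 1 is the limit for growing
  labels.\<close>

definition edge_weight :: "enat \<Rightarrow> real" where
  "edge_weight m = (case m of enat k \<Rightarrow> cos (pi / real k) | \<infinity> \<Rightarrow> 1)"

text \<open>The reflection \<open>v - 2 * B(e_i, v) * e_i\<close> of the geometric representation,
  in coordinates; \<open>B\<close> is the Tits form, normalised by
  \<open>B(e_i, e_i) = 1\<close>.\<close>

definition reflect :: "'a set \<Rightarrow> ('a \<Rightarrow> 'a \<Rightarrow> enat) \<Rightarrow> 'a \<Rightarrow> ('a \<Rightarrow> real) \<Rightarrow> 'a \<Rightarrow> real" where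
  "reflect I M i v = v(i := 2 * (\<Sum>j\<in>I - {i}. edge_weight (M i j) * v j) - v i)"

definition tits_action :: "'a set \<Rightarrow> ('a \<Rightarrow> 'a \<Rightarrow> enat) \<Rightarrow> 'a list \<Rightarrow> ('a \<Rightarrow> real) \<Rightarrow> 'a \<Rightarrow> real" where
  "tits_action I M u v = foldr (reflect I M) u v"

lemma tits_action_append: "tits_action I M (u @ v) x = tits_action I M u (tits_action I M v x)"
  by (simp add: tits_action_def)

lemma reflect_reflect: "reflect I M i (reflect I M i v) = v"
proof -
  have "(\<Sum>j\<in>I - {i}. edge_weight (M i j) * (v(i := x)) j) = (\<Sum>j\<in>I - {i}. edge_weight (M i j) * v j)" for x
    by (intro sum.cong) auto
  then show ?thesis by (auto simp: reflect_def fun_eq_iff)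
qed

text \<open>In the plane of two reflections, suitably recentred, the coordinates are consecutive values of
  a function \<open>a cos x + b sin x\<close> on an arithmetic progression with step \<open>\<pi> / m\<close>.\<close>

lemma reflect_pair_power:
  assumes "finite I" "i \<in> I" "j \<in> I" "i \<noteq> j" "M i j = enat m" "M j i = enat m" "2 \<le> m"
  shows "((\<lambda>v. reflect I M i (reflect I M j v)) ^^ m) v = v"
proof -
  define \<theta> where "\<theta> = pi / real m"
  define t where "t = 2 * cos \<theta>"
  define A where "A = 2 * (\<Sum>k\<in>I - {i} - {j}. edge_weight (M i k) * v k)"
  define B where "B = 2 * (\<Sum>k\<in>I - {i} - {j}. edge_weight (M j k) * v k)"
  have "0 < \<theta>" "\<theta> < pi" using assms(7) by (auto simp: \<theta>_def field_simps)
  then have sin: "sin \<theta> > 0" by (rule sin_gt_zero)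
  have "4 - t ^ 2 = 4 * sin \<theta> ^ 2" by (simp add: t_def power_mult_distrib sin_squared_eq)
  then have den: "4 - t ^ 2 \<noteq> 0" using sin by simp
  \<comment> \<open>\<open>(p, q)\<close> is the common fixed point of the two affine reflections,
    with the remaining coordinates frozen in \<open>A\<close> and \<open>B\<close>; it exists as
    \<open>4 - t ^ 2 = 4 * sin \<theta> ^ 2\<close> is nonzero.\<close>
  define p q where "p = (2 * A + t * B) / (4 - t ^ 2)" and "q = (2 * B + t * A) / (4 - t ^ 2)"
  have pq: "2 * p = t * q + A" "2 * q = t * p + B"
    using den by (simp_all add: p_def q_def field_simps power2_eq_square)
  define a where "a = v i - p"
  \<comment> \<open>Chosen so that \<open>f 0 = v i - p\<close> and
    \<open>f (- \<theta>) = v j - q\<close>, the initial offsets from the fixed point.\<close>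
  define b where "b = (a * cos \<theta> - (v j - q)) / sin \<theta>"
  define f where "f x = a * cos x + b * sin x" for x
  have f_step: "t * f (x + \<theta>) - f x = f (x + 2 * \<theta>)" for x
  proof -
    have "f (x + 2 * \<theta>) + f x = t * f (x + \<theta>)"
    proof -
      have c: "cos (x + 2 * \<theta>) + cos x = 2 * cos (x + \<theta>) * cos \<theta>"
        using cos_add[of "x + \<theta>" \<theta>] cos_diff[of "x + \<theta>" \<theta>] by (simp add: add.assoc)
      have s: "sin (x + 2 * \<theta>) + sin x = 2 * sin (x + \<theta>) * cos \<theta>"
        using sin_add[of "x + \<theta>" \<theta>] sin_diff[of "x + \<theta>" \<theta>] by (simp add: add.assoc)
      have "f (x + 2 * \<theta>) + f x = a * (cos (x + 2 * \<theta>) + cos x) + b * (sin (x + 2 * \<theta>) + sin x)"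
        by (simp add: f_def algebra_simps)
      then show ?thesis unfolding c s by (simp add: f_def t_def algebra_simps)
    qed
    then show ?thesis by linarith
  qed
  have wt: "edge_weight (M i j) = cos \<theta>" "edge_weight (M j i) = cos \<theta>"
    using assms(5,6) by (auto simp: edge_weight_def \<theta>_def)
  have ri: "reflect I M i (v(i := x, j := y)) = v(i := t * y + A - x, j := y)" for x y
  proof -
    have "(\<Sum>k\<in>I - {i}. edge_weight (M i k) * (v(i := x, j := y)) k)
        = edge_weight (M i j) * y + (\<Sum>k\<in>I - {i} - {j}. edge_weight (M i k) * (v(i := x, j := y)) k)"
      using assms by (subst sum.remove[of _ j]) auto
    also have "(\<Sum>k\<in>I - {i} - {j}. edge_weight (M i k) * (v(i := x, j := y)) k) = A / 2"
      by (auto simp: A_def intro!: sum.cong)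
    finally have "(\<Sum>k\<in>I - {i}. edge_weight (M i k) * (v(i := x, j := y)) k) = cos \<theta> * y + A / 2"
      unfolding wt .
    then have "reflect I M i (v(i := x, j := y))
        = (v(i := x, j := y))(i := 2 * (cos \<theta> * y + A / 2) - (v(i := x, j := y)) i)"
      unfolding reflect_def by (simp only:)
    then show ?thesis using assms(4) by (simp add: t_def fun_eq_iff)
  qed
  have rj: "reflect I M j (v(i := x, j := y)) = v(i := x, j := t * x + B - y)" for x y
  proof -
    have "(\<Sum>k\<in>I - {j}. edge_weight (M j k) * (v(i := x, j := y)) k)
        = edge_weight (M j i) * x + (\<Sum>k\<in>I - {j} - {i}. edge_weight (M j k) * (v(i := x, j := y)) k)"
      using assms by (subst sum.remove[of _ i]) auto
    also have "(\<Sum>k\<in>I - {j} - {i}. edge_weight (M j k) * (v(i := x, j := y)) k) = B / 2"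
      by (auto simp: B_def intro!: sum.cong)
    finally have "(\<Sum>k\<in>I - {j}. edge_weight (M j k) * (v(i := x, j := y)) k) = cos \<theta> * x + B / 2"
      unfolding wt .
    then have "reflect I M j (v(i := x, j := y))
        = (v(i := x, j := y))(j := 2 * (cos \<theta> * x + B / 2) - (v(i := x, j := y)) j)"
      unfolding reflect_def by (simp only:)
    then show ?thesis using assms(4) by (simp add: t_def fun_eq_iff)
  qed
  have iter: "((\<lambda>v. reflect I M i (reflect I M j v)) ^^ k) v
      = v(i := p + f (real (2 * k) * \<theta>), j := q + f (real (2 * k) * \<theta> - \<theta>))" for k
  proof (induction k)
    case 0
    have "f 0 = v i - p" by (simp add: f_def a_def)
    moreover have "f (- \<theta>) = v j - q" using sin by (simp add: f_def b_def)
    ultimately show ?case by (simp add: fun_eq_iff)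
  next
    case (Suc k)
    define x where "x = real (2 * k) * \<theta>"
    have x: "real (2 * Suc k) * \<theta> = x + 2 * \<theta>" by (simp add: x_def algebra_simps)
    have "((\<lambda>v. reflect I M i (reflect I M j v)) ^^ Suc k) v
      = reflect I M i (reflect I M j (v(i := p + f x, j := q + f (x - \<theta>))))"
      by (simp only: funpow.simps comp_apply Suc x_def)
    also have "\<dots> = reflect I M i (v(i := p + f x, j := t * (p + f x) + B - (q + f (x - \<theta>))))"
      by (subst rj) rule
    also have "t * (p + f x) + B - (q + f (x - \<theta>)) = q + f (x + \<theta>)"
      using pq(2) f_step[of "x - \<theta>"] by (simp add: algebra_simps)
    also have "reflect I M i (v(i := p + f x, j := q + f (x + \<theta>)))
      = v(i := t * (q + f (x + \<theta>)) + A - (p + f x), j := q + f (x + \<theta>))"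
      by (rule ri)
    also have "t * (q + f (x + \<theta>)) + A - (p + f x) = p + f (x + 2 * \<theta>)"
      using pq(1) f_step[of x] by (simp add: algebra_simps)
    finally show ?case unfolding x by (simp add: algebra_simps)
  qed
  \<comment> \<open>Each product of the two reflections advances the argument by
    \<open>2 * \<theta>\<close>, so \<open>m\<close> of them make a full turn.\<close>
  have "real (2 * m) * \<theta> = 2 * pi" using assms(7) by (simp add: \<theta>_def)
  then have "f (real (2 * m) * \<theta>) = f 0" "f (real (2 * m) * \<theta> - \<theta>) = f (- \<theta>)"
    unfolding f_def by (simp_all only: cos_2pi_minus sin_2pi_minus) simp_all
  then show ?thesis using iter[of m] iter[of 0] by simp
qed

lemma tits_action_cong:
  assumes "coxeter_matrix I M" "(u, v) \<in> word_cong I (coxeter_relations I M)"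
  shows "tits_action I M u = tits_action I M v"
  using assms(2)
proof induction
  case (base u v)
  then obtain m i j where m: "u = concat (replicate m [i, j])" "v = []"
      "i \<in> I" "j \<in> I" "M i j = enat m"
    by (auto simp: coxeter_relations_def)
  have pow: "tits_action I M (concat (replicate k [i, j])) x
      = ((\<lambda>v. reflect I M i (reflect I M j v)) ^^ k) x" for k x
    by (induction k) (auto simp: tits_action_def)
  show ?case
  proof (cases "i = j")
    case True
    then have "m = 1" using m assms(1) by (auto simp: coxeter_matrix_def one_enat_def)
    then show ?thesis using m True by (auto simp: tits_action_def reflect_reflect)
  next
    case False
    have "M j i = enat m" "2 \<le> m" "finite I"
      using assms(1) m False unfolding coxeter_matrix_def
      by (metis, metis enat_ord_simps(1) numeral_eq_enat, metis)
    then show ?thesis using m False pow reflect_pair_power[of I i j M m]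
      by (auto simp: fun_eq_iff tits_action_def)
  qed
next
  case (mult u v u' v')
  then show ?case by (intro ext) (simp add: tits_action_append)
qed auto

lemma reflect_linear:
  "reflect I M i (\<lambda>k. a * x k + b * y k) = (\<lambda>k. a * reflect I M i x k + b * reflect I M i y k)"
proof -
  have "(\<Sum>j\<in>I - {i}. edge_weight (M i j) * (a * x j + b * y j))
    = a * (\<Sum>j\<in>I - {i}. edge_weight (M i j) * x j) + b * (\<Sum>j\<in>I - {i}. edge_weight (M i j) * y j)"
    by (simp add: sum_distrib_left flip: sum.distrib) (auto intro!: sum.cong simp: algebra_simps)
  then show ?thesis by (auto simp: reflect_def fun_eq_iff algebra_simps)
qed

lemma tits_action_linear:
  "tits_action I M u (\<lambda>k. a * x k + b * y k)
    = (\<lambda>k. a * tits_action I M u x k + b * tits_action I M u y k)"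
  by (induction u) (auto simp: tits_action_def reflect_linear)

text \<open>Averaging the standard inner product over the group gives an invariant positive definite form
  \<open>Q\<close>, for which the generators are orthogonal reflections. Hence \<open>Q (e\<^sub>i, v)\<close> is a positive
  multiple of the value of the Tits form at \<open>(e\<^sub>i, v)\<close>.\<close>

lemma finite_type_positive:
  fixes c :: "'a \<Rightarrow> real"
  assumes cox: "coxeter_matrix I M" and fin: "finite_type I M"
    and c_nonneg: "\<And>i. i \<in> I \<Longrightarrow> 0 \<le> c i" and c_pos: "i0 \<in> I" "0 < c i0"
  shows "\<exists>i\<in>I. 0 < c i \<and> (\<Sum>j\<in>I - {i}. edge_weight (M i j) * c j) < c i"
proof -
  let ?G = "coxeter_group I M"
  let ?cl = "word_class I (coxeter_relations I M)"
  have finI: "finite I" using cox by (simp add: coxeter_matrix_def)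
  have carr: "carrier ?G = ?cl ` lists I"
    by (simp add: coxeter_group_def carrier_presented_monoid)
  have finG: "finite (carrier ?G)" using fin by (simp add: finite_type_def)
  \<comment> \<open>A group element acts through any word of its class;
    \<open>tits_action_cong\<close> makes the choice harmless.\<close>
  define \<rho> where "\<rho> w = tits_action I M (SOME u. u \<in> w)" for w
  have \<rho>: "\<rho> (?cl u) = tits_action I M u" if "u \<in> lists I" for u
  proof -
    have "u \<in> ?cl u" using that by (auto simp: word_class_def intro: word_cong.refl)
    then have "(SOME v. v \<in> ?cl u) \<in> ?cl u" by (rule someI)
    then have "(u, SOME v. v \<in> ?cl u) \<in> word_cong I (coxeter_relations I M)"
      by (simp add: word_class_def)
    then show ?thesis unfolding \<rho>_def by (rule tits_action_cong[OF cox, symmetric])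
  qed
  have \<rho>_linear: "\<rho> w (\<lambda>k. a * x k + b * y k) = (\<lambda>k. a * \<rho> w x k + b * \<rho> w y k)" for w a b x y
    unfolding \<rho>_def by (rule tits_action_linear)
  define Q where "Q x y = (\<Sum>w\<in>carrier ?G. \<Sum>k\<in>I. \<rho> w x k * \<rho> w y k)" for x y :: "'a \<Rightarrow> real"
  have Q_sym: "Q x y = Q y x" for x y by (simp add: Q_def mult.commute)
  have Q_linear: "Q x (\<lambda>k. a * y k + b * z k) = a * Q x y + b * Q x z" for x y z a b
  proof -
    have "Q x (\<lambda>k. a * y k + b * z k)
        = (\<Sum>w\<in>carrier ?G. \<Sum>k\<in>I. a * (\<rho> w x k * \<rho> w y k) + b * (\<rho> w x k * \<rho> w z k))"
      unfolding Q_def \<rho>_linear by (auto intro!: sum.cong simp: algebra_simps)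
    then show ?thesis by (simp add: Q_def sum.distrib sum_distrib_left)
  qed
  have Q_reflect: "Q (reflect I M i x) (reflect I M i y) = Q x y" if i: "i \<in> I" for i x y
  proof -
    \<comment> \<open>Right multiplication by the generator is an involution of the group; it
      reindexes the average.\<close>
    define h where "h w = w \<otimes>\<^bsub>?G\<^esub> ?cl [i]" for w
    have h: "h (?cl u) = ?cl (u @ [i])" if "u \<in> lists I" for u
      unfolding h_def coxeter_group_def using that i by (subst mult_presented_monoid) auto
    have hG: "h w \<in> carrier ?G" if w: "w \<in> carrier ?G" for w
    proof -
      obtain u where "u \<in> lists I" "w = ?cl u" using w unfolding carr by auto
      then show ?thesis unfolding carr using h i by (intro image_eqI[of _ _ "u @ [i]"]) auto
    qed
    have hh: "h (h w) = w" if w: "w \<in> carrier ?G" for w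
    proof -
      obtain u where u: "u \<in> lists I" "w = ?cl u" using w unfolding carr by auto
      have "h (h w) = ?cl (u @ [i, i])" unfolding u(2) using u(1) i by (subst h, simp, subst h) auto
      also have "\<dots> = ?cl u"
        using word_cong_append_cancel[OF coxeter_relation_square[OF cox i] u(1)] u(1) i
        by (subst word_class_eq_iff) auto
      finally show ?thesis using u by simp
    qed
    have \<rho>h: "\<rho> w (reflect I M i z) = \<rho> (h w) z" if w: "w \<in> carrier ?G" for w z
    proof -
      obtain u where u: "u \<in> lists I" "w = ?cl u" using w unfolding carr by auto
      have "u @ [i] \<in> lists I" using u i by auto
      then show ?thesis unfolding u(2) h[OF u(1)] using u(1)
        by (simp only: \<rho> tits_action_append) (simp add: tits_action_def)
    qed
    have "Q (reflect I M i x) (reflect I M i y)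
        = (\<Sum>w\<in>carrier ?G. \<Sum>k\<in>I. \<rho> (h w) x k * \<rho> (h w) y k)"
      unfolding Q_def by (auto intro!: sum.cong simp: \<rho>h)
    also have "\<dots> = Q x y" unfolding Q_def
      by (rule sum.reindex_bij_witness[of _ h h]) (auto simp: hh hG)
    finally show ?thesis .
  qed
  define e where "e i = (\<lambda>k. if k = i then 1 else 0 :: real)" for i :: 'a
  define B where "B i v = v i - (\<Sum>j\<in>I - {i}. edge_weight (M i j) * v j)" for i v
  \<comment> \<open>Invariance together with \<open>s_i e_i = - e_i\<close> determines the pairing
    with \<open>e i\<close> up to the factor \<open>Q (e i) (e i)\<close>.\<close>
  have Q_e: "Q (e i) v = Q (e i) (e i) * B i v" if i: "i \<in> I" for i v
  proof -
    have 1: "reflect I M i v = (\<lambda>k. 1 * v k + (- 2 * B i v) * e i k)" for v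
      by (auto simp: reflect_def e_def B_def fun_eq_iff)
    have "(\<Sum>j\<in>I - {i}. edge_weight (M i j) * e i j) = 0"
      by (intro sum.neutral) (auto simp: e_def)
    then have "B i (e i) = 1" by (simp add: B_def e_def)
    then have 2: "reflect I M i (e i) = (\<lambda>k. 0 * v k + (- 1) * e i k)"
      unfolding 1 by (auto simp: fun_eq_iff)
    have "Q (e i) v = Q (reflect I M i (e i)) (reflect I M i v)" using Q_reflect[OF i] by simp
    also have "\<dots> = - Q (e i) (reflect I M i v)"
      unfolding 2 by (subst Q_sym, subst Q_linear, subst Q_sym) simp
    also have "\<dots> = - Q (e i) v + 2 * B i v * Q (e i) (e i)"
      unfolding 1 Q_linear by simp
    finally show ?thesis by simp
  qed
  \<comment> \<open>Cut off outside \<open>I\<close>, so that \<open>d\<close> is a combination of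
    the vectors \<open>e i\<close> with \<open>i \<in> I\<close>.\<close>
  define d where "d k = (if k \<in> I then c k else 0)" for k
  have Q_sum: "Q (\<lambda>k. \<Sum>i\<in>J. d i * e i k) y = (\<Sum>i\<in>J. d i * Q (e i) y)"
    if "finite J" for J y
    using that
  proof induction
    case empty
    show ?case using Q_linear[of y 0 y 0 y] by (subst Q_sym) simp
  next
    case (insert i J)
    have "(\<lambda>k. \<Sum>i\<in>insert i J. d i * e i k) = (\<lambda>k. d i * e i k + 1 * (\<Sum>i\<in>J. d i * e i k))"
      using insert by simp
    then have "Q (\<lambda>k. \<Sum>i\<in>insert i J. d i * e i k) y
        = d i * Q y (e i) + 1 * Q y (\<lambda>k. \<Sum>i\<in>J. d i * e i k)"
      by (subst Q_sym) (simp only: Q_linear)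
    then show ?case using insert by (simp add: Q_sym[of y])
  qed
  have "(\<Sum>i\<in>I. d i * e i k) = d k" for k
  proof (cases "k \<in> I")
    case True
    then show ?thesis using finI by (subst sum.remove[of _ k]) (auto simp: e_def intro!: sum.neutral split: if_splits)
  qed (auto simp: e_def d_def intro!: sum.neutral split: if_splits)
  then have "Q d d = (\<Sum>i\<in>I. d i * Q (e i) d)" using Q_sum[OF finI, of d] by simp
  also have "\<dots> = (\<Sum>i\<in>I. d i * (Q (e i) (e i) * B i d))"
    by (rule sum.cong[OF HOL.refl], subst Q_e) auto
  finally have dQ: "Q d d = (\<Sum>i\<in>I. d i * (Q (e i) (e i) * B i d))" .
  have inner_nonneg: "0 \<le> (\<Sum>k\<in>I. \<rho> w x k * \<rho> w x k)" for w x by (intro sum_nonneg) auto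
  have Q_nonneg: "0 \<le> Q x x" for x unfolding Q_def by (intro sum_nonneg inner_nonneg)
  have "0 < Q d d"
  proof -
    \<comment> \<open>The identity alone contributes the ordinary square of \<open>d\<close>, which
      is positive at \<open>i0\<close>; the other summands are nonnegative.\<close>
    have nil: "?cl [] \<in> carrier ?G" unfolding carr by auto
    have "0 < d i0 * d i0" using c_pos by (simp add: d_def)
    also have "\<dots> \<le> (\<Sum>k\<in>I. d k * d k)"
      using finI c_pos by (intro member_le_sum) auto
    also have "\<dots> = (\<Sum>k\<in>I. \<rho> (?cl []) d k * \<rho> (?cl []) d k)"
      by (simp add: \<rho> tits_action_def)
    also have "\<dots> \<le> Q d d" unfolding Q_def
      using finG nil inner_nonneg by (intro member_le_sum[of "?cl []" _ "\<lambda>w. \<Sum>k\<in>I. \<rho> w d k * \<rho> w d k"]) auto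
    finally show ?thesis .
  qed
  then obtain i where i: "i \<in> I" "0 < d i * (Q (e i) (e i) * B i d)"
    unfolding dQ by (metis (no_types, lifting) not_less sum_nonpos)
  have "0 \<le> d i" "0 \<le> Q (e i) (e i)" using i c_nonneg Q_nonneg by (auto simp: d_def)
  then have "0 < d i" "0 < B i d" using i(2) by (auto simp: zero_less_mult_iff)
  moreover have "(\<Sum>j\<in>I - {i}. edge_weight (M i j) * d j) = (\<Sum>j\<in>I - {i}. edge_weight (M i j) * c j)"
    by (intro sum.cong) (auto simp: d_def)
  ultimately show ?thesis using i by (intro bexI[of _ i]) (auto simp: B_def d_def)
qed

section \<open>Excluded subdiagrams\<close>

lemma edge_weight_mono:
  assumes "enat k \<le> m" "1 \<le> k"
  shows "cos (pi / real k) \<le> edge_weight m"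
proof (cases m)
  case (enat l)
  then have "k \<le> l" using assms by simp
  then show ?thesis unfolding enat edge_weight_def using assms(2)
    by (auto intro!: cos_monotone_0_pi_le simp: field_simps)
qed (simp add: edge_weight_def)

lemma edge_weight_bounds:
  "2 \<le> m \<Longrightarrow> 0 \<le> edge_weight m" "3 \<le> m \<Longrightarrow> 1 / 2 \<le> edge_weight m"
  "4 \<le> m \<Longrightarrow> sqrt 2 / 2 \<le> edge_weight m" "6 \<le> m \<Longrightarrow> sqrt 3 / 2 \<le> edge_weight m"
  using edge_weight_mono[of 2 m] edge_weight_mono[of 3 m] edge_weight_mono[of 4 m]
    edge_weight_mono[of 6 m]
  by (simp_all add: numeral_eq_enat cos_60 cos_45 cos_30)

text \<open>To contradict finiteness it is enough to bound the neighbour sum from below on some set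
  \<open>J\<close>, as the weights between distinct nodes and the entries of \<open>c\<close> are
  nonnegative.\<close>

lemma finite_type_no_superharmonic:
  fixes c :: "'a \<Rightarrow> real"
  assumes cox: "coxeter_matrix I M" and fin: "finite_type I M"
    and c_nonneg: "\<And>i. i \<in> I \<Longrightarrow> 0 \<le> c i" and c_pos: "i0 \<in> I" "0 < c i0"
    and sup: "\<And>i. i \<in> I \<Longrightarrow> 0 < c i \<Longrightarrow>
      \<exists>J \<subseteq> I - {i}. c i \<le> (\<Sum>j\<in>J. edge_weight (M i j) * c j)"
  shows False
proof -
  obtain i where i: "i \<in> I" "0 < c i" "(\<Sum>j\<in>I - {i}. edge_weight (M i j) * c j) < c i"
    using finite_type_positive[OF cox fin, of c i0] c_nonneg c_pos by auto
  obtain J where J: "J \<subseteq> I - {i}" "c i \<le> (\<Sum>j\<in>J. edge_weight (M i j) * c j)" using sup i by blast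
  have "2 \<le> M i j" if "j \<in> I - {i}" for j using that i cox by (auto simp: coxeter_matrix_def)
  then have "(\<Sum>j\<in>J. edge_weight (M i j) * c j) \<le> (\<Sum>j\<in>I - {i}. edge_weight (M i j) * c j)"
    using cox J c_nonneg edge_weight_bounds(1) by (intro sum_mono2) (auto simp: coxeter_matrix_def)
  then show False using i J by simp
qed

text \<open>The entries \<open>sqrt 3\<close>, 2, 1 form the null vector of affine G_2 along a path
  with labels 6 and 3. Larger labels only increase the weights.\<close>

lemma finite_type_label_le_5:
  assumes cox: "coxeter_matrix I M" and fin: "finite_type I M"
    and ijk: "i \<in> I" "j \<in> I" "k \<in> I" "i \<noteq> j" "i \<noteq> k" "j \<noteq> k"
    and M: "6 \<le> M i j" "3 \<le> M j k"
  shows False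
proof -
  have sym: "M j i = M i j" "M k j = M j k" using cox ijk by (auto simp: coxeter_matrix_def)
  define c :: "'a \<Rightarrow> real" where "c x = (if x = i then sqrt 3 else if x = j then 2 else if x = k then 1 else 0)" for x
  have w: "sqrt 3 / 2 \<le> edge_weight (M i j)" "1 / 2 \<le> edge_weight (M j k)"
    using M edge_weight_bounds by auto
  have "3 / 2 \<le> edge_weight (M i j) * sqrt 3"
    using mult_right_mono[OF w(1), of "sqrt 3"] by simp
  then have 2: "2 \<le> edge_weight (M i j) * sqrt 3 + edge_weight (M j k)" using w by linarith
  show False
  proof (rule finite_type_no_superharmonic[OF cox fin, of c i])
    fix x assume "x \<in> I" "0 < c x"
    then consider "x = i" | "x = j" | "x = k" by (auto simp: c_def split: if_splits)
    then show "\<exists>J\<subseteq>I - {x}. c x \<le> (\<Sum>j\<in>J. edge_weight (M x j) * c j)"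
    proof cases
      case 1
      then show ?thesis using w ijk by (intro exI[of _ "{j}"]) (auto simp: c_def)
    next
      case 2
      then show ?thesis using \<open>2 \<le> edge_weight (M i j) * sqrt 3 + edge_weight (M j k)\<close> ijk sym
        by (intro exI[of _ "{i, k}"]) (auto simp: c_def)
    next
      case 3
      then show ?thesis using w ijk sym by (intro exI[of _ "{j}"]) (auto simp: c_def)
    qed
  qed (use ijk in \<open>auto simp: c_def\<close>)
qed

text \<open>The constant vector is the null vector of a cycle, the affine diagram of type A; two
  neighbours of weight at least 1/2 suffice at every node.\<close>

lemma finite_type_no_cycle:
  assumes cox: "coxeter_matrix I M" and fin: "finite_type I M"
    and S: "S \<subseteq> I" "S \<noteq> {}"
    and deg: "\<And>x. x \<in> S \<Longrightarrow>
      \<exists>y z. y \<in> S \<and> z \<in> S \<and> y \<noteq> z \<and> y \<noteq> x \<and> z \<noteq> x \<and> 3 \<le> M x y \<and> 3 \<le> M x z"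
  shows False
proof -
  obtain x0 where "x0 \<in> S" using S by auto
  define c :: "'a \<Rightarrow> real" where "c x = (if x \<in> S then 1 else 0)" for x
  show False
  proof (rule finite_type_no_superharmonic[OF cox fin, of c x0])
    fix x assume "x \<in> I" "0 < c x"
    then have "x \<in> S" by (auto simp: c_def split: if_splits)
    then obtain y z where yz: "y \<in> S" "z \<in> S" "y \<noteq> z" "y \<noteq> x" "z \<noteq> x" "3 \<le> M x y" "3 \<le> M x z"
      using deg by blast
    then show "\<exists>J\<subseteq>I - {x}. c x \<le> (\<Sum>j\<in>J. edge_weight (M x j) * c j)"
      using S edge_weight_bounds(2)[of "M x y"] edge_weight_bounds(2)[of "M x z"] \<open>x \<in> S\<close>
      by (intro exI[of _ "{y, z}"]) (auto simp: c_def)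
  qed (use S \<open>x0 \<in> S\<close> in \<open>auto simp: c_def\<close>)
qed

text \<open>The affine diagram \<open>C\<close> and everything above it: a chain \<open>P\<close> both of whose ends carry a
  label at least \<open>4\<close>, towards \<open>x\<close> and towards \<open>y\<close>.\<close>

lemma finite_type_no_two_strong:
  assumes cox: "coxeter_matrix I M" and fin: "finite_type I M"
    and P: "P \<subseteq> I" and xy: "x \<in> I" "y \<in> I" "x \<notin> P" "y \<notin> P"
    and strong_x: "\<exists>p\<in>P. 4 \<le> M p x" and strong_y: "\<exists>p\<in>P. 4 \<le> M p y"
    and deg: "\<And>p. p \<in> P \<Longrightarrow> \<exists>q q'. q \<noteq> q' \<and>
      (q \<in> P \<and> q \<noteq> p \<and> 3 \<le> M p q \<or> q \<in> {x, y} \<and> 4 \<le> M p q) \<and>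
      (q' \<in> P \<and> q' \<noteq> p \<and> 3 \<le> M p q' \<or> q' \<in> {x, y} \<and> 4 \<le> M p q')"
  shows False
proof -
  \<comment> \<open>The null vector of affine \<open>C\<close>: an inner neighbour, with weight 1/2
    and entry \<open>sqrt 2\<close>, and an end, with weight \<open>sqrt 2 / 2\<close> and entry 1,
    each contribute at least \<open>sqrt 2 / 2\<close>.\<close>
  define c :: "'a \<Rightarrow> real" where "c z = (if z \<in> P then sqrt 2 else if z \<in> {x, y} then 1 else 0)" for z
  have sym: "M a b = M b a" if "a \<in> I" "b \<in> I" for a b using cox that by (auto simp: coxeter_matrix_def)
  have part: "sqrt 2 / 2 \<le> edge_weight (M p q) * c q"
    if "q \<in> P \<and> q \<noteq> p \<and> 3 \<le> M p q \<or> q \<in> {x, y} \<and> 4 \<le> M p q" for p q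
    using that
  proof
    assume "q \<in> P \<and> q \<noteq> p \<and> 3 \<le> M p q"
    then show ?thesis using edge_weight_bounds(2)[of "M p q"]
        mult_right_mono[of "1 / 2" "edge_weight (M p q)" "sqrt 2"] by (simp add: c_def)
  next
    assume "q \<in> {x, y} \<and> 4 \<le> M p q"
    then show ?thesis using edge_weight_bounds(3)[of "M p q"] xy by (auto simp: c_def)
  qed
  show False
  proof (rule finite_type_no_superharmonic[OF cox fin, of c x])
    fix z assume z: "z \<in> I" "0 < c z"
    then consider "z \<in> P" | "z \<in> {x, y}" "z \<notin> P" using xy by (auto simp: c_def split: if_splits)
    then show "\<exists>J\<subseteq>I - {z}. c z \<le> (\<Sum>j\<in>J. edge_weight (M z j) * c j)"
    proof cases
      case 1
      obtain q q' where q: "q \<noteq> q'"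
        "q \<in> P \<and> q \<noteq> z \<and> 3 \<le> M z q \<or> q \<in> {x, y} \<and> 4 \<le> M z q"
        "q' \<in> P \<and> q' \<noteq> z \<and> 3 \<le> M z q' \<or> q' \<in> {x, y} \<and> 4 \<le> M z q'"
        using deg[OF 1] that by (elim exE conjE)
      have "q \<in> I - {z}" "q' \<in> I - {z}" using q(2,3) P xy 1 by blast+
      moreover have "(\<Sum>j\<in>{q, q'}. edge_weight (M z j) * c j)
          = edge_weight (M z q) * c q + edge_weight (M z q') * c q'" using q(1) by simp
      moreover have "c z = sqrt 2 / 2 + sqrt 2 / 2" using 1 by (simp add: c_def)
      ultimately show ?thesis using part[OF q(2)] part[OF q(3)]
        by (intro exI[of _ "{q, q'}"]) auto
    next
      case 2
      then obtain p where p: "p \<in> P" "4 \<le> M p z" using strong_x strong_y by blast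
      then have "1 \<le> edge_weight (M z p) * sqrt 2"
        using edge_weight_bounds(3)[of "M p z"] sym[of z p] z P
          mult_right_mono[of "sqrt 2 / 2" "edge_weight (M z p)" "sqrt 2"] by auto
      then show ?thesis using p P 2 by (intro exI[of _ "{p}"]) (auto simp: c_def)
    qed
  qed (use xy in \<open>auto simp: c_def\<close>)
qed


section \<open>Colourings of the diagram of type \<open>A\<close>\<close>

lemma enat_label_cases:
  fixes m :: enat
  assumes "2 \<le> m" "m \<le> 5"
  shows "m = 2 \<or> m = 3 \<or> m = 4 \<or> m = 5"
  using assms by (cases m) (auto simp: numeral_eq_enat)

lemma enat_eq_2: "2 \<le> (m :: enat) \<Longrightarrow> \<not> 3 \<le> m \<Longrightarrow> m = 2"
  by (cases m) (auto simp: numeral_eq_enat)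

text \<open>Each node of colour \<open>A\<close> is a run by itself and has \<open>B\<close> on at
  most one side, so that next to a run of \<open>B\<close> the reversal of \<open>A\<close> acts as
  one adjacent swap.\<close>

definition single_edge :: "nat \<Rightarrow> (nat \<Rightarrow> 'a) \<Rightarrow> 'a \<Rightarrow> 'a \<Rightarrow> bool" where
  "single_edge n col A B \<longleftrightarrow> (\<forall>x\<in>{1..n}. col x = A \<longrightarrow>
    (1 < x \<longrightarrow> col (x - 1) \<noteq> A) \<and> (x < n \<longrightarrow> col (Suc x) \<noteq> A) \<and>
    \<not> (1 < x \<and> x < n \<and> col (x - 1) = B \<and> col (Suc x) = B))"

text \<open>The nodes from \<open>p + 1\<close> to \<open>q\<close> are a maximal run of
  \<open>B\<close> that starts next to an \<open>A\<close>. Label 4 forces another \<open>A\<close>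
  behind it, label 5 is impossible. It is a predicate of the colouring so that it can be imposed on
  the reversed colouring as well.\<close>

definition branch_rule :: "nat \<Rightarrow> ('a \<Rightarrow> 'a \<Rightarrow> enat) \<Rightarrow> (nat \<Rightarrow> 'a) \<Rightarrow> bool" where
  "branch_rule n M' col \<longleftrightarrow> (\<forall>p q A B. single_edge n col A B \<longrightarrow> A \<noteq> B \<longrightarrow>
    1 \<le> p \<longrightarrow> p < q \<longrightarrow> q \<le> n \<longrightarrow> col p = A \<longrightarrow> (\<forall>x\<in>{p<..q}. col x = B) \<longrightarrow>
    (q < n \<longrightarrow> col (Suc q) \<noteq> B) \<longrightarrow> M' A B = 4 \<or> M' A B = 5 \<longrightarrow>
    M' A B = 4 \<and> q < n \<and> col (Suc q) = A)"

lemma branch_rule_cong: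
  assumes "\<And>x. x \<in> {1..n} \<Longrightarrow> col x = col' x"
  shows "branch_rule n M' col \<longleftrightarrow> branch_rule n M' col'"
proof -
  have *: "branch_rule n M' c" if c: "\<And>x. x \<in> {1..n} \<Longrightarrow> c x = d x" and d: "branch_rule n M' d" for c d
    unfolding branch_rule_def
  proof (intro allI impI)
    fix p q A B
    assume h: "single_edge n c A B" "A \<noteq> B" "1 \<le> p" "p < q" "q \<le> n" "c p = A"
      "\<forall>x\<in>{p<..q}. c x = B" "q < n \<longrightarrow> c (Suc q) \<noteq> B" "M' A B = 4 \<or> M' A B = 5"
    have "c (x - 1) = d (x - 1)" if "1 < x" "x \<le> n" for x using c[of "x - 1"] that by (cases x) auto
    then have "single_edge n d A B" using h(1) c unfolding single_edge_def by force
    moreover have "d p = A" "\<forall>x\<in>{p<..q}. d x = B" "q < n \<longrightarrow> d (Suc q) \<noteq> B"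
      using h c by auto
    ultimately have "M' A B = 4 \<and> q < n \<and> d (Suc q) = A"
      using d h(2-5,9) unfolding branch_rule_def by blast
    then show "M' A B = 4 \<and> q < n \<and> c (Suc q) = A" using c by auto
  qed
  show ?thesis using *[of col col'] *[of col' col] assms by auto
qed

text \<open>The colouring of the nodes \<open>1..n\<close> of the target diagram by the nodes of the source diagram,
  with the restrictions that the braid relations between longest elements impose on it.\<close>

locale colouring =
  fixes I' :: "'a set" and M' :: "'a \<Rightarrow> 'a \<Rightarrow> enat" and n :: nat and col :: "nat \<Rightarrow> 'a"
  assumes cox: "coxeter_matrix I' M'" and irr: "irreducible_coxeter I' M'"
    and fin: "finite_type I' M'" and card_gt_2: "2 < card I'"
    and surj: "col ` {1..n} = I'"
    and adjacent: "1 \<le> p \<Longrightarrow> p < n \<Longrightarrow> col p \<noteq> col (Suc p) \<Longrightarrow> 3 \<le> M' (col p) (col (Suc p))"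
    and edge_adjacent: "i \<in> I' \<Longrightarrow> j \<in> I' \<Longrightarrow> i \<noteq> j \<Longrightarrow> 3 \<le> M' i j \<Longrightarrow>
      \<exists>p. 1 \<le> p \<and> p < n \<and> {col p, col (Suc p)} = {i, j}"
    and three_isolated: "1 \<le> p \<Longrightarrow> p < n \<Longrightarrow> M' (col p) (col (Suc p)) = 3 \<Longrightarrow>
      (1 < p \<longrightarrow> col (p - 1) \<notin> {col p, col (Suc p)}) \<and>
      (Suc p < n \<longrightarrow> col (Suc (Suc p)) \<notin> {col p, col (Suc p)})"
    and three_neighbour: "p \<in> {1..n} \<Longrightarrow> j \<in> I' \<Longrightarrow> j \<noteq> col p \<Longrightarrow> M' (col p) j = 3 \<Longrightarrow>
      1 < p \<and> col (p - 1) = j \<or> p < n \<and> col (Suc p) = j"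
    and branch: "branch_rule n M' col"
    and branch_mirror: "branch_rule n M' (\<lambda>p. col (Suc n - p))"
begin

lemma col_mem: "1 \<le> p \<Longrightarrow> p \<le> n \<Longrightarrow> col p \<in> I'"
  using surj by auto

lemma sym: "i \<in> I' \<Longrightarrow> j \<in> I' \<Longrightarrow> M' i j = M' j i"
  using cox by (auto simp: coxeter_matrix_def)

lemma ge_2: "i \<in> I' \<Longrightarrow> j \<in> I' \<Longrightarrow> i \<noteq> j \<Longrightarrow> 2 \<le> M' i j"
  using cox by (auto simp: coxeter_matrix_def)

text \<open>Connectedness: a path from \<open>S\<close> to a node outside has to leave
  \<open>S\<close> along an edge.\<close>

lemma outside_neighbour:
  assumes "S \<subseteq> I'" "S \<noteq> {}" "card S < card I'"
  shows "\<exists>i\<in>S. \<exists>k\<in>I' - S. 3 \<le> M' i k"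
proof (rule ccontr)
  assume no: "\<not> (\<exists>i\<in>S. \<exists>k\<in>I' - S. 3 \<le> M' i k)"
  obtain i where i: "i \<in> S" using assms by auto
  have "I' - S \<noteq> {}" using assms by auto
  then obtain k where k: "k \<in> I' - S" by auto
  have "(i, k) \<in> (coxeter_graph I' M')\<^sup>*" using irr i k assms by (auto simp: irreducible_coxeter_def)
  then have "k \<in> S"
  proof induction
    case (step y z)
    then show ?case using no by (auto simp: coxeter_graph_def)
  qed (rule i)
  then show False using k by simp
qed

text \<open>Connectedness provides a third node next to \<open>i\<close> or \<open>j\<close>, and a
  label of at least 6 beside another edge contains affine G_2. In rank 2 every finite label is of
  finite type, which is why \<open>card_gt_2\<close> matters.\<close>

lemma label_le_5:
  assumes "i \<in> I'" "j \<in> I'" "i \<noteq> j"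
  shows "M' i j \<le> 5"
proof (rule ccontr)
  assume "\<not> M' i j \<le> 5"
  then have ge: "6 \<le> M' i j" by (cases "M' i j") (auto simp: numeral_eq_enat)
  obtain a k where "a \<in> {i, j}" "k \<in> I' - {i, j}" "3 \<le> M' a k"
    using outside_neighbour[of "{i, j}"] assms card_gt_2 by auto
  then show False
    using finite_type_label_le_5[OF cox fin, of i j k] finite_type_label_le_5[OF cox fin, of j i k]
      ge sym[of i j] assms by auto
qed

lemma label_cases:
  assumes "i \<in> I'" "j \<in> I'" "i \<noteq> j"
  shows "M' i j = 2 \<or> M' i j = 3 \<or> M' i j = 4 \<or> M' i j = 5"
  using enat_label_cases ge_2 label_le_5 assms by blast

lemma label_3_or_strong:
  assumes "i \<in> I'" "j \<in> I'" "i \<noteq> j" "3 \<le> M' i j"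
  shows "M' i j = 3 \<or> 4 \<le> M' i j"
  using label_cases[OF assms(1-3)] assms(4) by auto

text \<open>\<open>three_neighbour\<close> puts \<open>j\<close> on one side of \<open>x\<close>,
  and \<open>three_isolated\<close> at this pair keeps both colours away from the other
  side.\<close>

lemma single:
  assumes x: "x \<in> {1..n}" and j: "j \<in> I'" "j \<noteq> col x" "M' (col x) j = 3"
  shows "1 < x \<Longrightarrow> col (x - 1) \<noteq> col x" "x < n \<Longrightarrow> col (Suc x) \<noteq> col x"
    "1 < x \<and> col (x - 1) = j \<and> (x < n \<longrightarrow> col (Suc x) \<noteq> j)
      \<or> x < n \<and> col (Suc x) = j \<and> (1 < x \<longrightarrow> col (x - 1) \<noteq> j)"
proof -
  consider "1 < x" "col (x - 1) = j" | "x < n" "col (Suc x) = j"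
    using three_neighbour[OF x j] by blast
  then have "(1 < x \<longrightarrow> col (x - 1) \<noteq> col x) \<and> (x < n \<longrightarrow> col (Suc x) \<noteq> col x) \<and>
    (1 < x \<and> col (x - 1) = j \<and> (x < n \<longrightarrow> col (Suc x) \<noteq> j)
      \<or> x < n \<and> col (Suc x) = j \<and> (1 < x \<longrightarrow> col (x - 1) \<noteq> j))"
  proof cases
    case 1
    then have "M' (col (x - 1)) (col (Suc (x - 1))) = 3"
      using j sym[of "col x" j] col_mem[of x] x by auto
    then show ?thesis using three_isolated[of "x - 1"] 1 x j by auto
  next
    case 2
    then show ?thesis using three_isolated[of x] x j by auto
  qed
  then show "1 < x \<Longrightarrow> col (x - 1) \<noteq> col x" "x < n \<Longrightarrow> col (Suc x) \<noteq> col x"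
    "1 < x \<and> col (x - 1) = j \<and> (x < n \<longrightarrow> col (Suc x) \<noteq> j)
      \<or> x < n \<and> col (Suc x) = j \<and> (1 < x \<longrightarrow> col (x - 1) \<noteq> j)" by blast+
qed

text \<open>Consecutive nodes of a stretch without repetition are joined in the source, so an edge
  between its end colours closes a cycle of at least three nodes.\<close>

lemma chain_no_cycle:
  assumes "1 \<le> l" "l + 2 \<le> k" "k \<le> n" "inj_on col {l..k}" "3 \<le> M' (col k) (col l)"
  shows False
proof (rule finite_type_no_cycle[OF cox fin, of "col ` {l..k}"])
  show "col ` {l..k} \<subseteq> I'" using assms col_mem by auto
  show "col ` {l..k} \<noteq> {}" using assms by auto
  have ne: "col y \<noteq> col z" if "y \<in> {l..k}" "z \<in> {l..k}" "y \<noteq> z" for y z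
    using assms(4) that by (auto simp: inj_on_def)
  have right: "3 \<le> M' (col y) (col (Suc y))" if "l \<le> y" "y < k" for y
    using adjacent[of y] ne[of y "Suc y"] that assms by auto
  then have left: "3 \<le> M' (col y) (col (y - 1))" if "l < y" "y \<le> k" for y
    using right[of "y - 1"] sym[of "col y" "col (y - 1)"] col_mem[of y] col_mem[of "y - 1"] that assms
    by auto
  fix x assume "x \<in> col ` {l..k}"
  then obtain y where y: "x = col y" "l \<le> y" "y \<le> k" by auto
  have close: "3 \<le> M' (col l) (col k)" using assms sym[of "col l" "col k"] col_mem[of l] col_mem[of k] by auto
  define a b where "a = (if y = l then k else y - 1)" and "b = (if y = k then l else Suc y)"
  have "a \<in> {l..k}" "b \<in> {l..k}" "a \<noteq> b" "a \<noteq> y" "b \<noteq> y" using assms y by (auto simp: a_def b_def)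
  moreover have "3 \<le> M' x (col a)" "3 \<le> M' x (col b)"
    using left[of y] right[of y] y close assms(5) by (auto simp: a_def b_def)
  ultimately show "\<exists>u z. u \<in> col ` {l..k} \<and> z \<in> col ` {l..k} \<and> u \<noteq> z \<and> u \<noteq> x \<and> z \<noteq> x \<and>
      3 \<le> M' x u \<and> 3 \<le> M' x z"
    using ne y by (intro exI[of _ "col a"] exI[of _ "col b"]) auto
qed

text \<open>A chain that starts next to a label at least \<open>4\<close> can be prolonged only by a new node and a
  label \<open>3\<close>.\<close>

lemma chain_extend:
  assumes a: "1 \<le> a" "a < k" "k \<le> n" and inj: "inj_on col {a..k}"
    and B: "B \<in> I'" "B \<notin> col ` {a..k}" "4 \<le> M' (col a) B"
    and e: "e \<in> I'" "e \<noteq> col k" "e \<noteq> col (k - 1)" "3 \<le> M' (col k) e"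
  shows "e \<notin> col ` {a..k}" "e \<noteq> B" "M' (col k) e = 3"
proof -
  have ne: "col y \<noteq> col z" if "y \<in> {a..k}" "z \<in> {a..k}" "y \<noteq> z" for y z
    using inj that by (auto simp: inj_on_def)
  have right: "3 \<le> M' (col y) (col (Suc y))" if "a \<le> y" "y < k" for y
    using adjacent[of y] ne[of y "Suc y"] that a by auto
  have left: "3 \<le> M' (col y) (col (y - 1))" if "a < y" "y \<le> k" for y
  proof -
    have "3 \<le> M' (col (y - 1)) (col (Suc (y - 1)))" by (rule right) (use that in auto)
    moreover have "Suc (y - 1) = y" "y - 1 \<in> {1..n}" "y \<in> {1..n}" using that a by auto
    ultimately show ?thesis using sym[of "col y" "col (y - 1)"] col_mem by simp
  qed
  have pred: "y - 1 \<in> {a..k}" "col (y - 1) \<noteq> col y" "y < k \<Longrightarrow> col (y - 1) \<noteq> col (Suc y)"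
    if "a < y" "y \<le> k" for y
  proof -
    show m: "y - 1 \<in> {a..k}" using that by auto
    show "col (y - 1) \<noteq> col y" using that a by (intro ne m) auto
    show "col (y - 1) \<noteq> col (Suc y)" if "y < k"
      using that \<open>a < y\<close> a by (intro ne m) auto
  qed
  show new: "e \<notin> col ` {a..k}"
  proof
    assume "e \<in> col ` {a..k}"
    then obtain l where l: "e = col l" "a \<le> l" "l \<le> k" by auto
    then have "l \<noteq> k" "l \<noteq> k - 1" using e by auto
    then have "l + 2 \<le> k" using l by linarith
    moreover have "inj_on col {l..k}" using inj by (rule inj_on_subset) (use l in auto)
    ultimately show False using chain_no_cycle[of l k] l a e by auto
  qed
  have P: "col ` {a..k} \<subseteq> I'" using a col_mem by auto
  have aB: "3 \<le> M' (col a) B" using B(3) by (rule order_trans[rotated]) (simp add: numeral_eq_enat)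
  \<comment> \<open>An edge back to \<open>B\<close> would close a cycle through
    \<open>B\<close>.\<close>
  show eB: "e \<noteq> B"
  proof
    assume eB: "e = B"
    show False
    proof (rule finite_type_no_cycle[OF cox fin, of "insert B (col ` {a..k})"])
      show "insert B (col ` {a..k}) \<subseteq> I'" using P B by auto
      have Ba: "3 \<le> M' B (col a)" "3 \<le> M' B (col k)"
        using aB e eB sym[of B "col a"] sym[of B "col k"] B col_mem[of a] col_mem[of k] a by auto
      fix x assume "x \<in> insert B (col ` {a..k})"
      then consider "x = B" | y where "x = col y" "a \<le> y" "y \<le> k" by auto
      then show "\<exists>u z. u \<in> insert B (col ` {a..k}) \<and> z \<in> insert B (col ` {a..k}) \<and> u \<noteq> z \<and>
          u \<noteq> x \<and> z \<noteq> x \<and> 3 \<le> M' x u \<and> 3 \<le> M' x z"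
      proof cases
        case 1
        then show ?thesis using Ba ne[of a k] a B(2)
          by (intro exI[of _ "col a"] exI[of _ "col k"]) auto
      next
        case (2 y)
        define u z where "u = (if y = a then B else col (y - 1))"
          and "z = (if y = k then B else col (Suc y))"
        have "u \<in> insert B (col ` {a..k})" "z \<in> insert B (col ` {a..k})"
          using 2 pred(1)[of y] by (auto simp: u_def z_def)
        moreover have "u \<noteq> x" "z \<noteq> x" using 2 B(2) pred(2)[of y] ne[of y "Suc y"]
          by (auto simp: u_def z_def)
        moreover have "u \<noteq> z" using 2 B(2) pred(1,3)[of y] a
          by (auto simp: u_def z_def)
        moreover have "3 \<le> M' x u" "3 \<le> M' x z"
          using 2 aB e eB left[of y] right[of y] by (auto simp: u_def z_def)
        ultimately show ?thesis by blast
      qed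
    qed simp
  qed
  show "M' (col k) e = 3"
  proof (rule ccontr)
    assume "M' (col k) e \<noteq> 3"
    then have strong: "4 \<le> M' (col k) e"
      using label_3_or_strong[of "col k" e] e col_mem[of k] a by auto
    \<comment> \<open>A second strong label at the far end would make the chain, with
      \<open>B\<close> and \<open>e\<close> attached to its ends, contain affine
      \<open>C\<close>.\<close>
    show False
    proof (rule finite_type_no_two_strong[OF cox fin P B(1) e(1) B(2) new])
      show "\<exists>p\<in>col ` {a..k}. 4 \<le> M' p B" using B(3) a by auto
      show "\<exists>p\<in>col ` {a..k}. 4 \<le> M' p e" using strong a by auto
      fix p assume "p \<in> col ` {a..k}"
      then obtain y where y: "p = col y" "a \<le> y" "y \<le> k" by auto
      define u z where "u = (if y = a then B else col (y - 1))"
        and "z = (if y = k then e else col (Suc y))"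
      have "u \<in> col ` {a..k} \<and> u \<noteq> p \<and> 3 \<le> M' p u \<or> u \<in> {B, e} \<and> 4 \<le> M' p u"
        using y pred(1,2)[of y] left[of y] B(3) by (auto simp: u_def)
      moreover have "z \<in> col ` {a..k} \<and> z \<noteq> p \<and> 3 \<le> M' p z \<or> z \<in> {B, e} \<and> 4 \<le> M' p z"
        using y ne[of y "Suc y"] right[of y] strong by (auto simp: z_def)
      moreover have "u \<noteq> z"
        using y pred(1,3)[of y] a B(2) new eB by (auto simp: u_def z_def)
      ultimately show "\<exists>q q'. q \<noteq> q' \<and>
          (q \<in> col ` {a..k} \<and> q \<noteq> p \<and> 3 \<le> M' p q \<or> q \<in> {B, e} \<and> 4 \<le> M' p q) \<and>
          (q' \<in> col ` {a..k} \<and> q' \<noteq> p \<and> 3 \<le> M' p q' \<or> q' \<in> {B, e} \<and> 4 \<le> M' p q')"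
        by blast
    qed
  qed
qed

section \<open>The two surviving colourings\<close>

definition bijective :: bool where
  "bijective \<longleftrightarrow> inj_on col {1..n} \<and>
    (\<forall>p\<in>{1..n}. \<forall>q\<in>{1..n}. M' (col p) (col q) = matrix_A p q)"

text \<open>The last colour fills the middle run from \<open>m\<close> to \<open>Suc n - m\<close>,
  which \<open>2 * m \<le> Suc n\<close> makes nonempty; the nodes \<open>1..m\<close> represent all
  colours.\<close>

definition folded :: bool where
  "folded \<longleftrightarrow> (let m = card I' in 2 * m \<le> Suc n \<and>
    (\<forall>p\<in>{1..n}. col (Suc n - p) = col p) \<and> (\<forall>p\<in>{m..Suc n - m}. col p = col m) \<and>
    bij_betw col {1..m} I' \<and>
    (\<forall>p\<in>{1..m}. \<forall>q\<in>{1..m}. M' (col p) (col q) = matrix_B m p q))"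

text \<open>Every edge has label 3, so equal colours are at least three nodes apart by
  \<open>single\<close> and \<open>three_isolated\<close>, and the first repetition on the path
  would close a cycle. An injective colouring identifies the source with the path.\<close>

lemma no_strong_imp_bijective:
  assumes all3: "\<And>i j. i \<in> I' \<Longrightarrow> j \<in> I' \<Longrightarrow> i \<noteq> j \<Longrightarrow> \<not> 4 \<le> M' i j"
  shows bijective
proof -
  have three: "M' i j = 3" if "i \<in> I'" "j \<in> I'" "i \<noteq> j" "3 \<le> M' i j" for i j
    using label_3_or_strong that all3 by blast
  have nb: "col (Suc x) \<noteq> col x" if "1 \<le> x" "x < n" for x
  proof -
    have "col x \<in> I'" using col_mem that by simp
    then obtain k where "k \<in> I' - {col x}" "3 \<le> M' (col x) k"
      using outside_neighbour[of "{col x}"] card_gt_2 by auto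
    then show ?thesis using single(2)[of x k] three[of "col x" k] col_mem[of x] that by auto
  qed
  have "k \<le> n \<Longrightarrow> inj_on col {1..k}" for k
  proof (induction k)
    case (Suc k)
    have "col (Suc k) \<notin> col ` {1..k}"
    proof
      assume "col (Suc k) \<in> col ` {1..k}"
      then obtain l where l: "col (Suc k) = col l" "1 \<le> l" "l \<le> k" by auto
      have lk: "l \<noteq> k" using nb[of k] l Suc.prems by auto
      have k3: "M' (col k) (col (Suc k)) = 3"
        using nb[of k] adjacent[of k] three[of "col k" "col (Suc k)"] col_mem l Suc.prems by auto
      show False
      proof (cases "Suc l = k")
        case True
        then show False using three_isolated[of k] k3 l Suc.prems by auto
      next
        case False
        then have "l + 2 \<le> k" using l lk by linarith
        moreover have "inj_on col {l..k}" using inj_on_subset[OF Suc.IH] l Suc.prems by auto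
        ultimately show False using chain_no_cycle[of l k] l Suc.prems k3 by auto
      qed
    qed
    then show ?case using Suc by (simp add: atLeastAtMostSuc_conv)
  qed simp
  then have inj: "inj_on col {1..n}" by blast
  have mem: "col p \<in> I'" if "p \<in> {1..n}" for p using col_mem that by simp
  have "M' (col p) (col q) = matrix_A p q" if p: "p \<in> {1..n}" and q: "q \<in> {1..n}" for p q
  proof (cases "p = q")
    case True
    then show ?thesis using cox mem[OF p] by (simp add: matrix_A_def coxeter_matrix_def)
  next
    case False
    then have ne: "col p \<noteq> col q" using inj_onD[OF inj] p q by blast
    have two: "M' (col p) (col q) = 2" if far: "q \<noteq> Suc p" "p \<noteq> Suc q"
    proof -
      have "\<not> 3 \<le> M' (col p) (col q)"
      proof
        assume "3 \<le> M' (col p) (col q)"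
        then obtain z where z: "1 \<le> z" "z < n" "{col z, col (Suc z)} = {col p, col q}"
          using edge_adjacent[OF mem[OF p] mem[OF q] ne] by blast
        then have "col ` {z, Suc z} = col ` {p, q}" by simp
        then have "{z, Suc z} = {p, q}"
          using inj_on_image_eq_iff[OF inj, of "{z, Suc z}" "{p, q}"] p q z by simp
        then show False using far by (auto simp: doubleton_eq_iff)
      qed
      then show ?thesis using enat_eq_2 ge_2[OF mem[OF p] mem[OF q] ne] by blast
    qed
    have next3: "M' (col x) (col (Suc x)) = 3" if "x \<in> {1..n}" "Suc x \<in> {1..n}" for x
      using three[OF mem[OF that(1)] mem[OF that(2)]] adjacent[of x] nb[of x] that by fastforce
    consider "q = Suc p" | "p = Suc q" | "q \<noteq> Suc p" "p \<noteq> Suc q" by blast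
    then show ?thesis
    proof cases
      case 1
      then show ?thesis using next3[of p] p q by (simp add: matrix_A_def)
    next
      case 2
      then have "M' (col q) (col p) = 3" using next3[of q] p q by simp
      then have "M' (col p) (col q) = 3" using sym[OF mem[OF p] mem[OF q]] by simp
      then show ?thesis using 2 by (simp add: matrix_A_def)
    next
      case 3
      then show ?thesis using two False by (simp add: matrix_A_def)
    qed
  qed
  then show ?thesis using inj by (simp add: bijective_def)
qed

text \<open>The run of \<open>B\<close> behind \<open>p\<close> ends, by the branch rule, at a
  second \<open>A\<close>, the node \<open>a\<close>. From there the colours run to the right end as
  a chain without repetition and with labels 3. The labels 3 demand the same neighbours around the
  first \<open>A\<close>, so the left side repeats the chain in mirror image, and no node can be
  left over.\<close>

lemma strong_imp_folded:
  assumes AB: "A \<in> I'" "B \<in> I'" "A \<noteq> B" "4 \<le> M' A B"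
    and c: "c \<in> I'" "c \<noteq> A" "c \<noteq> B" "M' A c = 3"
    and p: "1 \<le> p" "p < n" "col p = A" "col (Suc p) = B"
  shows folded
proof -
  have nbrs: "1 < x \<and> col (x - 1) = c \<and> (x < n \<longrightarrow> col (Suc x) \<noteq> c)
      \<or> x < n \<and> col (Suc x) = c \<and> (1 < x \<longrightarrow> col (x - 1) \<noteq> c)"
    "1 < x \<Longrightarrow> col (x - 1) \<noteq> A" "x < n \<Longrightarrow> col (Suc x) \<noteq> A"
    if "x \<in> {1..n}" "col x = A" for x
    using single[of x c] that c by auto
  have se: "single_edge n col A B" unfolding single_edge_def
    using nbrs c by (intro ballI impI conjI) blast+
  define run where "run q \<longleftrightarrow> q \<le> n \<and> p < q \<and> (\<forall>x\<in>{p<..q}. col x = B)" for q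
  define q where "q = Greatest run"
  have bound: "y \<le> n" if "run y" for y using that by (simp add: run_def)
  have "{p<..Suc p} = {Suc p}" by auto
  then have "run (Suc p)" using p by (simp add: run_def)
  then have "run q" unfolding q_def using bound by (rule GreatestI_nat)
  then have q: "q \<le> n" "p < q" "\<forall>x\<in>{p<..q}. col x = B" by (auto simp: run_def)
  have q_max: "col (Suc q) \<noteq> B" if "q < n"
  proof
    assume "col (Suc q) = B"
    then have "run (Suc q)" using q that by (auto simp: run_def le_Suc_eq)
    then have "Suc q \<le> q" using Greatest_le_nat[of run "Suc q" n] bound unfolding q_def by blast
    then show False by simp
  qed
  have "M' A B = 4 \<or> M' A B = 5" using label_cases[of A B] AB by auto
  then have br: "M' A B = 4" "q < n" "col (Suc q) = A"
    using branch[unfolded branch_rule_def, rule_format, OF se AB(3) p(1) q(2,1) p(3)] q(3) q_max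
    by blast+
  define a where "a = Suc q"
  have a: "1 \<le> a" "a \<le> n" "col a = A" "col (a - 1) = B" "p < a - 1"
    using br q by (auto simp: a_def)
  \<comment> \<open>\<open>A\<close> needs a neighbour of colour \<open>c\<close>, and the left
    neighbour of \<open>a\<close> is \<open>B\<close>.\<close>
  have a_lt: "a < n" and a_next: "col (Suc a) = c" using nbrs(1)[of a] a c by auto
  \<comment> \<open>The first step leads to \<open>c\<close>; each later one is an instance of
    \<open>chain_extend\<close>, whose condition on the last two colours comes from
    \<open>three_isolated\<close>.\<close>
  have walk: "a < k \<Longrightarrow> k \<le> n \<Longrightarrow> inj_on col {a..k} \<and> B \<notin> col ` {a..k} \<and>
      (\<forall>x\<in>{a..<k}. M' (col x) (col (Suc x)) = 3)" for k
  proof (induction k)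
    case (Suc k)
    show ?case
    proof (cases "a = k")
      case True
      then have "{a..Suc k} = {a, Suc a}" by auto
      then show ?thesis using True a a_next c AB by auto
    next
      case False
      then have ak: "a < k" "k \<le> n" "k < n" using Suc.prems by auto
      then have IH: "inj_on col {a..k}" "B \<notin> col ` {a..k}"
        "\<And>x. x \<in> {a..<k} \<Longrightarrow> M' (col x) (col (Suc x)) = 3" using Suc.IH by blast+
      have k3: "M' (col (k - 1)) (col (Suc (k - 1))) = 3" using IH(3)[of "k - 1"] ak by auto
      have "col (Suc k) \<notin> {col (k - 1), col k}"
        using three_isolated[of "k - 1"] k3 ak a by auto
      moreover have "3 \<le> M' (col k) (col (Suc k))"
        using adjacent[of k] calculation ak a by auto
      ultimately have "col (Suc k) \<notin> col ` {a..k}" "col (Suc k) \<noteq> B" "M' (col k) (col (Suc k)) = 3"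
        using chain_extend[of a k B "col (Suc k)"] ak a IH AB col_mem[of "Suc k"] by auto
      moreover have "{a..Suc k} = insert (Suc k) {a..k}" "{a..<Suc k} = insert k {a..<k}"
        using ak by auto
      ultimately show ?thesis using IH by auto
    qed
  qed simp
  have inj: "inj_on col {a..n}" and Bn: "B \<notin> col ` {a..n}"
    and three: "\<And>x. a \<le> x \<Longrightarrow> x < n \<Longrightarrow> M' (col x) (col (Suc x)) = 3"
    using walk[of n] a_lt by auto
  have left: "\<forall>l\<le>k. a + l \<le> n \<longrightarrow> l < p \<and> col (p - l) = col (a + l)" for k
  proof (induction k)
    case 0
    then show ?case using p a by auto
  next
    case (Suc k)
    note IHl = Suc
    have "Suc k < p \<and> col (p - Suc k) = col (a + Suc k)" if an: "a + Suc k \<le> n"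
    proof -
    have k: "k < p" "col (p - k) = col (a + k)" using Suc an by auto
    define x where "x = p - k"
    have x: "x \<in> {1..n}" "col x = col (a + k)" using k p by (auto simp: x_def)
    have m3: "M' (col x) (col (Suc (a + k))) = 3" using three[of "a + k"] an x by auto
    have ne: "col (Suc (a + k)) \<noteq> col x"
      unfolding x(2) using inj_onD[OF inj, of "Suc (a + k)" "a + k"] an by auto
    \<comment> \<open>The neighbour required by the label 3 cannot lie on the right of
      \<open>x\<close>, where \<open>B\<close> or the preceding colour of the chain stands; so it
      lies on the left.\<close>
    have "col (Suc x) \<noteq> col (Suc (a + k))"
    proof (cases k)
      case 0
      then have "col (Suc x) = B" using p by (simp add: x_def)
      then show ?thesis using Bn an by auto
    next
      case (Suc l)
      then have "Suc x = p - l" using k by (simp add: x_def)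
      moreover have "col (p - l) = col (a + l)" using IHl(1) Suc an by simp
      ultimately show ?thesis using inj_onD[OF inj, of "a + l" "Suc (a + k)"] an Suc by auto
    qed
    then have "1 < x \<and> col (x - 1) = col (Suc (a + k))"
      using three_neighbour[of x "col (Suc (a + k))"] x(1) ne m3 col_mem[of "Suc (a + k)"] an
      by auto
    then show ?thesis by (auto simp: x_def)
    qed
    then show ?case using Suc by (auto simp: le_Suc_eq)
  qed
  have left: "k < p" "col (p - k) = col (a + k)" if "a + k \<le> n" for k using left that by auto
  \<comment> \<open>If the left side were longer, the counterpart \<open>x\<close> of the end
    \<open>n\<close> would have a further neighbour \<open>e\<close>. By \<open>chain_extend\<close>
    its label to \<open>col n\<close> is 3, so \<open>e\<close> would also have to stand beside
    \<open>n\<close>, where only \<open>col (n - 1)\<close> does.\<close>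
  have p_eq: "p = Suc n - a"
  proof (rule ccontr)
    assume "p \<noteq> Suc n - a"
    define k where "k = n - a"
    define x where "x = p - k"
    have k: "a + k = n" "1 \<le> k" using a_lt by (auto simp: k_def)
    have kp: "k < p" "col (p - k) = col n" using left[of k] k(1) by simp_all
    have "Suc n - a = Suc k" using k(1) by linarith
    then have "p \<noteq> Suc k" using \<open>p \<noteq> Suc n - a\<close> by simp
    then have x: "1 < x" "x < n" "col x = col n" using kp p(2) by (auto simp: x_def)
    have "Suc x = p - (k - 1)" "a + (k - 1) = n - 1" using k kp(1) unfolding x_def by linarith+
    then have sx: "col (Suc x) = col (n - 1)" using left(2)[of "k - 1"] k by simp
    have "M' (col (n - 1)) (col n) = 3" using three[of "n - 1"] a_lt by simp
    then have n3: "M' (col x) (col (Suc x)) = 3"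
      unfolding x(3) sx using sym[of "col n" "col (n - 1)"] col_mem[of n] col_mem[of "n - 1"] a_lt a by simp
    define e where "e = col (x - 1)"
    have e: "e \<noteq> col n" "e \<noteq> col (n - 1)" "e \<in> I'"
      using three_isolated[of x] n3 x sx col_mem[of "x - 1"] by (auto simp: e_def)
    have "3 \<le> M' e (col n)"
      using adjacent[of "x - 1"] x e(1) by (simp add: e_def)
    then have "3 \<le> M' (col n) e" using sym[of e "col n"] e(3) col_mem[of n] a by simp
    then have "M' (col n) e = 3"
      using chain_extend(3)[of a n B e] a_lt a inj Bn AB e by auto
    then show False using three_neighbour[of n e] e a by auto
  qed
  then have ap: "a = Suc n - p" "q = n - p" "p < n - p" using a a_def q by auto
  have mirror: "col (Suc n - x) = col x" if "1 \<le> x" "x \<le> p" for x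
  proof -
    have "a + (p - x) = Suc n - x" "p - (p - x) = x" "a + (p - x) \<le> n" using that ap p by auto
    then show ?thesis using left(2)[of "p - x"] by simp
  qed
  have mid: "col x = B" if "p < x" "x \<le> n - p" for x using q(3) that ap by auto
  have inj': "inj_on col {1..p}"
  proof (rule inj_onI)
    fix x y assume "x \<in> {1..p}" "y \<in> {1..p}" "col x = col y"
    then have "col (Suc n - x) = col (Suc n - y)" "Suc n - x \<in> {a..n}" "Suc n - y \<in> {a..n}"
      using mirror ap by auto
    then have "Suc n - x = Suc n - y" using inj by (auto dest: inj_onD)
    then show "x = y" using \<open>x \<in> {1..p}\<close> \<open>y \<in> {1..p}\<close> ap by auto
  qed
  have Bp: "B \<notin> col ` {1..p}"
  proof
    assume "B \<in> col ` {1..p}"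
    then obtain x where "B = col x" "1 \<le> x" "x \<le> p" by auto
    then have "B = col (Suc n - x)" "Suc n - x \<in> {a..n}" using mirror ap by auto
    then show False using Bn by blast
  qed
  have colSp: "col (Suc p) = B" by (rule p)
  have inj_m: "inj_on col {1..Suc p}"
    using inj' Bp colSp by (simp add: atLeastAtMostSuc_conv)
  \<comment> \<open>Every node has the colour of a representative in \<open>1..Suc p\<close>,
    obtained by reflecting or by collapsing the middle run.\<close>
  have fold_ex: "\<exists>y. 1 \<le> y \<and> y \<le> Suc p \<and> col y = col x \<and> (y = x \<or> y = Suc n - x \<or> y = Suc p \<and> p < x \<and> x \<le> n - p)"
    if "1 \<le> x" "x \<le> n" for x
  proof -
    consider "x \<le> p" | "p < x" "x \<le> n - p" | "n - p < x" by linarith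
    then show ?thesis
    proof cases
      case 3
      then have "col (Suc n - (Suc n - x)) = col (Suc n - x)" using that by (intro mirror) auto
      then show ?thesis using that 3 by (intro exI[of _ "Suc n - x"]) auto
    qed (use that mid colSp in auto)
  qed
  have img: "col ` {1..Suc p} = I'"
  proof
    show "col ` {1..Suc p} \<subseteq> I'" using col_mem p by auto
    show "I' \<subseteq> col ` {1..Suc p}"
    proof
      fix i assume "i \<in> I'"
      then obtain x where "i = col x" "1 \<le> x" "x \<le> n" using surj by auto
      then show "i \<in> col ` {1..Suc p}" using fold_ex[of x] by (metis atLeastAtMost_iff imageI)
    qed
  qed
  then have bij: "bij_betw col {1..Suc p} I'" using inj_m by (simp add: bij_betw_def)
  then have m: "card I' = Suc p" using bij_betw_same_card by fastforce
  have mat: "M' (col x) (col y) = matrix_B (Suc p) x y" if xy: "1 \<le> x" "x < y" "y \<le> Suc p" for x y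
  proof -
    have ne: "col x \<noteq> col y" using inj_onD[OF inj_m, of x y] xy by auto
    have mem: "col x \<in> I'" "col y \<in> I'" using col_mem xy p by auto
    consider "y = Suc p" "x = p" | "y = Suc x" "y \<le> p" | "Suc x < y" using xy by linarith
    then show ?thesis
    proof cases
      case 1
      then have "{x, y} = {Suc p - 1, Suc p}" by auto
      then show ?thesis using 1 br(1) p by (simp add: matrix_B_def)
    next
      case 2
      have "M' (col (Suc n - y)) (col (Suc (Suc n - y))) = 3"
        using three[of "Suc n - y"] 2 ap xy by simp
      moreover have "Suc (Suc n - y) = Suc n - x" using 2 ap by simp
      ultimately have "M' (col y) (col x) = 3" using mirror[of x] mirror[of y] 2 xy by simp
      moreover have "{x, y} \<noteq> {Suc p - 1, Suc p}" using 2 xy by (auto simp: doubleton_eq_iff)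
      ultimately show ?thesis using sym[OF mem] 2 by (simp add: matrix_B_def)
    next
      case 3
      \<comment> \<open>An edge would be visible at neighbouring nodes \<open>z\<close>,
        \<open>Suc z\<close>; their representatives differ by at most 1, but \<open>x\<close> and
        \<open>y\<close> are further apart.\<close>
      have "\<not> 3 \<le> M' (col x) (col y)"
      proof
        assume "3 \<le> M' (col x) (col y)"
        then obtain z where z: "1 \<le> z" "z < n" "{col z, col (Suc z)} = {col x, col y}"
          using edge_adjacent[OF mem ne] by auto
        obtain u where u: "1 \<le> u" "u \<le> Suc p" "col u = col z"
            "u = z \<or> u = Suc n - z \<or> u = Suc p \<and> p < z \<and> z \<le> n - p"
          using fold_ex[of z] z by auto
        obtain v where v: "1 \<le> v" "v \<le> Suc p" "col v = col (Suc z)"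
            "v = Suc z \<or> v = Suc n - Suc z \<or> v = Suc p \<and> p < Suc z \<and> Suc z \<le> n - p"
          using fold_ex[of "Suc z"] z by auto
        have "{u, v} = {x, y}"
          using inj_on_image_eq_iff[OF inj_m, of "{u, v}" "{x, y}"] u v z xy by auto
        then have "u = x \<and> v = y \<or> u = y \<and> v = x" by (auto simp: doubleton_eq_iff)
        moreover have "u \<le> Suc v \<and> v \<le> Suc u"
          using u(1,2,4) v(1,2,4) z(1,2) ap(3) by (elim disjE conjE) linarith+
        ultimately show False using 3 by linarith
      qed
      then have "M' (col x) (col y) = 2" using enat_eq_2 ge_2[OF mem ne] by blast
      moreover have "{x, y} \<noteq> {Suc p - 1, Suc p}" using 3 xy by (auto simp: doubleton_eq_iff)
      ultimately show ?thesis using 3 by (simp add: matrix_B_def)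
    qed
  qed
  have mat': "M' (col x) (col y) = matrix_B (Suc p) x y"
    if xy: "1 \<le> x" "x \<le> Suc p" "1 \<le> y" "y \<le> Suc p" for x y
  proof -
    have mem: "col x \<in> I'" "col y \<in> I'" using col_mem xy p by auto
    have sB: "matrix_B (Suc p) x y = matrix_B (Suc p) y x"
      by (simp add: matrix_B_def insert_commute)
    consider "x < y" | "y < x" | "x = y" by linarith
    then show ?thesis
    proof cases
      case 1
      then show ?thesis using mat xy by blast
    next
      case 2
      then show ?thesis using mat[of y x] xy sym[OF mem] sB by simp
    next
      case 3
      then show ?thesis using mem cox by (simp add: matrix_B_def coxeter_matrix_def)
    qed
  qed
  have "col (Suc n - x) = col x" if "1 \<le> x" "x \<le> n" for x
  proof -
    consider "x \<le> p" | "p < x" "x \<le> n - p" | "n - p < x" by linarith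
    then show ?thesis
    proof cases
      case 1
      then show ?thesis using mirror that by simp
    next
      case 2
      then show ?thesis using mid[of x] mid[of "Suc n - x"] by simp
    next
      case 3
      then show ?thesis using mirror[of "Suc n - x"] that by simp
    qed
  qed
  note symm = this
  have const: "col x = col (Suc p)" if "x \<in> {Suc p..Suc n - Suc p}" for x
    using mid[of x] that colSp by simp
  have "2 * Suc p \<le> Suc n" using ap(3) by arith
  moreover have "\<forall>x\<in>{1..n}. col (Suc n - x) = col x" using symm by simp
  moreover have "\<forall>x\<in>{Suc p..Suc n - Suc p}. col x = col (Suc p)" using const by blast
  moreover have "\<forall>x\<in>{1..Suc p}. \<forall>y\<in>{1..Suc p}. M' (col x) (col y) = matrix_B (Suc p) x y"
    using mat' by simp
  ultimately show ?thesis unfolding folded_def Let_def m using bij by blast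
qed

text \<open>The conditions do not distinguish the two directions of the path. This covers the case
  that the strong pair is met in the order \<open>B\<close>, \<open>A\<close>.\<close>

lemma mirror: "colouring I' M' n (\<lambda>p. col (Suc n - p))"
proof
  show "(\<lambda>p. col (Suc n - p)) ` {1..n} = I'"
  proof -
    have "(\<lambda>p. Suc n - p) ` {1..n} = {1..n}"
    proof
      show "{1..n} \<subseteq> (\<lambda>p. Suc n - p) ` {1..n}"
      proof
        fix x assume "x \<in> {1..n}"
        then show "x \<in> (\<lambda>p. Suc n - p) ` {1..n}" by (intro image_eqI[of _ _ "Suc n - x"]) auto
      qed
    qed auto
    then show ?thesis using surj by (metis image_image)
  qed
  show "branch_rule n M' (\<lambda>p. col (Suc n - (Suc n - p)))"
    using branch branch_rule_cong[of n "\<lambda>p. col (Suc n - (Suc n - p))" col M'] by auto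
next
  fix p assume p: "1 \<le> p" "p < n" "col (Suc n - p) \<noteq> col (Suc n - Suc p)"
  have e: "Suc n - p = Suc (n - p)" "Suc n - Suc p = n - p" using p by auto
  have "col (n - p) \<in> I'" "col (Suc (n - p)) \<in> I'" using col_mem p by auto
  then show "3 \<le> M' (col (Suc n - p)) (col (Suc n - Suc p))"
    using adjacent[of "n - p"] p sym unfolding e by simp
next
  fix i j assume "i \<in> I'" "j \<in> I'" "i \<noteq> j" "3 \<le> M' i j"
  then obtain p where p: "1 \<le> p" "p < n" "{col p, col (Suc p)} = {i, j}"
    using edge_adjacent by blast
  then have "Suc n - (n - p) = Suc p" "Suc n - Suc (n - p) = p" by auto
  then show "\<exists>p. 1 \<le> p \<and> p < n \<and> {col (Suc n - p), col (Suc n - Suc p)} = {i, j}"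
    using p by (intro exI[of _ "n - p"]) (auto simp: insert_commute)
next
  fix p assume p: "1 \<le> p" "p < n" "M' (col (Suc n - p)) (col (Suc n - Suc p)) = 3"
  define r where "r = n - p"
  have r: "Suc n - p = Suc r" "Suc n - Suc p = r" "Suc n - Suc (Suc p) = r - 1"
    "1 < p \<Longrightarrow> Suc n - (p - 1) = Suc (Suc r)" "1 \<le> r" "r < n" "Suc p < n \<longleftrightarrow> 1 < r" "1 < p \<longleftrightarrow> Suc r < n"
    using p by (auto simp: r_def)
  have "M' (col r) (col (Suc r)) = 3" using p(3) r sym[of "col r" "col (Suc r)"] col_mem by simp
  then show "(1 < p \<longrightarrow> col (Suc n - (p - 1)) \<notin> {col (Suc n - p), col (Suc n - Suc p)}) \<and>
      (Suc p < n \<longrightarrow> col (Suc n - Suc (Suc p)) \<notin> {col (Suc n - p), col (Suc n - Suc p)})"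
    using three_isolated[of r] r by auto
next
  fix p j assume p: "p \<in> {1..n}" and j: "j \<in> I'" "j \<noteq> col (Suc n - p)" "M' (col (Suc n - p)) j = 3"
  have "Suc n - p \<in> {1..n}" using p by auto
  then have "1 < Suc n - p \<and> col (Suc n - p - 1) = j \<or> Suc n - p < n \<and> col (Suc (Suc n - p)) = j"
    using three_neighbour[of "Suc n - p" j] j by auto
  moreover have "Suc n - p - 1 = Suc n - Suc p" "1 < p \<Longrightarrow> Suc (Suc n - p) = Suc n - (p - 1)"
    "1 < Suc n - p \<longleftrightarrow> p < n" "Suc n - p < n \<longleftrightarrow> 1 < p" using p by auto
  ultimately show "1 < p \<and> col (Suc n - (p - 1)) = j \<or> p < n \<and> col (Suc n - Suc p) = j" by auto
qed (rule cox irr fin card_gt_2 branch_mirror)+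

text \<open>Of the two ends of a strong label, \<open>x\<close> is one with a third neighbour
  \<open>c\<close>; that edge has label 3, since two strong labels at one node contain affine
  \<open>C\<close>.\<close>

theorem bijective_or_folded: "bijective \<or> folded"
proof (cases "\<exists>i\<in>I'. \<exists>j\<in>I'. i \<noteq> j \<and> 4 \<le> M' i j")
  case False
  then show ?thesis using no_strong_imp_bijective by blast
next
  case True
  then obtain i j where ij: "i \<in> I'" "j \<in> I'" "i \<noteq> j" "4 \<le> M' i j" by auto
  obtain x c where xc: "x \<in> {i, j}" "c \<in> I' - {i, j}" "3 \<le> M' x c"
    using outside_neighbour[of "{i, j}"] ij card_gt_2 by auto
  define y where "y = (if x = i then j else i)"
  have xy: "x \<in> I'" "y \<in> I'" "x \<noteq> y" "4 \<le> M' x y" "c \<in> I'" "c \<noteq> x" "c \<noteq> y"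
    using ij xc sym[of i j] by (auto simp: y_def)
  have c3: "M' x c = 3"
  proof (rule ccontr)
    assume "M' x c \<noteq> 3"
    then have "4 \<le> M' x c" using label_3_or_strong[of x c] xy xc by auto
    then show False
      using finite_type_no_two_strong[OF cox fin, of "{x}" y c] xy by auto
  qed
  have "3 \<le> M' x y" using xy(4) by (rule order_trans[rotated]) (simp add: numeral_eq_enat)
  then obtain p where p: "1 \<le> p" "p < n" "{col p, col (Suc p)} = {x, y}"
    using edge_adjacent xy by blast
  then consider "col p = x" "col (Suc p) = y" | "col p = y" "col (Suc p) = x"
    by (auto simp: doubleton_eq_iff)
  then show ?thesis
  proof cases
    case 1
    then show ?thesis using strong_imp_folded[of x y c p] xy c3 p by blast
  next
    case 2
    interpret m: colouring I' M' n "\<lambda>p. col (Suc n - p)" by (rule mirror)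
    have "Suc n - (n - p) = Suc p" "Suc n - Suc (n - p) = p" using p by auto
    \<comment> \<open>A palindrome read backwards is itself, so the conclusion for the reversed
      colouring carries over to the original one.\<close>
    then have f: "m.folded"
      using m.strong_imp_folded[of x y c "n - p"] 2 xy c3 p by auto
    define k where "k = card I'"
    have f: "2 * k \<le> Suc n" "\<forall>p\<in>{1..n}. col (Suc n - (Suc n - p)) = col (Suc n - p)"
      "\<forall>p\<in>{k..Suc n - k}. col (Suc n - p) = col (Suc n - k)"
      "bij_betw (\<lambda>p. col (Suc n - p)) {1..k} I'"
      "\<forall>p\<in>{1..k}. \<forall>q\<in>{1..k}. M' (col (Suc n - p)) (col (Suc n - q)) = matrix_B k p q"
      using f unfolding m.folded_def Let_def k_def[symmetric] by blast+
    have "1 \<le> k" using card_gt_2 by (simp add: k_def)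
    have s: "col (Suc n - p) = col p" if p: "p \<in> {1..n}" for p
    proof -
      have "Suc n - (Suc n - p) = p" using p by auto
      then show ?thesis using f(2) p by auto
    qed
    have eq: "col (Suc n - p) = col p" if "p \<in> {1..k}" for p
      by (rule s) (use that f(1) \<open>1 \<le> k\<close> in auto)
    have mid: "col (Suc n - p) = col p" if "p \<in> {k..Suc n - k}" for p
      by (rule s) (use that f(1) \<open>1 \<le> k\<close> in auto)
    have "bij_betw (\<lambda>p. col (Suc n - p)) {1..k} I' \<longleftrightarrow> bij_betw col {1..k} I'"
      by (intro bij_betw_cong eq)
    moreover have "\<forall>p\<in>{k..Suc n - k}. col p = col k"
      using f(3) mid eq[of k] \<open>1 \<le> k\<close> by (metis atLeastAtMost_iff order_refl)
    moreover have "\<forall>p\<in>{1..k}. \<forall>q\<in>{1..k}. M' (col p) (col q) = matrix_B k p q"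
      using f(5) eq by metis
    ultimately have folded using f(1,4) s
      unfolding folded_def Let_def k_def[symmetric] by blast
    then show ?thesis by simp
  qed
qed

end


section \<open>Crossings in reversal diagrams\<close>

primrec perm :: "nat list \<Rightarrow> nat \<Rightarrow> nat" where
  "perm [] = id"
| "perm (i # u) = adj i \<circ> perm u"

lemma perm_append: "perm (u @ v) = perm u \<circ> perm v"
  by (induction u) (simp_all add: comp_assoc)

lemma foldl_adj: "foldl (\<lambda>w i. w \<circ> adj i) w u = w \<circ> perm u"
  by (induction u arbitrary: w) (simp_all add: comp_assoc)

text \<open>Together with \<open>perm\<close>, the type A model on words of numbers; targets of type
  A and unfolded targets of type B are both compared in it.\<close>

primrec rising :: "(nat \<Rightarrow> nat) \<Rightarrow> nat list \<Rightarrow> bool" where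
  "rising w [] = True"
| "rising w (i # u) \<longleftrightarrow> w i < w (Suc i) \<and> rising (w \<circ> adj i) u"

lemma rising_append:
  "rising w (u @ v) \<longleftrightarrow> rising w u \<and> rising (w \<circ> perm u) v"
  by (induction u arbitrary: w) (auto simp: comp_assoc)

text \<open>The number of crossings of the strands that end at the positions \<open>p\<close> and \<open>q\<close>.\<close>

primrec crossings :: "nat list \<Rightarrow> nat \<Rightarrow> nat \<Rightarrow> nat" where
  "crossings [] p q = 0"
| "crossings (i # u) p q = crossings u p q +
    (if perm u p = i \<and> perm u q = Suc i \<or> perm u p = Suc i \<and> perm u q = i then 1 else 0)"

lemma crossings_append:
  "crossings (u @ v) p q = crossings v p q + crossings u (perm v p) (perm v q)"
  by (induction u) (auto simp: perm_append)

lemma crossings_commute: "crossings u p q = crossings u q p"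
  by (induction u) auto

abbreviation acong_A :: "nat \<Rightarrow> (nat list \<times> nat list) set" where
  "acong_A n \<equiv> word_cong {1..n} (artin_relations {1..n} matrix_A)"

text \<open>The third Reidemeister move: on either side each two of the three strands cross once.
  Far generators involve different pairs of strands.\<close>

lemma braid_crossings:
  "crossings [i, Suc i, i] p q = crossings [Suc i, i, Suc i] p q"
  "j \<noteq> Suc i \<Longrightarrow> i \<noteq> Suc j \<Longrightarrow> i \<noteq> j \<Longrightarrow> crossings [i, j] p q = crossings [j, i] p q"
proof -
  have t: "adj i i = Suc i" "adj i (Suc i) = i" "adj i (Suc (Suc i)) = Suc (Suc i)"
    "adj (Suc i) i = i" by simp_all
  have other: "adj i x = x" "adj (Suc i) x = x" if "x \<noteq> i" "x \<noteq> Suc i" "x \<noteq> Suc (Suc i)" for x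
    using that by simp_all
  consider "p = i" | "p = Suc i" | "p = Suc (Suc i)" | "p \<noteq> i" "p \<noteq> Suc i" "p \<noteq> Suc (Suc i)" by blast
  then show "crossings [i, Suc i, i] p q = crossings [Suc i, i, Suc i] p q"
  proof cases
    case 1
    consider "q = i" | "q = Suc i" | "q = Suc (Suc i)" | "q \<noteq> i" "q \<noteq> Suc i" "q \<noteq> Suc (Suc i)" by blast
    then show ?thesis using 1 by cases (simp_all add: t other)
  next
    case 2
    consider "q = i" | "q = Suc i" | "q = Suc (Suc i)" | "q \<noteq> i" "q \<noteq> Suc i" "q \<noteq> Suc (Suc i)" by blast
    then show ?thesis using 2 by cases (simp_all add: t other)
  next
    case 3
    consider "q = i" | "q = Suc i" | "q = Suc (Suc i)" | "q \<noteq> i" "q \<noteq> Suc i" "q \<noteq> Suc (Suc i)" by blast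
    then show ?thesis using 3 by cases (simp_all add: t other)
  next
    case 4
    then show ?thesis by (simp add: other)
  qed
next
  assume ij: "j \<noteq> Suc i" "i \<noteq> Suc j" "i \<noteq> j"
  have inv: "adj j x = i \<longleftrightarrow> x = i" "adj j x = Suc i \<longleftrightarrow> x = Suc i"
    "adj i x = j \<longleftrightarrow> x = j" "adj i x = Suc j \<longleftrightarrow> x = Suc j" for x
    using ij by (auto simp: transpose_eq_iff)
  show "crossings [i, j] p q = crossings [j, i] p q" by (simp add: inv)
qed

text \<open>Both are invariants of positive braids. Crossing numbers add up along a product, with
  the pair of strands moved by the right factor.\<close>

lemma acong_A_invariants:
  assumes "(u, v) \<in> acong_A n"
  shows "perm u = perm v \<and> (\<forall>p q. crossings u p q = crossings v p q)"
  using assms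
proof induction
  case (base u v)
  then obtain m i j where m: "u = alternating_word m i j" "v = alternating_word m j i"
      "i \<noteq> j" "matrix_A i j = enat m"
    by (auto simp: artin_relations_def)
  consider "j = Suc i" "m = 3" | "i = Suc j" "m = 3" | "j \<noteq> Suc i" "i \<noteq> Suc j" "m = 2"
    using m(3,4) by (auto simp: matrix_A_def numeral_eq_enat split: if_splits)
  then show ?case
  proof cases
    case 1
    have "adj i \<circ> adj (Suc i) \<circ> adj i = adj (Suc i) \<circ> adj i \<circ> adj (Suc i)"
      by (auto simp: fun_eq_iff transpose_def)
    then have "perm u = perm v" unfolding m 1 alternating_word_numeral by (simp add: comp_assoc)
    then show ?thesis unfolding m 1 alternating_word_numeral using braid_crossings(1)[of i] by blast
  next
    case 2
    have "adj j \<circ> adj (Suc j) \<circ> adj j = adj (Suc j) \<circ> adj j \<circ> adj (Suc j)"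
      by (auto simp: fun_eq_iff transpose_def)
    then have "perm u = perm v" unfolding m 2 alternating_word_numeral by (simp add: comp_assoc)
    then show ?thesis unfolding m 2 alternating_word_numeral using braid_crossings(1)[of j] by metis
  next
    case 3
    have "adj i \<circ> adj j = adj j \<circ> adj i" using 3 m(3) by (auto simp: fun_eq_iff transpose_def)
    then have "perm u = perm v" unfolding m 3 alternating_word_numeral by simp
    then show ?thesis unfolding m 3 alternating_word_numeral
      using braid_crossings(2)[OF 3(1,2) m(3)] by blast
  qed
next
  case (mult u v u' v')
  then show ?case by (simp add: perm_append crossings_append)
qed auto

lemma inj_perm: "inj (perm u)"
proof (induction u)
  case (Cons i u)
  then show ?case unfolding perm.simps by (intro inj_compose inj_transpose)
qed (simp add: inj_on_id)

text \<open>In a reduced word two strands cross at most once: a letter appended on the right crosses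
  two neighbouring strands that are not yet inverted.\<close>

lemma crossings_rising:
  assumes "rising id u" "p < q"
  shows "crossings u p q = (if perm u q < perm u p then 1 else 0)"
  using assms
proof (induction u arbitrary: p q rule: rev_induct)
  case (snoc i u)
  have r: "rising id u" "perm u i < perm u (Suc i)" using snoc.prems(1) unfolding rising_append by simp_all
  have eq: "crossings (u @ [i]) p q = crossings [i] p q + crossings u (adj i p) (adj i q)"
    "perm (u @ [i]) = perm u \<circ> adj i"
    using crossings_append[of u "[i]"] perm_append[of u "[i]"] by simp_all
  show ?case
  proof (cases "p = i \<and> q = Suc i")
    case True
    then have "crossings u (adj i p) (adj i q) = 0"
      using snoc.IH[OF r(1), of i "Suc i"] r(2) crossings_commute[of u "Suc i" i] by simp
    then show ?thesis unfolding eq using True r by simp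
  next
    case False
    then have "adj i p < adj i q" using snoc.prems(2) by (auto simp: transpose_def)
    moreover have "crossings [i] p q = 0" using False snoc.prems(2) by auto
    ultimately show ?thesis unfolding eq using snoc.IH[OF r(1), of "adj i p" "adj i q"] by simp
  qed
qed simp

text \<open>Only the letter \<open>c\<close> exchanges the positions \<open>c\<close> and
  \<open>Suc c\<close>, so without it nothing passes between \<open>{..c}\<close> and the
  rest.\<close>

lemma perm_cut:
  assumes "u \<in> lists J" "c \<notin> J"
  shows "perm u x \<le> c \<longleftrightarrow> x \<le> c"
  using assms(1)
proof (induction u)
  case (Cons i u)
  then have "i \<noteq> c" using assms by auto
  then have "adj i y \<le> c \<longleftrightarrow> y \<le> c" for y by (auto simp: transpose_def)
  then show ?case using Cons by simp
qed simp

text \<open>A maximal interval of nodes from \<open>a\<close> to \<open>c - 1\<close>, hence of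
  strands from \<open>a\<close> to \<open>c\<close>; the half-open form makes \<open>c\<close> the
  last strand.\<close>

definition run :: "nat set \<Rightarrow> nat \<Rightarrow> nat \<Rightarrow> bool" where
  "run J a c \<longleftrightarrow> 1 \<le> a \<and> a < c \<and> {a..<c} \<subseteq> J \<and> a - 1 \<notin> J \<and> c \<notin> J"

lemma run_mem: "run J a c \<Longrightarrow> a \<le> x \<Longrightarrow> x < c \<Longrightarrow> x \<in> J"
  by (auto simp: run_def)

lemma ex_run:
  assumes "finite J" "0 \<notin> J" "x \<in> J"
  obtains a c where "run J a c" "a \<le> x" "x < c"
proof -
  define a where "a = (LEAST a. {a..x} \<subseteq> J)"
  define c where "c = (LEAST c. x < c \<and> c \<notin> J)"
  have "\<exists>c. x < c \<and> c \<notin> J"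
  proof (intro exI conjI)
    show "x < Suc (Max J)" using assms by (simp add: less_Suc_eq_le)
    show "Suc (Max J) \<notin> J" using Max_ge[OF assms(1), of "Suc (Max J)"] by auto
  qed
  then have c: "x < c" "c \<notin> J" unfolding c_def by (metis (mono_tags, lifting) LeastI_ex)+
  have c_min: "y \<in> J" if "x < y" "y < c" for y
    using not_less_Least[of y "\<lambda>c. x < c \<and> c \<notin> J"] that unfolding c_def by auto
  have "{x..x} \<subseteq> J" using assms by simp
  then have a: "{a..x} \<subseteq> J" "a \<le> x" unfolding a_def by (rule LeastI, rule Least_le)
  have "1 \<le> a" using a assms(2) by (cases a) auto
  moreover have "a - 1 \<notin> J"
  proof
    assume "a - 1 \<in> J"
    then have "{a - 1..x} \<subseteq> J" using a by (auto simp: subset_iff) (metis Suc_pred le_antisym not_less_eq_eq not_gr_zero diff_0_eq_0 One_nat_def)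
    then show False using Least_le[of "\<lambda>a. {a..x} \<subseteq> J" "a - 1"] \<open>1 \<le> a\<close> unfolding a_def by simp
  qed
  moreover have "{a..<c} \<subseteq> J"
  proof
    fix y assume "y \<in> {a..<c}"
    then show "y \<in> J" using a(1) c_min by (cases "y \<le> x") auto
  qed
  ultimately have "run J a c" using a c by (simp add: run_def)
  then show thesis using that a c by blast
qed

text \<open>The permutation preserves \<open>{a..c}\<close> by \<open>perm_cut\<close> and decreases
  strictly on it, which squeezes it between two equal bounds.\<close>

lemma perm_run:
  assumes u: "u \<in> lists J" and desc: "\<And>j. j \<in> J \<Longrightarrow> perm u (Suc j) < perm u j"
    and run: "run J a c" and x: "a \<le> x" "x \<le> c"
  shows "perm u x = a + c - x"
proof -
  have ac: "1 \<le> a" "a < c" "{a..<c} \<subseteq> J" "a - 1 \<notin> J" "c \<notin> J" using run by (auto simp: run_def)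
  have dec: "perm u (Suc y) < perm u y" if "a \<le> y" "y < c" for y using desc that ac(3) by auto
  have up: "perm u (a + k) \<le> c - k" if "a + k \<le> c" for k
    using that
  proof (induction k)
    case 0
    then show ?case using perm_cut[OF u ac(5), of a] ac by simp
  next
    case (Suc k)
    then show ?case using dec[of "a + k"] by simp
  qed
  have lo: "a + k \<le> perm u (c - k)" if "a + k \<le> c" for k
    using that
  proof (induction k)
    case 0
    then show ?case using perm_cut[OF u ac(4), of c] ac(1,2) by simp linarith
  next
    case (Suc k)
    have "c - k = Suc (c - Suc k)" "a \<le> c - Suc k" "c - Suc k < c" using Suc.prems by auto
    then show ?case using dec[of "c - Suc k"] Suc by simp
  qed
  have "perm u x \<le> c - (x - a)" using up[of "x - a"] x by simp
  moreover have "a + (c - x) \<le> perm u x" using lo[of "c - x"] x by simp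
  ultimately show ?thesis using x by simp
qed

section \<open>Relations between reversals\<close>

primrec alternating_concat :: "nat \<Rightarrow> 'b list \<Rightarrow> 'b list \<Rightarrow> 'b list" where
  "alternating_concat 0 u v = []"
| "alternating_concat (Suc k) u v = u @ alternating_concat k v u"

lemma alternating_concat_numeral:
  "alternating_concat 2 u v = u @ v" "alternating_concat 3 u v = u @ v @ u"
  "alternating_concat 4 u v = u @ v @ u @ v" "alternating_concat 5 u v = u @ v @ u @ v @ u"
  by (simp_all add: eval_nat_numeral)

text \<open>\<open>U i\<close> is a reduced word of the longest element on the nodes
  \<open>K i\<close> of \<open>A_n\<close>. Targets of type A give such a family directly, those of
  type B after unfolding.\<close>

locale reversal_family =
  fixes I' :: "'a set" and M' :: "'a \<Rightarrow> 'a \<Rightarrow> enat" and n :: nat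
    and K :: "'a \<Rightarrow> nat set" and U :: "'a \<Rightarrow> nat list"
  assumes cox: "coxeter_matrix I' M'" and irr: "irreducible_coxeter I' M'"
    and fin: "finite_type I' M'" and card_gt_2: "2 < card I'"
    and K_nonempty: "i \<in> I' \<Longrightarrow> K i \<noteq> {}" and K_disjoint: "disjoint_family_on K I'"
    and K_cover: "(\<Union>i\<in>I'. K i) = {1..n}"
    and U_lists: "i \<in> I' \<Longrightarrow> U i \<in> lists (K i)" and U_rising: "i \<in> I' \<Longrightarrow> rising id (U i)"
    and U_descent: "i \<in> I' \<Longrightarrow> x \<in> K i \<Longrightarrow> perm (U i) (Suc x) < perm (U i) x"
    and relation: "i \<in> I' \<Longrightarrow> j \<in> I' \<Longrightarrow> i \<noteq> j \<Longrightarrow> M' i j = enat m \<Longrightarrow>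
      (alternating_concat m (U i) (U j), alternating_concat m (U j) (U i)) \<in> acong_A n"
    and edge: "i \<in> I' \<Longrightarrow> j \<in> I' \<Longrightarrow> i \<noteq> j \<Longrightarrow> 3 \<le> M' i j \<Longrightarrow>
      \<exists>x\<in>K i. \<exists>y\<in>K j. y = Suc x \<or> x = Suc y"
begin

definition col :: "nat \<Rightarrow> 'a" where "col x = (THE i. i \<in> I' \<and> x \<in> K i)"

lemma K_sub: "i \<in> I' \<Longrightarrow> K i \<subseteq> {1..n}"
  using K_cover by auto

lemma zero_notin_K: "i \<in> I' \<Longrightarrow> 0 \<notin> K i"
  using K_sub by fastforce

lemma K_unique: "i \<in> I' \<Longrightarrow> j \<in> I' \<Longrightarrow> x \<in> K i \<Longrightarrow> x \<in> K j \<Longrightarrow> i = j"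
  using K_disjoint by (auto simp: disjoint_family_on_def)

lemma col_eq: "i \<in> I' \<Longrightarrow> x \<in> K i \<Longrightarrow> col x = i"
  unfolding col_def using K_unique by blast

lemma col_in:
  assumes "1 \<le> x" "x \<le> n"
  shows "col x \<in> I' \<and> x \<in> K (col x)"
proof -
  have "x \<in> (\<Union>i\<in>I'. K i)" unfolding K_cover using assms by simp
  then obtain i where "i \<in> I'" "x \<in> K i" by blast
  then show ?thesis using col_eq[of i x] by simp
qed

lemma in_K_iff:
  assumes "i \<in> I'"
  shows "x \<in> K i \<longleftrightarrow> 1 \<le> x \<and> x \<le> n \<and> col x = i"
proof
  assume x: "x \<in> K i"
  then have "x \<in> {1..n}" using K_sub[OF assms] by blast
  then show "1 \<le> x \<and> x \<le> n \<and> col x = i" using col_eq[OF assms x] by simp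
next
  assume "1 \<le> x \<and> x \<le> n \<and> col x = i"
  then show "x \<in> K i" using col_in[of x] by blast
qed

abbreviation W :: "'a \<Rightarrow> nat \<Rightarrow> nat" where "W i \<equiv> perm (U i)"

lemma W_cut: "i \<in> I' \<Longrightarrow> c \<notin> K i \<Longrightarrow> W i x \<le> c \<longleftrightarrow> x \<le> c"
  using perm_cut U_lists by blast

lemma W_run: "i \<in> I' \<Longrightarrow> run (K i) a c \<Longrightarrow> a \<le> x \<Longrightarrow> x \<le> c \<Longrightarrow> W i x = a + c - x"
  using perm_run U_lists U_descent by blast

lemma W_fix: "i \<in> I' \<Longrightarrow> x - 1 \<notin> K i \<Longrightarrow> x \<notin> K i \<Longrightarrow> W i x = x"
  using W_cut[of i "x - 1" x] W_cut[of i x x] W_cut[of i 0 0] zero_notin_K[of i] by (cases x) auto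

lemma W_inj: "W i x = W i y \<Longrightarrow> x = y"
  using inj_perm by (rule injD)

lemma crossings_cut:
  assumes "i \<in> I'" "c \<notin> K i" "x \<le> c" "c < y"
  shows "crossings (U i) x y = 0"
proof -
  have "W i x \<le> c" "\<not> W i y \<le> c" using W_cut[OF assms(1,2)] assms(3,4) by simp_all
  then have "\<not> W i y < W i x" by linarith
  then show ?thesis using crossings_rising[OF U_rising[OF assms(1)], of x y] assms(3,4) by simp
qed

lemma crossings_run:
  assumes "i \<in> I'" "run (K i) a c" "a \<le> x" "x < y" "y \<le> c"
  shows "crossings (U i) x y = 1"
proof -
  have "W i x = a + c - x" "W i y = a + c - y"
    using W_run[OF assms(1,2), of x] W_run[OF assms(1,2), of y] assms by simp_all
  then have "W i y < W i x" using assms by simp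
  then show ?thesis using crossings_rising[OF U_rising[OF assms(1)] assms(4)] by simp
qed

lemma run_ex:
  assumes "i \<in> I'" "x \<in> K i"
  obtains a c where "run (K i) a c" "a \<le> x" "x < c"
  using ex_run[of "K i" x] assms zero_notin_K finite_subset[OF K_sub] by blast

lemma relation_2:
  assumes "i \<in> I'" "j \<in> I'" "i \<noteq> j" "M' i j = 2"
  shows "W i (W j x) = W j (W i x)"
  using acong_A_invariants[OF relation[OF assms(1-3), of 2]] assms(4)
  by (simp add: numeral_eq_enat alternating_concat_numeral perm_append fun_eq_iff)

lemma relation_3:
  assumes "i \<in> I'" "j \<in> I'" "i \<noteq> j" "M' i j = 3"
  shows "W i (W j (W i x)) = W j (W i (W j x))"
    and "crossings (U i) x y + crossings (U j) (W i x) (W i y) + crossings (U i) (W j (W i x)) (W j (W i y))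
      = crossings (U j) x y + crossings (U i) (W j x) (W j y) + crossings (U j) (W i (W j x)) (W i (W j y))"
  using acong_A_invariants[OF relation[OF assms(1-3), of 3]] assms(4)
  by (simp_all add: numeral_eq_enat alternating_concat_numeral perm_append crossings_append fun_eq_iff)

lemma relation_4:
  assumes "i \<in> I'" "j \<in> I'" "i \<noteq> j" "M' i j = 4"
  shows "W i (W j (W i (W j x))) = W j (W i (W j (W i x)))"
  using acong_A_invariants[OF relation[OF assms(1-3), of 4]] assms(4)
  by (simp add: numeral_eq_enat alternating_concat_numeral perm_append fun_eq_iff)

lemma relation_5:
  assumes "i \<in> I'" "j \<in> I'" "i \<noteq> j" "M' i j = 5"
  shows "W i (W j (W i (W j (W i x)))) = W j (W i (W j (W i (W j x))))"
  using acong_A_invariants[OF relation[OF assms(1-3), of 5]] assms(4)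
  by (simp add: numeral_eq_enat alternating_concat_numeral perm_append fun_eq_iff)

lemma boundary:
  assumes p: "1 \<le> p" "p < n" and i: "i = col p" and j: "j = col (Suc p)" and ne: "i \<noteq> j"
  obtains a c where "i \<in> I'" "j \<in> I'" "run (K i) a (Suc p)" "run (K j) (Suc p) c"
    "p \<notin> K j" "Suc p \<notin> K i" "p \<in> K i" "Suc p \<in> K j"
proof -
  have ij: "i \<in> I'" "p \<in> K i" "j \<in> I'" "Suc p \<in> K j"
    using col_in[of p] col_in[of "Suc p"] p i j by auto
  then have nin: "p \<notin> K j" "Suc p \<notin> K i" using K_unique ne by blast+
  obtain a c' where a: "run (K i) a c'" "a \<le> p" "p < c'" using run_ex ij by blast
  have "c' = Suc p"
  proof (rule ccontr)
    assume "c' \<noteq> Suc p"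
    then have "Suc p \<in> {a..<c'}" using a by auto
    then show False using a(1) nin by (auto simp: run_def)
  qed
  obtain a' c where c: "run (K j) a' c" "a' \<le> Suc p" "Suc p < c" using run_ex ij by blast
  have "a' = Suc p"
  proof (rule ccontr)
    assume "a' \<noteq> Suc p"
    then have "p \<in> {a'..<c}" using c by auto
    then show False using c(1) nin by (auto simp: run_def)
  qed
  then show thesis using that a c ij nin \<open>c' = Suc p\<close> by blast
qed

text \<open>Two reversals that share the strand \<open>Suc p\<close> cannot commute: one order
  brings it to the left of the shared position, the other one to the right.\<close>

lemma adjacent_ge_3:
  assumes p: "1 \<le> p" "p < n" "col p \<noteq> col (Suc p)"
  shows "3 \<le> M' (col p) (col (Suc p))"
proof (rule ccontr)
  define i j where "i = col p" and "j = col (Suc p)"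
  assume "\<not> 3 \<le> M' (col p) (col (Suc p))"
  then have n3: "\<not> 3 \<le> M' i j" by (simp add: i_def j_def)
  obtain a c where r: "i \<in> I'" "j \<in> I'" "run (K i) a (Suc p)" "run (K j) (Suc p) c"
    "p \<notin> K j" "Suc p \<notin> K i"
    using boundary[OF p(1,2) i_def j_def] p(3) unfolding i_def j_def by metis
  have ne: "i \<noteq> j" using p(3) by (simp add: i_def j_def)
  have "2 \<le> M' i j" using cox r ne by (auto simp: coxeter_matrix_def)
  then have m: "M' i j = 2" using n3 enat_eq_2 by blast
  have ac: "a \<le> p" "Suc p < c" using r by (auto simp: run_def)
  have "W i (Suc p) = a" "W j (Suc p) = c" using W_run r ac by auto
  then have "W i c = W j a" using relation_2[OF r(1,2) ne m, of "Suc p"] by simp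
  moreover have "\<not> W i c \<le> Suc p" using W_cut[OF r(1,6), of c] ac by simp
  moreover have "W j a \<le> p" using W_cut[OF r(2,5), of a] ac by simp
  ultimately show False by simp
qed

text \<open>The permutations only show that each reversal fixes the far end of the other run. That
  both runs consist of one node follows from crossing numbers.\<close>

lemma isolated:
  assumes p: "1 \<le> p" "p < n" and m: "M' (col p) (col (Suc p)) = 3"
  shows "p - 1 \<notin> K (col p)" "p - 1 \<notin> K (col (Suc p))"
    "Suc (Suc p) \<notin> K (col p)" "Suc (Suc p) \<notin> K (col (Suc p))"
proof -
  define i j where "i = col p" and "j = col (Suc p)"
  have "M' (col p) (col p) = 1" using cox col_in[of p] p by (auto simp: coxeter_matrix_def)
  then have ne: "i \<noteq> j" using m by (auto simp: i_def j_def)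
  have m: "M' i j = 3" using m by (simp add: i_def j_def)
  obtain a c where r: "i \<in> I'" "j \<in> I'" "run (K i) a (Suc p)" "run (K j) (Suc p) c"
    "p \<notin> K j" "Suc p \<notin> K i" "p \<in> K i" "Suc p \<in> K j"
    using boundary[OF p(1,2) i_def j_def ne] .
  have ac: "1 \<le> a" "a \<le> p" "Suc p < c" using r by (auto simp: run_def)
  have W: "W i (Suc p) = a" "W j (Suc p) = c" "W i a = Suc p" "W j c = Suc p"
    using W_run[OF r(1,3)] W_run[OF r(2,4)] ac by auto
  have "W j a \<le> p" using W_cut[OF r(2,5), of a] ac by simp
  then have 1: "W i (W j a) \<le> Suc p" using W_cut[OF r(1,6), of "W j a"] by simp
  have "\<not> W i c \<le> Suc p" using W_cut[OF r(1,6), of c] ac by simp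
  then have 2: "\<not> W j (W i c) \<le> p" using W_cut[OF r(2,5), of "W i c"] by simp
  \<comment> \<open>The shared strand ends at most at \<open>Suc p\<close> on one side of the
    relation and beyond \<open>p\<close> on the other, hence exactly at
    \<open>Suc p\<close>.\<close>
  have "W i (W j a) = W j (W i c)"
    using relation_3(1)[OF r(1,2) ne m, of "Suc p"] W by simp
  then have "W i (W j a) = W i a" "W j (W i c) = W j c" using 1 2 W by auto
  then have fixed: "W j a = a" "W i c = c" using W_inj by blast+
  have ja: "a - 1 \<notin> K j"
  proof
    assume "a - 1 \<in> K j"
    then obtain d e where d: "run (K j) d e" "d \<le> a - 1" "a - 1 < e" using run_ex r by blast
    have "a \<in> K i" using r(3) ac by (auto simp: run_def)
    then have "a \<notin> K j" using K_unique r ne by blast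
    have "e = a"
    proof (rule ccontr)
      assume "e \<noteq> a"
      then have "a \<in> {d..<e}" using d ac by auto
      then show False using d(1) \<open>a \<notin> K j\<close> by (auto simp: run_def)
    qed
    moreover have "1 \<le> a - 1" using \<open>a - 1 \<in> K j\<close> zero_notin_K[OF r(2)] by (cases "a - 1") auto
    ultimately have "d \<le> a" "a \<le> e" "d < a" using d by auto
    then show False using W_run[OF r(2) d(1), of a] \<open>e = a\<close> fixed by simp
  qed
  have ic: "c \<notin> K i"
  proof
    assume "c \<in> K i"
    then obtain d e where d: "run (K i) d e" "d \<le> c" "c < e" using run_ex r by blast
    have "c - 1 \<in> K j" using r(4) ac by (auto simp: run_def)
    then have cK: "c - 1 \<notin> K i" using K_unique r ne by blast
    have "d = c"
    proof (rule ccontr)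
      assume "d \<noteq> c"
      then have "c - 1 \<in> {d..<e}" using d by auto
      then show False using d(1) cK by (auto simp: run_def)
    qed
    then show False using W_run[OF r(1) d(1), of c] d(3) fixed by simp
  qed
  \<comment> \<open>Otherwise the strands \<open>Suc a\<close> and \<open>Suc p\<close> cross at
    least once on the left of the relation and never on its right.\<close>
  have "a = p"
  proof (rule ccontr)
    assume "a \<noteq> p"
    then have ap: "Suc a \<le> p" using ac by simp
    have "a \<in> K i" "Suc a \<in> K i" using r(3) ap by (auto simp: run_def)
    then have "a \<notin> K j" "Suc a \<notin> K j" using K_unique r ne by blast+
    then have Wj: "W j (Suc a) = Suc a" using W_fix[OF r(2), of "Suc a"] by simp
    have Wi: "W i (Suc a) = p" using W_run[OF r(1,3), of "Suc a"] ap by simp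
    have "crossings (U i) (Suc a) (Suc p) = 1" using crossings_run[OF r(1,3)] ap by simp
    moreover have "crossings (U j) (Suc a) (Suc p) = 0" using crossings_cut[OF r(2,5)] ap by simp
    moreover have "crossings (U i) (Suc a) c = 0" using crossings_cut[OF r(1,6)] ap ac by simp
    moreover have "crossings (U j) p c = 0" using crossings_cut[OF r(2,5)] ac by simp
    ultimately show False
      using relation_3(2)[OF r(1,2) ne m, of "Suc a" "Suc p"] by (simp add: W Wj Wi fixed)
  qed
  \<comment> \<open>The same for the strands \<open>Suc p\<close> and \<open>c - 1\<close>, with the
    sides exchanged.\<close>
  moreover have "c = Suc (Suc p)"
  proof (rule ccontr)
    assume "c \<noteq> Suc (Suc p)"
    then have cp: "Suc p < c - 1" "c - 1 < c" using ac by auto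
    have "c - 1 \<in> K j" "c - 1 - 1 \<in> K j" using r(4) cp by (auto simp: run_def)
    then have "c - 1 \<notin> K i" "c - 1 - 1 \<notin> K i" using K_unique r ne by blast+
    then have Wi: "W i (c - 1) = c - 1" using W_fix[OF r(1), of "c - 1"] by simp
    have Wj: "W j (c - 1) = Suc (Suc p)" using W_run[OF r(2,4), of "c - 1"] cp by simp
    have "crossings (U j) (Suc p) (c - 1) = 1" using crossings_run[OF r(2,4)] cp by simp
    moreover have "crossings (U i) (Suc p) (c - 1) = 0" using crossings_cut[OF r(1,6)] cp by simp
    moreover have "crossings (U j) a (c - 1) = 0" using crossings_cut[OF r(2,5)] cp ac by simp
    moreover have "crossings (U i) a (Suc (Suc p)) = 0" using crossings_cut[OF r(1,6)] ac by simp
    ultimately show False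
      using relation_3(2)[OF r(1,2) ne m, of "Suc p" "c - 1"] by (simp only: W Wj Wi fixed)
  qed
  ultimately show "p - 1 \<notin> K (col p)" "p - 1 \<notin> K (col (Suc p))"
    "Suc (Suc p) \<notin> K (col p)" "Suc (Suc p) \<notin> K (col (Suc p))"
    using r(3,4) ja ic by (auto simp: run_def i_def j_def)
qed

text \<open>If \<open>j\<close> occurred on neither side of the run through \<open>x\<close>, its
  reversal would fix both end strands of the run, and the relation would identify them. Once
  \<open>j\<close> is adjacent, \<open>isolated\<close> shrinks the run to \<open>x\<close>
  itself.\<close>

lemma neighbour_3:
  assumes x: "x \<in> {1..n}" and j: "j \<in> I'" "j \<noteq> col x" and m: "M' (col x) j = 3"
  shows "1 < x \<and> col (x - 1) = j \<or> x < n \<and> col (Suc x) = j"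
proof -
  define i where "i = col x"
  have i: "i \<in> I'" "x \<in> K i" "i \<noteq> j" using col_in[of x] x j by (auto simp: i_def)
  have m: "M' i j = 3" "M' j i = 3" using m cox i j by (auto simp: i_def coxeter_matrix_def)
  obtain a c where r: "run (K i) a c" "a \<le> x" "x < c" using run_ex i by blast
  have ac: "1 \<le> a" "a < c" "a \<in> K i" "c - 1 \<in> K i" using r by (auto simp: run_def)
  then have nj: "a \<notin> K j" "c - 1 \<notin> K j" using K_unique i j by blast+
  have Wi: "W i a = c" "W i c = a" using W_run[OF i(1) r(1)] ac by auto
  have "a - 1 \<in> K j \<or> c \<in> K j"
  proof (rule ccontr)
    assume "\<not> (a - 1 \<in> K j \<or> c \<in> K j)"
    then have "W j a = a" "W j c = c" using W_fix[OF j(1)] nj by blast+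
    then show False using relation_3(1)[OF i(1) j(1) i(3) m(1), of a] Wi ac by simp
  qed
  then show ?thesis
  proof
    assume aj: "a - 1 \<in> K j"
    then have cj: "col (a - 1) = j" "1 \<le> a - 1" using in_K_iff j by auto
    have ci: "col (Suc (a - 1)) = i" "Suc (a - 1) = a" "a \<le> n" using in_K_iff[OF i(1), of a] ac by auto
    have "Suc a \<notin> K i" using isolated(4)[of "a - 1"] cj ci m by auto
    then have "\<not> Suc a < c" using run_mem[OF r(1), of "Suc a"] by auto
    then have "x = a" using r by simp
    then show ?thesis using cj by auto
  next
    assume "c \<in> K j"
    then have cj: "col c = j" "c \<le> n" using in_K_iff j by auto
    have ci: "col (c - 1) = i" "Suc (c - 1) = c" "1 \<le> c - 1" using in_K_iff[OF i(1), of "c - 1"] ac by auto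
    have "c - 1 - 1 \<notin> K i" using isolated(1)[of "c - 1"] cj ci m by auto
    then have "\<not> a \<le> c - 1 - 1" using run_mem[OF r(1), of "c - 1 - 1"] ac by auto
    then have "\<not> a < c - 1" by linarith
    then have "x = c - 1" using r by simp
    then show ?thesis using cj ci by auto
  qed
qed

text \<open>The images of the points \<open>p, P, c\<close> around a node of the colour \<open>A\<close> next to a run of the
  colour \<open>B\<close>; the run continues with the colour \<open>A\<close> unless \<open>W A c = c\<close>.\<close>

lemma branch_points:
  assumes AB: "A \<in> I'" "B \<in> I'" "A \<noteq> B" "M' A B = 4 \<or> M' A B = 5"
    and W: "W A p = P" "W A P = p" "W B P = c" "W B c = P" "W B p = p" "c \<noteq> p"
    and c: "W A c = c \<or> W A c = e \<and> W A e = c \<and> W B e = e \<and> e \<noteq> P"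
  shows "M' A B = 4 \<and> W A c \<noteq> c"
proof -
  have "W A c \<noteq> c" if "M' A B = 4"
  proof
    assume "W A c = c"
    then show False using relation_4[OF AB(1-3) that, of P] W by simp
  qed
  moreover have False if "M' A B = 5"
    using c
  proof
    assume "W A c = c"
    then show False using relation_5[OF AB(1-3) that, of P] W by simp
  next
    assume "W A c = e \<and> W A e = c \<and> W B e = e \<and> e \<noteq> P"
    then show False using relation_5[OF AB(1-3) that, of P] W by simp
  qed
  ultimately show ?thesis using AB(4) by blast
qed

lemma single_edge_K:
  assumes se: "single_edge n col A B" and A: "A \<in> I'" and B: "B \<in> I'" "A \<noteq> B" and x: "x \<in> K A"
  shows "run (K A) x (Suc x)" "x - 1 \<notin> K B \<or> Suc x \<notin> K B" "x \<notin> K B"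
proof -
  have xn: "1 \<le> x" "x \<le> n" "col x = A" using in_K_iff A x by auto
  note s = se[unfolded single_edge_def, rule_format, of x]
  have "x - 1 \<notin> K A" "Suc x \<notin> K A" "x - 1 \<notin> K B \<or> Suc x \<notin> K B"
    using s xn in_K_iff[OF A] in_K_iff[OF B(1)] by auto
  then show "run (K A) x (Suc x)" "x - 1 \<notin> K B \<or> Suc x \<notin> K B"
    using xn x by (auto simp: run_def)
  show "x \<notin> K B" using K_unique A B x by blast
qed

text \<open>\<open>branch_points\<close> applies to the strands \<open>p\<close>,
  \<open>Suc p\<close>, \<open>Suc q\<close>. The reversal of \<open>A\<close> moves the last one
  only if a node of colour \<open>A\<close> follows the run, since \<open>q\<close> itself has
  colour \<open>B\<close>.\<close>

lemma branch_right:
  assumes se: "single_edge n col A B" and ne: "A \<noteq> B" and p: "1 \<le> p" "p < q" "q \<le> n" "col p = A"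
    and run_B: "\<And>x. x \<in> {p<..q} \<Longrightarrow> col x = B" and q: "q < n \<Longrightarrow> col (Suc q) \<noteq> B"
    and M: "M' A B = 4 \<or> M' A B = 5"
  shows "M' A B = 4 \<and> q < n \<and> col (Suc q) = A"
proof -
  have A: "A \<in> I'" "p \<in> K A" using col_in[of p] p by auto
  have Bx: "x \<in> K B" if "x \<in> {p<..q}" for x using col_in[of x] run_B[OF that] that p by auto
  have B: "B \<in> I'" using col_in[of q] run_B[of q] p by auto
  have Sq: "Suc q \<notin> K B" using in_K_iff[OF B] q by auto
  note sp = single_edge_K[OF se A(1) B ne A(2)]
  have pB: "p - 1 \<notin> K B" using sp(2) Bx[of "Suc p"] p by auto
  have rB: "run (K B) (Suc p) (Suc q)" using sp(3) Bx Sq p by (auto simp: run_def)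
  have nA: "q \<notin> K A" using K_unique A B ne Bx[of q] p by auto
  have W: "W A p = Suc p" "W A (Suc p) = p" "W B (Suc p) = Suc q" "W B (Suc q) = Suc p" "W B p = p"
    using W_run[OF A(1) sp(1), of p] W_run[OF A(1) sp(1), of "Suc p"] W_run[OF B rB, of "Suc p"]
      W_run[OF B rB, of "Suc q"] W_fix[OF B pB sp(3)] p by simp_all
  have "W A (Suc q) = Suc q \<or> W A (Suc q) = Suc (Suc q) \<and> W A (Suc (Suc q)) = Suc q \<and>
      W B (Suc (Suc q)) = Suc (Suc q) \<and> Suc (Suc q) \<noteq> Suc p"
  proof (cases "Suc q \<in> K A")
    case True
    note sq = single_edge_K[OF se A(1) B ne True]
    have "Suc (Suc q) \<notin> K B" using sq(2) Bx[of q] p by auto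
    then have "W B (Suc (Suc q)) = Suc (Suc q)" using W_fix[OF B, of "Suc (Suc q)"] sq(3) by simp
    then show ?thesis
      using W_run[OF A(1) sq(1), of "Suc q"] W_run[OF A(1) sq(1), of "Suc (Suc q)"] p by simp
  next
    case False
    then show ?thesis using W_fix[OF A(1), of "Suc q"] nA by simp
  qed
  then have *: "M' A B = 4 \<and> W A (Suc q) \<noteq> Suc q"
    by (intro branch_points[OF A(1) B ne M W]) (use p in auto)
  then have "Suc q \<in> K A" using W_fix[OF A(1), of "Suc q"] nA by auto
  then have "1 \<le> Suc q \<and> Suc q \<le> n \<and> col (Suc q) = A" using in_K_iff[OF A(1)] by blast
  then show ?thesis using * by auto
qed

text \<open>The argument from the other end, with the strands \<open>Suc p\<close>,
  \<open>p\<close>, \<open>q\<close>: only the colouring is ever mirrored, not the family of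
  words.\<close>

lemma branch_left:
  assumes se: "single_edge n col A B" and ne: "A \<noteq> B" and p: "1 \<le> q" "q < p" "p \<le> n" "col p = A"
    and run_B: "\<And>x. x \<in> {q..<p} \<Longrightarrow> col x = B" and q: "1 < q \<Longrightarrow> col (q - 1) \<noteq> B"
    and M: "M' A B = 4 \<or> M' A B = 5"
  shows "M' A B = 4 \<and> 1 < q \<and> col (q - 1) = A"
proof -
  have A: "A \<in> I'" "p \<in> K A" using col_in[of p] p by auto
  have Bx: "x \<in> K B" if "x \<in> {q..<p}" for x using col_in[of x] run_B[OF that] that p by auto
  have B: "B \<in> I'" using col_in[of q] run_B[of q] p by auto
  have Sq: "q - 1 \<notin> K B" using in_K_iff[OF B] q by auto
  note sp = single_edge_K[OF se A(1) B ne A(2)]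
  have pB: "Suc p \<notin> K B" using sp(2) Bx[of "p - 1"] p by auto
  have rB: "run (K B) q p" using sp(3) Bx Sq p by (auto simp: run_def)
  have nA: "q \<notin> K A" using K_unique A B ne Bx[of q] p by auto
  have W: "W A (Suc p) = p" "W A p = Suc p" "W B p = q" "W B q = p" "W B (Suc p) = Suc p"
    using W_run[OF A(1) sp(1), of p] W_run[OF A(1) sp(1), of "Suc p"] W_run[OF B rB, of p]
      W_run[OF B rB, of q] W_fix[OF B, of "Suc p"] pB sp(3) p by simp_all
  have "W A q = q \<or> W A q = q - 1 \<and> W A (q - 1) = q \<and> W B (q - 1) = q - 1 \<and> q - 1 \<noteq> p"
  proof (cases "q - 1 \<in> K A")
    case True
    note sq = single_edge_K[OF se A(1) B ne True]
    have "1 \<le> q - 1" using True in_K_iff A by auto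
    then have "Suc (q - 1) = q" by simp
    moreover have "q - 1 - 1 \<notin> K B" using sq(2) Bx[of q] p calculation by simp
    ultimately have "W B (q - 1) = q - 1" using W_fix[OF B, of "q - 1"] sq(3) by simp
    then show ?thesis using W_run[OF A(1) sq(1), of "q - 1"] W_run[OF A(1) sq(1), of q]
        \<open>Suc (q - 1) = q\<close> p by auto
  next
    case False
    then show ?thesis using W_fix[OF A(1), of q] nA by simp
  qed
  then have *: "M' A B = 4 \<and> W A q \<noteq> q"
    by (intro branch_points[OF A(1) B ne M W]) (use p in auto)
  then have "q - 1 \<in> K A" using W_fix[OF A(1), of q] nA by auto
  then have "1 \<le> q - 1 \<and> q - 1 \<le> n \<and> col (q - 1) = A" using in_K_iff[OF A(1)] by blast
  then show ?thesis using * by auto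
qed

sublocale colouring I' M' n col
proof
  show "col ` {1..n} = I'"
  proof
    show "col ` {1..n} \<subseteq> I'" using col_in by auto
    show "I' \<subseteq> col ` {1..n}"
    proof
      fix i assume i: "i \<in> I'"
      then obtain x where "x \<in> K i" using K_nonempty by blast
      then show "i \<in> col ` {1..n}" using in_K_iff[OF i] by force
    qed
  qed
  fix p assume p: "1 \<le> p" "p < n"
  show "3 \<le> M' (col p) (col (Suc p))" if "col p \<noteq> col (Suc p)" by (rule adjacent_ge_3[OF p that])
  assume m: "M' (col p) (col (Suc p)) = 3"
  have "col p \<in> I'" "col (Suc p) \<in> I'" using col_in p by auto
  then show "(1 < p \<longrightarrow> col (p - 1) \<notin> {col p, col (Suc p)}) \<and>
      (Suc p < n \<longrightarrow> col (Suc (Suc p)) \<notin> {col p, col (Suc p)})"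
    using isolated[OF p m] p by (auto simp: in_K_iff)
next
  fix i j assume ij: "i \<in> I'" "j \<in> I'" "i \<noteq> j" "3 \<le> M' i j"
  then obtain x y where xy: "x \<in> K i" "y \<in> K j" "y = Suc x \<or> x = Suc y" using edge by blast
  then have c: "col x = i" "col y = j" "1 \<le> x" "x \<le> n" "1 \<le> y" "y \<le> n" using in_K_iff ij by auto
  show "\<exists>p. 1 \<le> p \<and> p < n \<and> {col p, col (Suc p)} = {i, j}"
    using xy(3)
  proof
    assume "y = Suc x"
    then show ?thesis using c by (intro exI[of _ x]) auto
  next
    assume "x = Suc y"
    then show ?thesis using c by (intro exI[of _ y]) auto
  qed
next
  show "branch_rule n M' col" unfolding branch_rule_def
    by (intro allI impI, rule branch_right) auto
  have se: "single_edge n col A B" if "single_edge n (\<lambda>p. col (Suc n - p)) A B" for A B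
    unfolding single_edge_def
  proof
    fix x assume x: "x \<in> {1..n}"
    define y where "y = Suc n - x"
    have y: "y \<in> {1..n}" "Suc n - y = x" "1 < y \<longleftrightarrow> x < n" "y < n \<longleftrightarrow> 1 < x"
      "Suc n - Suc y = x - 1" "1 < y \<Longrightarrow> Suc n - (y - 1) = Suc x"
      using x by (auto simp: y_def)
    show "col x = A \<longrightarrow> (1 < x \<longrightarrow> col (x - 1) \<noteq> A) \<and> (x < n \<longrightarrow> col (Suc x) \<noteq> A) \<and>
        \<not> (1 < x \<and> x < n \<and> col (x - 1) = B \<and> col (Suc x) = B)"
    proof
      assume "col x = A"
      then have s: "(1 < y \<longrightarrow> col (Suc n - (y - 1)) \<noteq> A) \<and> (y < n \<longrightarrow> col (x - 1) \<noteq> A) \<and>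
          \<not> (1 < y \<and> y < n \<and> col (Suc n - (y - 1)) = B \<and> col (x - 1) = B)"
        using that[unfolded single_edge_def, THEN bspec, OF y(1)] unfolding y(2,5) by blast
      have "1 < y \<Longrightarrow> col (Suc n - (y - 1)) = col (Suc x)" using y(6) by (simp only:)
      then show "(1 < x \<longrightarrow> col (x - 1) \<noteq> A) \<and> (x < n \<longrightarrow> col (Suc x) \<noteq> A) \<and>
          \<not> (1 < x \<and> x < n \<and> col (x - 1) = B \<and> col (Suc x) = B)"
        using s y(3,4) by metis
    qed
  qed
  show "branch_rule n M' (\<lambda>p. col (Suc n - p))" unfolding branch_rule_def
  proof (intro allI impI)
    fix p q A B
    assume h: "single_edge n (\<lambda>p. col (Suc n - p)) A B" "A \<noteq> B" "1 \<le> p" "p < q" "q \<le> n"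
      "col (Suc n - p) = A" "\<forall>x\<in>{p<..q}. col (Suc n - x) = B" "q < n \<longrightarrow> col (Suc n - Suc q) \<noteq> B"
      "M' A B = 4 \<or> M' A B = 5"
    have "M' A B = 4 \<and> 1 < Suc n - q \<and> col (Suc n - q - 1) = A"
    proof (rule branch_left[OF se[OF h(1)] h(2) _ _ _ h(6) _ _ h(9)])
      fix x assume "x \<in> {Suc n - q..<Suc n - p}"
      then have "Suc n - x \<in> {p<..q}" "Suc n - (Suc n - x) = x" using h(3-5) by auto
      then show "col x = B" using h(7) by metis
    next
      assume "1 < Suc n - q"
      moreover have "Suc n - q - 1 = Suc n - Suc q" by simp
      ultimately show "col (Suc n - q - 1) \<noteq> B" using h(8) by simp
    qed (use h(3-5) in auto)
    then show "M' A B = 4 \<and> q < n \<and> col (Suc n - Suc q) = A" by auto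
  qed
qed (rule cox irr fin card_gt_2 | erule (3) neighbour_3)+

end


section \<open>Longest words and unfolding\<close>

lemma take_nth_alternating_word:
  assumes "k < m"
  shows "take k (alternating_word m i j) = alternating_word k i j"
    "alternating_word m i j ! k = (if even k then i else j)"
proof -
  have "m = k + Suc (m - k - 1)" using assms by simp
  then have eq: "alternating_word m i j = alternating_word k i j @
      (if even k then alternating_word (Suc (m - k - 1)) i j else alternating_word (Suc (m - k - 1)) j i)"
    using alternating_word_add[of k "Suc (m - k - 1)" i j] by metis
  show "take k (alternating_word m i j) = alternating_word k i j" unfolding eq by simp
  show "alternating_word m i j ! k = (if even k then i else j)" unfolding eq by (simp add: nth_append)
qed

section \<open>Alternating words are reduced\<close>

context braid_model
begin

text \<open>The factorisation from the proof of Matsumoto's theorem: an element with descents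
  \<open>i\<close> and \<open>j\<close> ends in a full alternating word.\<close>

lemma two_descents:
  assumes w: "w \<in> S" and ij: "i \<in> I" "j \<in> I" "i \<noteq> j" "\<not> asc w i" "\<not> asc w j" and m: "M i j = enat m"
  obtains u where "u \<in> lists I" "red u" "state u = w" "m \<le> length u"
proof -
  let ?a = "alternating_word m i j"
  have a: "?a \<in> lists I" using ij by (intro alternating_word_in_lists)
  have desc: "\<not> asc (foldl act w (alternating_word k i j)) (if even k then i else j)" if "k < m" for k
  proof -
    obtain l where "M i j = enat l"
      "\<forall>k<l. \<not> asc (foldl act w (alternating_word k i j)) (if even k then i else j)"
      using dihedral[OF w ij] by blast
    then show ?thesis using m that by simp
  qed
  have r: "red_from (foldl act w ?a) (rev ?a)"
    using w a by (rule red_from_rev) (simp add: take_nth_alternating_word desc)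
  have "foldl act w ?a \<in> S" using w a by (rule foldl_act_in_S)
  then obtain t where t: "t \<in> lists I" "red t" "state t = foldl act w ?a" using ex_red by blast
  have "t @ rev ?a \<in> lists I" using t(1) a by (simp add: append_in_lists_conv del: in_lists_conv_set) auto
  moreover have "red (t @ rev ?a)" using t r by (simp add: red_from_append)
  moreover have "state (t @ rev ?a) = w" using t foldl_act_rev[OF w a] by simp
  ultimately show thesis using that[of "t @ rev ?a"] by simp
qed

text \<open>If an alternating word shorter than \<open>m\<close> could not be prolonged, its state
  would have both descents and so a reduced word of length at least \<open>m\<close>, against the
  invariance of length.\<close>

lemma red_alternating:
  assumes ij: "i \<in> I" "j \<in> I" "i \<noteq> j" and m: "M i j = enat m"
  shows "red (alternating_word m i j)"
proof -
  have "k \<le> m \<Longrightarrow> red (alternating_word k i j)" for k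
  proof (induction k)
    case (Suc k)
    then have r: "red (alternating_word k i j)" and km: "k < m" by auto
    define w where "w = state (alternating_word k i j)"
    have aw: "alternating_word k i j \<in> lists I" using ij by (intro alternating_word_in_lists)
    have wS: "w \<in> S" unfolding w_def using e_in_S aw by (rule foldl_act_in_S)
    define x y where "x = (if even k then i else j)" and "y = (if even k then j else i)"
    have xy: "x \<in> I" "y \<in> I" "x \<noteq> y" using ij by (auto simp: x_def y_def)
    have Mxy: "M x y = enat m" using m coxeter ij by (auto simp: x_def y_def coxeter_matrix_def)
    have "asc w x"
    proof (rule ccontr)
      assume nx: "\<not> asc w x"
      show False
      proof (cases k)
        case 0
        then show False using nx asc_e xy by (simp add: w_def)
      next
        case k: (Suc l)
        have eq: "alternating_word k i j = alternating_word l i j @ [y]"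
          unfolding k alternating_word_snoc y_def k by simp
        have "alternating_word l i j @ [y] \<in> lists I" using aw eq by simp
        then have "\<not> asc w y"
          using red_snocD(2)[of "alternating_word l i j" y] r unfolding w_def eq by blast
        then obtain u where u: "u \<in> lists I" "red u" "state u = w" "m \<le> length u"
          using two_descents[OF wS xy nx _ Mxy] by blast
        then have "(u, alternating_word k i j) \<in> acong"
          using aw r by (intro matsumoto) (simp_all add: w_def)
        then have "length u = k" using artin_cong_length_set[OF coxeter] by fastforce
        then show False using u km by simp
      qed
    qed
    then show ?case using r unfolding alternating_word_snoc x_def w_def by (simp add: red_from_append)
  qed simp
  then show ?thesis by blast
qed

end

section \<open>Substitution of words for letters\<close>

abbreviation subst :: "('a \<Rightarrow> 'b list) \<Rightarrow> 'a list \<Rightarrow> 'b list" where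
  "subst h u \<equiv> concat (map h u)"

lemma subst_in_lists:
  assumes "\<And>x. x \<in> I \<Longrightarrow> h x \<in> lists J" "u \<in> lists I"
  shows "subst h u \<in> lists J"
  using assms(2) by (induction u) (use assms(1) in \<open>auto simp: subset_iff\<close>)

lemma word_cong_subst:
  assumes "(u, v) \<in> word_cong I R"
    and "\<And>x. x \<in> I \<Longrightarrow> h x \<in> lists J"
    and "\<And>u v. (u, v) \<in> R \<Longrightarrow> u \<in> lists I \<Longrightarrow> v \<in> lists I \<Longrightarrow> (subst h u, subst h v) \<in> word_cong J R'"
  shows "(subst h u, subst h v) \<in> word_cong J R'"
  using assms(1)
proof induction
  case (base u v)
  then show ?case by (rule assms(3))
next
  case (refl u)
  show ?case by (rule word_cong.refl, rule subst_in_lists[OF assms(2) refl])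
next
  case (sym u v)
  show ?case by (rule word_cong.sym[OF sym.IH])
next
  case (trans u v w)
  show ?case by (rule word_cong.trans[OF trans.IH])
next
  case (mult u v u' v')
  show ?case using word_cong.mult[OF mult.IH] by simp
qed

lemma subst_alternating_word: "subst h (alternating_word m i j) = alternating_concat m (h i) (h j)"
  by (induction m arbitrary: i j) auto

lemma alternating_concat_in_lists:
  "u \<in> lists I \<Longrightarrow> v \<in> lists I \<Longrightarrow> alternating_concat m u v \<in> lists I"
  by (induction m arbitrary: u v) auto

lemma subst_alternating_concat:
  "subst h (alternating_concat m u v) = alternating_concat m (subst h u) (subst h v)"
  by (induction m arbitrary: u v) auto

lemma coxeter_matrix_A: "coxeter_matrix {1..n} matrix_A"
  by (auto simp: coxeter_matrix_def matrix_A_def numeral_eq_enat one_enat_def)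

lemma labelled_A_nat: "labelled_A {1..n} matrix_A n (\<lambda>x. x)"
proof
  show "coxeter_matrix {1..n} matrix_A" by (rule coxeter_matrix_A)
  show "bij_betw (\<lambda>x. x) {1..n} {1..n}" by (simp add: bij_betw_def inj_on_def)
qed simp

lemma matsumoto_A:
  assumes "u \<in> lists {1..n}" "v \<in> lists {1..n}" "rising id u" "rising id v" "perm u = perm v"
  shows "(u, v) \<in> acong_A n"
proof -
  interpret labelled_A "{1..n}" matrix_A n "\<lambda>x. x" by (rule labelled_A_nat)
  have r: "red_from w u \<longleftrightarrow> rising w u" for w u by (induction u arbitrary: w) auto
  show ?thesis
    by (rule matsumoto) (use assms in \<open>simp_all add: r foldl_adj\<close>)
qed

text \<open>By \<open>perm_run\<close> such a permutation reverses each maximal run of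
  \<open>J\<close>; by \<open>perm_cut\<close> it fixes every other strand.\<close>

lemma perm_unique:
  assumes J: "finite J" "0 \<notin> J" and u: "u \<in> lists J" "\<And>j. j \<in> J \<Longrightarrow> perm u (Suc j) < perm u j"
    and v: "v \<in> lists J" "\<And>j. j \<in> J \<Longrightarrow> perm v (Suc j) < perm v j"
  shows "perm u = perm v"
proof
  fix x
  have run: "perm u x = perm v x" if "run J a c" "a \<le> x" "x \<le> c" for a c
    using perm_run[OF u that] perm_run[OF v that] by simp
  consider "x \<in> J" | "x - 1 \<in> J" | "x \<notin> J" "x - 1 \<notin> J" by blast
  then show "perm u x = perm v x"
  proof cases
    case 1
    then show ?thesis using ex_run[OF J 1] run by (metis less_imp_le_nat)
  next
    case 2
    obtain a c where ac: "run J a c" "a \<le> x - 1" "x - 1 < c" using ex_run[OF J 2] by blast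
    then show ?thesis using run[OF ac(1)] by linarith
  next
    case 3
    have "perm w x = x" if "w \<in> lists J" for w
    proof (cases x)
      case 0
      then show ?thesis using perm_cut[OF that J(2), of 0] by simp
    next
      case (Suc y)
      then show ?thesis using perm_cut[OF that 3(1), of x] perm_cut[OF that 3(2), of x] by simp
    qed
    then show ?thesis using u v by simp
  qed
qed

context labelled_A
begin

lemma red_from_rising: "red_from w u \<longleftrightarrow> rising w (map \<iota> u)"
  by (induction u arbitrary: w) auto

lemma foldl_perm: "foldl (\<lambda>w b. w \<circ> adj (\<iota> b)) w u = w \<circ> perm (map \<iota> u)"
  by (induction u arbitrary: w) (auto simp: comp_assoc)

lemma label_image: "J \<subseteq> I \<Longrightarrow> \<iota> ` J \<subseteq> {1..n}"
  using bij by (auto simp: bij_betw_def)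

lemma acong_A_map:
  assumes "(u, v) \<in> acong"
  shows "(map \<iota> u, map \<iota> v) \<in> acong_A n"
proof (rule word_cong_subst[OF assms, of "\<lambda>x. [\<iota> x]", unfolded concat_map_singleton])
  show "[\<iota> x] \<in> lists {1..n}" if "x \<in> I" for x using label_range[OF that] by simp
  fix u v assume "(u, v) \<in> artin_relations I M" "u \<in> lists I" "v \<in> lists I"
  then obtain m i j where m: "u = alternating_word m i j" "v = alternating_word m j i" "i \<in> I" "j \<in> I"
    "i \<noteq> j" "M i j = enat m" by (auto simp: artin_relations_def)
  have map: "map \<iota> (alternating_word m i j) = alternating_word m (\<iota> i) (\<iota> j)" for m i j
    by (induction m arbitrary: i j) auto
  have rng: "\<iota> i \<in> {1..n}" "\<iota> j \<in> {1..n}" "\<iota> i \<noteq> \<iota> j" "matrix_A (\<iota> i) (\<iota> j) = enat m"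
    using label_range m M_eq label_eq_iff by auto
  then have "(alternating_word m (\<iota> i) (\<iota> j), alternating_word m (\<iota> j) (\<iota> i)) \<in> artin_relations {1..n} matrix_A"
    unfolding artin_relations_def by blast
  then show "(map \<iota> u, map \<iota> v) \<in> acong_A n"
    unfolding m(1,2) map
    using rng(1,2) by (intro word_cong.base alternating_word_in_lists)
qed

lemma descent_iff:
  assumes "b \<in> I"
  shows "\<not> state u (\<iota> b) < state u (Suc (\<iota> b)) \<longleftrightarrow> perm (map \<iota> u) (Suc (\<iota> b)) < perm (map \<iota> u) (\<iota> b)"
proof -
  have "perm (map \<iota> u) (Suc (\<iota> b)) \<noteq> perm (map \<iota> u) (\<iota> b)"
    by (simp add: inj_eq[OF inj_perm])
  moreover have "state u = perm (map \<iota> u)" by (simp add: foldl_perm)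
  ultimately show ?thesis by (simp only: not_less) linarith
qed

lemma longest_word_unique:
  assumes J: "J \<subseteq> I"
    and u: "u \<in> lists J" "rising id (map \<iota> u)" "\<And>j. j \<in> J \<Longrightarrow> perm (map \<iota> u) (Suc (\<iota> j)) < perm (map \<iota> u) (\<iota> j)"
    and v: "v \<in> lists J" "rising id (map \<iota> v)" "\<And>j. j \<in> J \<Longrightarrow> perm (map \<iota> v) (Suc (\<iota> j)) < perm (map \<iota> v) (\<iota> j)"
  shows "(u, v) \<in> acong"
proof (rule matsumoto)
  have "perm (map \<iota> u) = perm (map \<iota> v)"
  proof (rule perm_unique[of "\<iota> ` J"])
    show "finite (\<iota> ` J)" using label_image[OF J] by (rule finite_subset) simp
    show "0 \<notin> \<iota> ` J" using label_image[OF J] by auto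
    show "map \<iota> u \<in> lists (\<iota> ` J)" "map \<iota> v \<in> lists (\<iota> ` J)" using u(1) v(1) by auto
  qed (use u(3) v(3) in auto)
  then show "state u = state v" by (simp add: foldl_perm)
  show "u \<in> lists I" "v \<in> lists I" using J u(1) v(1) by auto
  show "red u" "red v" unfolding red_from_rising by (rule u(2) v(2))+
qed

end

text \<open>Reduced words in type A for the flips; for odd \<open>N\<close> the last flip swaps
  \<open>r\<close> and \<open>r + 2\<close>, which takes three letters.\<close>

definition unfold_letter :: "nat \<Rightarrow> nat \<Rightarrow> nat \<Rightarrow> nat list" where
  "unfold_letter r N i = (if i < r then [i, N - i] else if N = 2 * r then [r] else [r, Suc r, r])"

section \<open>Unfolding type B into type A\<close>

context labelled_B
begin

abbreviation unf :: "'b list \<Rightarrow> nat list" where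
  "unf \<equiv> subst (\<lambda>b. unfold_letter r N (\<iota> b))"

lemma unfold_letter_in_lists:
  assumes "1 \<le> i" "i \<le> r"
  shows "unfold_letter r N i \<in> lists {1..N - 1}"
  using assms r N by (auto simp: unfold_letter_def)

lemma perm_unfold_letter:
  assumes "1 \<le> i" "i \<le> r"
  shows "perm (unfold_letter r N i) = flip r N i"
proof (cases "i < r")
  case True
  then show ?thesis by (simp add: unfold_letter_def flip_def)
next
  case False
  then have i: "i = r" using assms by simp
  show ?thesis
  proof (cases "N = 2 * r")
    case True
    then have "Suc N - r = Suc r" by simp
    then show ?thesis using i True by (simp add: unfold_letter_def flip_def)
  next
    case False
    then have "Suc N - r = Suc (Suc r)" using N by simp
    moreover have "adj r \<circ> adj (Suc r) \<circ> adj r = transpose r (Suc (Suc r))"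
      by (rule transpose_comp_triple) auto
    ultimately show ?thesis using i False by (simp add: unfold_letter_def flip_def comp_assoc)
  qed
qed

text \<open>The middle strand is fixed, so comparing the values at \<open>r\<close> and at its
  mirror image amounts to comparing either with the middle.\<close>

lemma middle_order:
  assumes "w \<in> bstates" "N \<noteq> 2 * r"
  shows "w r < w (Suc N - r) \<longleftrightarrow> w r < w (Suc r)" "w r < w (Suc N - r) \<longleftrightarrow> w (Suc r) < w (Suc (Suc r))"
proof -
  have NN: "N = Suc (2 * r)" using N assms by blast
  have "r \<in> {1..N}" using NN r by simp
  then have "w (Suc N - r) = Suc N - w r" "w r \<in> {1..N}"
    using assms(1) permutes_in_image[of w "{1..N}" r] by blast+
  moreover have "w (Suc r) = Suc r" using bstates_mid[OF assms(1) NN] .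
  moreover have "Suc N - r = Suc (Suc r)" using NN by simp
  ultimately have "w (Suc (Suc r)) = Suc N - w r" "w r \<le> N" "w (Suc r) = Suc r" "Suc N - r = Suc (Suc r)"
    by auto
  then show "w r < w (Suc N - r) \<longleftrightarrow> w r < w (Suc r)" "w r < w (Suc N - r) \<longleftrightarrow> w (Suc r) < w (Suc (Suc r))"
    using NN by auto
qed

lemma rising_unfold_letter:
  assumes w: "w \<in> bstates" and b: "b \<in> I" and asc: "basc w b"
  shows "rising w (unfold_letter r N (\<iota> b))"
proof -
  note rb = label_range[OF b]
  show ?thesis
  proof (cases "\<iota> b < r")
    case True
    define i where "i = \<iota> b"
    define z where "z = N - i"
    have z: "N - i = z" "Suc N - i = Suc z" "Suc N - Suc i = z" "Suc i < z" "i \<in> {1..N}" "Suc i \<in> {1..N}"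
      using True rb N by (auto simp: z_def i_def)
    have "w i < w (Suc i)" using asc True by (simp add: i_def)
    then have "w z < w (Suc z)" using bstates_mirror_less[OF w z(6,5)] z by simp
    then show ?thesis using True \<open>w i < w (Suc i)\<close> z by (simp add: unfold_letter_def i_def)
  next
    case False
    then have br: "\<iota> b = r" using rb by simp
    show ?thesis
    proof (cases "N = 2 * r")
      case True
      then have "Suc N - r = Suc r" by simp
      then show ?thesis using asc br True by (simp add: unfold_letter_def)
    next
      case False
      then have "Suc N - r = Suc (Suc r)" using N by simp
      then show ?thesis using asc br False middle_order[OF w False]
        by (simp add: unfold_letter_def)
    qed
  qed
qed

text \<open>An ascent of type B unfolds into ascents of type A, so unfolding carries reduced words
  to reduced words.\<close>

lemma red_from_unf:
  assumes "w \<in> bstates" "u \<in> lists I" "red_from w u"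
  shows "rising w (unf u) \<and> foldl bact w u = w \<circ> perm (unf u)"
  using assms
proof (induction u arbitrary: w)
  case (Cons b u)
  have b: "b \<in> I" "u \<in> lists I" using Cons.prems(2) by auto
  have "basc w b" "red_from (bact w b) u" using Cons.prems(3) unfolding red_from.simps by blast+
  note b = b this
  have bw: "bact w b \<in> bstates" using act_in_S[OF Cons.prems(1) b(1)] .
  have p: "perm (unfold_letter r N (\<iota> b)) = flip r N (\<iota> b)"
    using label_range[OF b(1)] by (intro perm_unfold_letter) auto
  have IH: "rising (bact w b) (unf u)" "foldl bact (bact w b) u = bact w b \<circ> perm (unf u)"
    using Cons.IH[OF bw b(2,4)] by blast+
  have "rising w (unf (b # u))"
    using rising_unfold_letter[OF Cons.prems(1) b(1,3)] IH(1) p by (simp add: rising_append)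
  moreover have "foldl bact w (b # u) = w \<circ> perm (unf (b # u))"
    using IH(2) p by (simp add: perm_append comp_assoc)
  ultimately show ?case by blast
qed simp

lemma rising_unf: "u \<in> lists I \<Longrightarrow> red u \<Longrightarrow> rising id (unf u)"
  using red_from_unf[OF e_in_S] by blast

lemma state_unf: "u \<in> lists I \<Longrightarrow> red u \<Longrightarrow> state u = perm (unf u)"
  using red_from_unf[OF e_in_S, of u] unfolding id_comp by blast

lemma unf_in_lists: "u \<in> lists I \<Longrightarrow> unf u \<in> lists {1..N - 1}"
  by (rule subst_in_lists[of I]) (use unfold_letter_in_lists label_range in blast)+

text \<open>Both sides of a relation of type B are reduced with the same state, so their unfoldings
  are reduced words of the same permutation. Matsumoto's theorem in type A replaces a computation
  with braid moves.\<close>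

lemma acong_A_unf:
  assumes "(u, v) \<in> acong"
  shows "(unf u, unf v) \<in> acong_A (N - 1)"
proof (rule word_cong_subst[OF assms])
  show "unfold_letter r N (\<iota> b) \<in> lists {1..N - 1}" if "b \<in> I" for b
    using unfold_letter_in_lists label_range[OF that] by blast
  fix u v assume uv: "(u, v) \<in> artin_relations I M" "u \<in> lists I" "v \<in> lists I"
  then obtain m i j where m: "u = alternating_word m i j" "v = alternating_word m j i" "i \<in> I" "j \<in> I"
    "i \<noteq> j" "M i j = enat m" by (auto simp: artin_relations_def)
  have mji: "M j i = enat m" using m coxeter by (auto simp: coxeter_matrix_def)
  have "red u" "red v" unfolding m(1,2)
    using red_alternating[OF m(3,4,5,6)] red_alternating[OF m(4,3) _ mji] m(5) by auto
  then have r: "rising id (unf u)" "state u = perm (unf u)" "rising id (unf v)" "state v = perm (unf v)"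
    using rising_unf state_unf uv(2,3) by blast+
  have "state u = state v" unfolding m(1,2) using braid[OF e_in_S m(3-6)] .
  then show "(unf u, unf v) \<in> acong_A (N - 1)"
    using r unf_in_lists uv by (intro matsumoto_A) simp_all
qed

definition unfold_set :: "'b set \<Rightarrow> nat set" where
  "unfold_set J = (\<Union>b\<in>J. set (unfold_letter r N (\<iota> b)))"

lemma unf_descent:
  assumes J: "J \<subseteq> I" and u: "u \<in> lists J" "red u" "\<And>j. j \<in> J \<Longrightarrow> \<not> basc (state u) j"
    and x: "x \<in> unfold_set J"
  shows "perm (unf u) (Suc x) < perm (unf u) x"
proof -
  define w where "w = state u"
  have uI: "u \<in> lists I" using u J by auto
  have w: "w \<in> bstates" unfolding w_def by (rule foldl_act_in_S[OF e_in_S uI])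
  have wp: "w = perm (unf u)" unfolding w_def using state_unf[OF uI u(2)] .
  have "inj w" unfolding wp by (rule inj_perm)
  then have inj: "w y = w z \<Longrightarrow> y = z" for y z by (rule injD)
  obtain b where b: "b \<in> J" "x \<in> set (unfold_letter r N (\<iota> b))" using x by (auto simp: unfold_set_def)
  have bI: "b \<in> I" and nb: "\<not> basc w b" using b J u(3) by (auto simp: w_def)
  note rb = label_range[OF bI]
  have "w (Suc x) < w x"
  proof (cases "\<iota> b < r")
    case True
    define i where "i = \<iota> b"
    define z where "z = N - i"
    have z: "N - i = z" "Suc N - i = Suc z" "Suc N - Suc i = z" "i \<in> {1..N}" "Suc i \<in> {1..N}"
      using True rb N by (auto simp: z_def i_def)
    have "\<not> w i < w (Suc i)" using nb True by (simp add: i_def)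
    moreover have "w i \<noteq> w (Suc i)" using inj[of i "Suc i"] by auto
    ultimately have i: "w (Suc i) < w i" by linarith
    then have "w (Suc z) < w z" using bstates_mirror_less[OF w z(4,5)] z by simp
    moreover have "x = i \<or> x = z" using b(2) True z(1) by (auto simp: unfold_letter_def i_def)
    ultimately show ?thesis using i by blast
  next
    case False
    then have br: "\<iota> b = r" using rb by simp
    then have nr: "\<not> w r < w (Suc N - r)" using nb by simp
    show ?thesis
    proof (cases "N = 2 * r")
      case True
      then have "Suc N - r = Suc r" "x = r" using b(2) br by (auto simp: unfold_letter_def)
      moreover have "w r \<noteq> w (Suc r)" using inj[of r "Suc r"] by auto
      ultimately show ?thesis using nr by simp
    next
      case False
      then have "x = r \<or> x = Suc r" using b(2) br by (auto simp: unfold_letter_def)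
      moreover have "w r \<noteq> w (Suc r)" "w (Suc r) \<noteq> w (Suc (Suc r))"
        using inj[of r "Suc r"] inj[of "Suc r" "Suc (Suc r)"] by auto
      moreover have "\<not> w r < w (Suc r)" "\<not> w (Suc r) < w (Suc (Suc r))"
        using nr middle_order[OF w False] by blast+
      ultimately show ?thesis by (metis linorder_neqE_nat)
    qed
  qed
  then show ?thesis unfolding wp .
qed

lemma unf_unfold_set: "u \<in> lists J \<Longrightarrow> unf u \<in> lists (unfold_set J)"
  by (rule subst_in_lists[of J]) (auto simp: unfold_set_def)

lemma unfold_set_sub:
  assumes "J \<subseteq> I"
  shows "unfold_set J \<subseteq> {1..N - 1}"
  unfolding unfold_set_def
proof (rule UN_least)
  fix b assume "b \<in> J"
  then have "1 \<le> \<iota> b" "\<iota> b \<le> r" using label_range[of b] assms by blast+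
  then have "unfold_letter r N (\<iota> b) \<in> lists {1..N - 1}" by (rule unfold_letter_in_lists)
  then show "set (unfold_letter r N (\<iota> b)) \<subseteq> {1..N - 1}" by blast
qed

text \<open>Uniqueness is inherited from type A: the state of a reduced word is the permutation of
  its unfolding.\<close>

lemma longest_word_unique:
  assumes J: "J \<subseteq> I"
    and u: "u \<in> lists J" "red u" "\<And>j. j \<in> J \<Longrightarrow> \<not> basc (state u) j"
    and v: "v \<in> lists J" "red v" "\<And>j. j \<in> J \<Longrightarrow> \<not> basc (state v) j"
  shows "(u, v) \<in> acong"
proof (rule matsumoto)
  have I: "u \<in> lists I" "v \<in> lists I" using J u v by auto
  then show "u \<in> lists I" "v \<in> lists I" by simp_all
  have "perm (unf u) = perm (unf v)"
  proof (rule perm_unique[of "unfold_set J"])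
    show "finite (unfold_set J)" using unfold_set_sub[OF J] by (rule finite_subset) simp
    show "0 \<notin> unfold_set J" using unfold_set_sub[OF J] by auto
    show "unf u \<in> lists (unfold_set J)" "unf v \<in> lists (unfold_set J)"
      using unf_unfold_set u(1) v(1) by blast+
  qed (use unf_descent[OF J u] unf_descent[OF J v] in blast)+
  then show "state u = state v" using state_unf[OF I(1) u(2)] state_unf[OF I(2) v(2)] by (simp only:)
qed (rule u(2) v(2))+

lemma artin_lift_longest:
  assumes J: "J \<subseteq> I" "finite (parabolic I M J)"
    and u: "u \<in> lists J" "red u" "\<And>j. j \<in> J \<Longrightarrow> \<not> basc (state u) j"
  shows "artin_lift I M (longest_element I M J) = word_class I (artin_relations I M) u"
proof -
  obtain v where v: "v \<in> lists J" "red v" "\<And>j. j \<in> J \<Longrightarrow> \<not> basc (state v) j"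
    "artin_lift I M (longest_element I M J) = word_class I (artin_relations I M) v"
    using longest_element_word[OF J] by blast
  have vu: "(v, u) \<in> acong" by (rule longest_word_unique[OF J(1) v(1-3) u])
  show ?thesis unfolding v(4) using vu word_cong_lists[OF vu] by (subst word_class_eq_iff) auto
qed

end


section \<open>Homomorphisms of Artin monoids\<close>

abbreviation artin_class :: "'a set \<Rightarrow> ('a \<Rightarrow> 'a \<Rightarrow> enat) \<Rightarrow> 'a list \<Rightarrow> 'a list set" where
  "artin_class I M \<equiv> word_class I (artin_relations I M)"

abbreviation artin_cong :: "'a set \<Rightarrow> ('a \<Rightarrow> 'a \<Rightarrow> enat) \<Rightarrow> ('a list \<times> 'a list) set" where
  "artin_cong I M \<equiv> word_cong I (artin_relations I M)"

lemma mult_artin: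
  "u \<in> lists I \<Longrightarrow> v \<in> lists I \<Longrightarrow>
    artin_class I M u \<otimes>\<^bsub>artin_monoid I M\<^esub> artin_class I M v = artin_class I M (u @ v)"
  unfolding artin_monoid_def by (rule mult_presented_monoid)

lemma carrier_artin: "carrier (artin_monoid I M) = artin_class I M ` lists I"
  unfolding artin_monoid_def by (rule carrier_presented_monoid)

lemma one_artin: "\<one>\<^bsub>artin_monoid I M\<^esub> = artin_class I M []"
  unfolding artin_monoid_def by (rule one_presented_monoid)

lemma artin_class_eqI: "(u, v) \<in> artin_cong I M \<Longrightarrow> artin_class I M u = artin_class I M v"
  using word_cong_lists word_class_eq_iff by metis

lemma artin_relation:
  assumes "i \<in> I" "j \<in> I" "i \<noteq> j" "M i j = enat m"
  shows "(alternating_word m i j, alternating_word m j i) \<in> artin_cong I M"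
proof (rule word_cong.base)
  show "(alternating_word m i j, alternating_word m j i) \<in> artin_relations I M"
    unfolding artin_relations_def using assms by blast
qed (use assms alternating_word_in_lists in metis)+

lemma alternating_product_class:
  assumes "u \<in> lists I" "v \<in> lists I"
  shows "alternating_product (artin_monoid I M) k (artin_class I M u) (artin_class I M v)
    = artin_class I M (alternating_concat k u v)"
  using assms
proof (induction k arbitrary: u v)
  case (Suc k)
  then show ?case
    using mult_artin[OF Suc.prems(1) alternating_concat_in_lists[OF Suc.prems(2,1), of k], of M] by simp
qed (simp add: one_artin)

lemma hom_word:
  assumes \<Phi>: "\<Phi> \<in> monoid_hom (artin_monoid I' M') (artin_monoid I M)"
    and V: "\<And>i. i \<in> I' \<Longrightarrow> V i \<in> lists I" "\<And>i. i \<in> I' \<Longrightarrow> \<Phi> (artin_gen I' M' i) = artin_class I M (V i)"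
    and u: "u \<in> lists I'"
  shows "\<Phi> (artin_class I' M' u) = artin_class I M (subst V u)"
  using u
proof (induction u)
  case Nil
  then show ?case using \<Phi> by (simp add: monoid_hom_def one_artin)
next
  case (Cons i u)
  then have i: "i \<in> I'" "u \<in> lists I'" "[i] \<in> lists I'" by auto
  have hom: "\<Phi> \<in> hom (artin_monoid I' M') (artin_monoid I M)" using \<Phi> by (simp add: monoid_hom_def)
  have "artin_class I' M' (i # u)
      = artin_gen I' M' i \<otimes>\<^bsub>artin_monoid I' M'\<^esub> artin_class I' M' u"
    unfolding artin_gen_def using mult_artin[OF i(3,2), of M'] by simp
  moreover have "artin_gen I' M' i \<in> carrier (artin_monoid I' M')"
    "artin_class I' M' u \<in> carrier (artin_monoid I' M')"
    unfolding carrier_artin artin_gen_def using i by blast+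
  ultimately have "\<Phi> (artin_class I' M' (i # u))
      = artin_class I M (V i) \<otimes>\<^bsub>artin_monoid I M\<^esub> artin_class I M (subst V u)"
    using hom_mult[OF hom] V(2)[OF i(1)] Cons.IH by simp
  also have "\<dots> = artin_class I M (V i @ subst V u)"
    by (intro mult_artin V(1) i(1) subst_in_lists[of I'] i(2))
  finally show ?case by simp
qed

lemma hom_relation:
  assumes \<Phi>: "\<Phi> \<in> monoid_hom (artin_monoid I' M') (artin_monoid I M)"
    and V: "\<And>i. i \<in> I' \<Longrightarrow> V i \<in> lists I" "\<And>i. i \<in> I' \<Longrightarrow> \<Phi> (artin_gen I' M' i) = artin_class I M (V i)"
    and ij: "i \<in> I'" "j \<in> I'" "i \<noteq> j" "M' i j = enat m"
  shows "(alternating_concat m (V i) (V j), alternating_concat m (V j) (V i)) \<in> artin_cong I M"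
proof -
  have w: "alternating_word m i j \<in> lists I'" "alternating_word m j i \<in> lists I'"
    using ij alternating_word_in_lists by metis+
  have "\<Phi> (artin_class I' M' (alternating_word m i j)) = \<Phi> (artin_class I' M' (alternating_word m j i))"
    using artin_class_eqI[OF artin_relation[where M = M', OF ij]] by simp
  then have "artin_class I M (alternating_concat m (V i) (V j)) = artin_class I M (alternating_concat m (V j) (V i))"
    using hom_word[OF \<Phi> V w(1)] hom_word[OF \<Phi> V w(2)] by (simp add: subst_alternating_word)
  then show ?thesis
    using word_class_eq_iff[of _ I _ "artin_relations I M"] alternating_concat_in_lists V(1) ij by metis
qed

text \<open>The universal property of the presentation, with the value computed on a chosen word of
  the class.\<close>

lemma ex_artin_hom:
  assumes V: "\<And>i. i \<in> I' \<Longrightarrow> V i \<in> lists I"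
    and rel: "\<And>i j m. i \<in> I' \<Longrightarrow> j \<in> I' \<Longrightarrow> i \<noteq> j \<Longrightarrow> M' i j = enat m \<Longrightarrow>
      (alternating_concat m (V i) (V j), alternating_concat m (V j) (V i)) \<in> artin_cong I M"
  obtains \<Psi> where "\<Psi> \<in> monoid_hom (artin_monoid I' M') (artin_monoid I M)"
    "\<And>u. u \<in> lists I' \<Longrightarrow> \<Psi> (artin_class I' M' u) = artin_class I M (subst V u)"
proof -
  define \<Psi> where "\<Psi> x = artin_class I M (subst V (SOME u. u \<in> x))" for x
  have sub: "subst V u \<in> lists I" if "u \<in> lists I'" for u by (rule subst_in_lists[OF V that])
  have \<Psi>: "\<Psi> (artin_class I' M' u) = artin_class I M (subst V u)" if "u \<in> lists I'" for u
  proof -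
    have "u \<in> artin_class I' M' u" using that by (simp add: word_class_def word_cong.refl)
    then have "(SOME v. v \<in> artin_class I' M' u) \<in> artin_class I' M' u" by (rule someI)
    then have "(u, SOME v. v \<in> artin_class I' M' u) \<in> artin_cong I' M'" by (simp add: word_class_def)
    then have "(subst V u, subst V (SOME v. v \<in> artin_class I' M' u)) \<in> artin_cong I M"
    proof (rule word_cong_subst)
      fix u v assume "(u, v) \<in> artin_relations I' M'"
      then show "(subst V u, subst V v) \<in> artin_cong I M"
        using rel by (auto simp: artin_relations_def subst_alternating_word)
    qed (rule V)
    then show ?thesis unfolding \<Psi>_def using artin_class_eqI by metis
  qed
  have "\<Psi> \<in> hom (artin_monoid I' M') (artin_monoid I M)"
  proof (rule homI)
    fix x assume "x \<in> carrier (artin_monoid I' M')"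
    then obtain u where "x = artin_class I' M' u" "u \<in> lists I'" unfolding carrier_artin by blast
    then show "\<Psi> x \<in> carrier (artin_monoid I M)" unfolding carrier_artin using \<Psi> sub by blast
  next
    fix x y assume "x \<in> carrier (artin_monoid I' M')" "y \<in> carrier (artin_monoid I' M')"
    then obtain u v where uv: "x = artin_class I' M' u" "u \<in> lists I'" "y = artin_class I' M' v" "v \<in> lists I'"
      unfolding carrier_artin by blast
    then have "u @ v \<in> lists I'" by (simp add: append_in_lists_conv del: in_lists_conv_set)
    then show "\<Psi> (x \<otimes>\<^bsub>artin_monoid I' M'\<^esub> y) = \<Psi> x \<otimes>\<^bsub>artin_monoid I M\<^esub> \<Psi> y"
      unfolding uv(1,3) mult_artin[OF uv(2,4)] using \<Psi> uv(2,4) mult_artin[OF sub sub, OF uv(2,4)] by simp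
  qed
  moreover have "\<Psi> \<one>\<^bsub>artin_monoid I' M'\<^esub> = \<one>\<^bsub>artin_monoid I M\<^esub>"
    unfolding one_artin using \<Psi>[of "[]"] by simp
  ultimately have "\<Psi> \<in> monoid_hom (artin_monoid I' M') (artin_monoid I M)" by (simp add: monoid_hom_def)
  then show thesis using that \<Psi> by blast
qed

lemma artin_cong_map:
  assumes uv: "(u, v) \<in> artin_cong I M" and f: "\<And>i. i \<in> I \<Longrightarrow> f i \<in> J" "inj_on f I"
    and N: "\<And>i j. i \<in> I \<Longrightarrow> j \<in> I \<Longrightarrow> N (f i) (f j) = M i j"
  shows "(map f u, map f v) \<in> artin_cong J N"
proof (rule word_cong_subst[OF uv, of "\<lambda>x. [f x]", unfolded concat_map_singleton])
  show "[f x] \<in> lists J" if "x \<in> I" for x using f(1)[OF that] by simp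
  fix u v assume "(u, v) \<in> artin_relations I M"
  then obtain m i j where m: "u = alternating_word m i j" "v = alternating_word m j i" "i \<in> I" "j \<in> I"
    "i \<noteq> j" "M i j = enat m" by (auto simp: artin_relations_def)
  have map: "map f (alternating_word m i j) = alternating_word m (f i) (f j)" for m i j
    by (induction m arbitrary: i j) auto
  have "f i \<noteq> f j" using f(2) m by (auto dest: inj_onD)
  then show "(map f u, map f v) \<in> artin_cong J N"
    unfolding m(1,2) map using artin_relation[of "f i" J "f j" N m] f(1) m N by simp
qed

lemma commuting_word_letters:
  assumes "w \<in> lists I" "v \<in> lists I" "\<And>b. b \<in> set v \<Longrightarrow> (w @ [b], [b] @ w) \<in> word_cong I R"
  shows "(w @ v, v @ w) \<in> word_cong I R"
  using assms(2,3)
proof (induction v)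
  case Nil
  then show ?case using assms(1) by (simp add: word_cong.refl)
next
  case (Cons b v)
  then have b: "b \<in> I" "v \<in> lists I" by auto
  have IH: "(w @ v, v @ w) \<in> word_cong I R" using Cons.IH Cons.prems(1) by simp
  have "([b] @ (w @ v), [b] @ (v @ w)) \<in> word_cong I R"
    by (rule word_cong.mult[OF word_cong.refl IH]) (use b in simp)
  moreover have "((w @ [b]) @ v, ([b] @ w) @ v) \<in> word_cong I R"
    by (rule word_cong.mult[OF Cons.prems(1) word_cong.refl]) (use b in simp_all)
  ultimately show ?case using word_cong.trans[of "w @ b # v" "b # w @ v" I R "b # v @ w"] by simp
qed

lemma commuting_words:
  assumes "u \<in> lists I" "v \<in> lists I"
    and "\<And>a b. a \<in> set u \<Longrightarrow> b \<in> set v \<Longrightarrow> ([a, b], [b, a]) \<in> word_cong I R"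
  shows "(u @ v, v @ u) \<in> word_cong I R"
proof (rule commuting_word_letters[OF assms(1,2)])
  fix b assume b: "b \<in> set v"
  have bI: "[b] \<in> lists I" using assms(2) b by auto
  have "([b] @ u, u @ [b]) \<in> word_cong I R"
    by (rule commuting_word_letters[OF bI assms(1)]) (use assms(3) b in \<open>simp add: word_cong.sym\<close>)
  then show "(u @ [b], [b] @ u) \<in> word_cong I R" by (rule word_cong.sym)
qed

lemma artin_commute:
  assumes "a \<in> I" "b \<in> I" "a \<noteq> b" "M a b = 2"
  shows "([a, b], [b, a]) \<in> artin_cong I M"
  using artin_relation[of a I b M 2] assms by (simp add: alternating_word_numeral numeral_eq_enat)

section \<open>Consequences of optimality for any target\<close>

locale standard_setup =
  fixes I' :: "'a set" and M' :: "'a \<Rightarrow> 'a \<Rightarrow> enat" and I :: "'b set" and M :: "'b \<Rightarrow> 'b \<Rightarrow> enat"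
    and \<Phi> :: "'a list set \<Rightarrow> 'b list set" and K :: "'a \<Rightarrow> 'b set" and V :: "'a \<Rightarrow> 'b list"
  assumes cox': "coxeter_matrix I' M'" and irr': "irreducible_coxeter I' M'"
    and fin': "finite_type I' M'" and card': "2 < card I'"
    and cox: "coxeter_matrix I M" and I_nonempty: "I \<noteq> {}"
    and hom: "\<Phi> \<in> monoid_hom (artin_monoid I' M') (artin_monoid I M)"
    and disjoint: "disjoint_family_on K I'" and cover: "(\<Union>i\<in>I'. K i) = I"
    and optimal: "optimal_hom I' M' I M \<Phi>"
    and V_K: "i \<in> I' \<Longrightarrow> V i \<in> lists (K i)"
    and V_hom: "i \<in> I' \<Longrightarrow> \<Phi> (artin_gen I' M' i) = artin_class I M (V i)"
    and V_nonempty: "i \<in> I' \<Longrightarrow> K i \<noteq> {} \<Longrightarrow> V i \<noteq> []"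
begin

lemma K_sub: "i \<in> I' \<Longrightarrow> K i \<subseteq> I" using cover by blast

lemma V_I: "i \<in> I' \<Longrightarrow> V i \<in> lists I" using V_K K_sub by blast

lemma K_unique: "i \<in> I' \<Longrightarrow> j \<in> I' \<Longrightarrow> b \<in> K i \<Longrightarrow> b \<in> K j \<Longrightarrow> i = j"
  using disjoint by (auto simp: disjoint_family_on_def)

text \<open>The letters of \<open>K i\<close> and \<open>K j\<close> commute, so 2 is an exponent;
  the disjoint supports keep the images distinct, so 1 is not. Optimality then reads off the label
  2.\<close>

lemma non_adjacent:
  assumes ij: "i \<in> I'" "j \<in> I'" "i \<noteq> j" and ne: "K i \<noteq> {} \<or> K j \<noteq> {}"
    and M2: "\<And>a b. a \<in> K i \<Longrightarrow> b \<in> K j \<Longrightarrow> M a b = 2"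
  shows "M' i j = 2"
proof -
  define x y where "x = \<Phi> (artin_gen I' M' i)" and "y = \<Phi> (artin_gen I' M' j)"
  define B where "B = braid_exponents (artin_monoid I M) x y"
  have x: "x = artin_class I M (V i)" and y: "y = artin_class I M (V j)"
    using V_hom ij by (simp_all add: x_def y_def)
  have prod: "alternating_product (artin_monoid I M) k x y = artin_class I M (alternating_concat k (V i) (V j))"
    "alternating_product (artin_monoid I M) k y x = artin_class I M (alternating_concat k (V j) (V i))" for k
    unfolding x y using alternating_product_class V_I ij by metis+
  have neq: "x \<noteq> y"
  proof
    assume "x = y"
    then have "(V i, V j) \<in> artin_cong I M" unfolding x y using word_class_eq_iff V_I ij by metis
    then have eq: "set (V i) = set (V j)" using artin_cong_length_set[OF cox] by blast
    have "set (V i) \<subseteq> K i" "set (V j) \<subseteq> K j" using V_K ij by blast+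
    moreover have "K i \<inter> K j = {}" using disjoint ij by (auto simp: disjoint_family_on_def)
    ultimately have "set (V i) \<subseteq> {}" using eq by (metis Int_greatest)
    then have "V i = []" "V j = []" using eq by simp_all
    then show False using V_nonempty[OF ij(1)] V_nonempty[OF ij(2)] ne by blast
  qed
  have "(V i @ V j, V j @ V i) \<in> artin_cong I M"
  proof (rule commuting_words[OF V_I[OF ij(1)] V_I[OF ij(2)]])
    fix a b assume "a \<in> set (V i)" "b \<in> set (V j)"
    then have ab: "a \<in> K i" "b \<in> K j" using V_K ij by blast+
    then have "a \<in> I" "b \<in> I" "a \<noteq> b" using K_sub K_unique ij by blast+
    then show "([a, b], [b, a]) \<in> artin_cong I M" using M2[OF ab] by (rule artin_commute)
  qed
  then have "2 \<in> B" unfolding B_def braid_exponents_def prod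
    using artin_class_eqI by (simp add: alternating_concat_numeral)
  moreover have "2 \<le> k" if "k \<in> B" for k
  proof -
    have "k \<noteq> 1"
    proof
      assume "k = 1"
      then have "alternating_product (artin_monoid I M) 1 x y = alternating_product (artin_monoid I M) 1 y x"
        using that by (simp add: B_def braid_exponents_def)
      then show False using neq unfolding prod by (simp add: x y)
    qed
    moreover have "0 < k" using that by (simp add: B_def braid_exponents_def)
    ultimately show ?thesis by simp
  qed
  ultimately have "(LEAST k. k \<in> B) = 2" by (rule Least_equality)
  moreover have "M' i j = enat (LEAST k. k \<in> B)"
    using optimal ij neq \<open>2 \<in> B\<close> unfolding optimal_hom_def Let_def B_def x_def y_def by blast
  ultimately show ?thesis by (simp add: numeral_eq_enat)
qed

text \<open>An empty class is \<open>non_adjacent\<close> to every nonempty one, so emptiness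
  spreads along the edges of the connected source, until nothing covers \<open>I\<close>.\<close>

lemma K_nonempty:
  assumes "i \<in> I'"
  shows "K i \<noteq> {}"
proof
  assume empty: "K i = {}"
  have "K j = {}" if "j \<in> I'" for j
  proof -
    have "(i, j) \<in> (coxeter_graph I' M')\<^sup>*" using irr' assms that by (simp add: irreducible_coxeter_def)
    then show ?thesis
    proof induction
      case (step y z)
      then have yz: "y \<in> I'" "z \<in> I'" "y \<noteq> z" "3 \<le> M' y z" by (auto simp: coxeter_graph_def)
      show ?case
      proof (rule ccontr)
        assume "K z \<noteq> {}"
        then have "M' y z = 2" using non_adjacent[OF yz(1-3)] step.IH by blast
        then show False using yz(4) by simp
      qed
    qed (rule empty)
  qed
  then show False using cover I_nonempty by blast
qed

lemma edge_ex:
  assumes "i \<in> I'" "j \<in> I'" "i \<noteq> j" "3 \<le> M' i j"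
  shows "\<exists>a\<in>K i. \<exists>b\<in>K j. a \<noteq> b \<and> M a b \<noteq> 2"
proof (rule ccontr)
  assume no: "\<not> ?thesis"
  have "a \<noteq> b" if "a \<in> K i" "b \<in> K j" for a b using that K_unique assms by blast
  then have "M' i j = 2" using no by (intro non_adjacent assms(1-3)) (use K_nonempty[OF assms(1)] in blast)+
  then show False using assms(4) by simp
qed

lemma V_relation:
  assumes "i \<in> I'" "j \<in> I'" "i \<noteq> j" "M' i j = enat m"
  shows "(alternating_concat m (V i) (V j), alternating_concat m (V j) (V i)) \<in> artin_cong I M"
  by (rule hom_relation[OF hom V_I V_hom assms])

end

lemma alternating_concat_map: "map f (alternating_concat m u v) = alternating_concat m (map f u) (map f v)"
  by (induction m arbitrary: u v) auto

section \<open>Targets of types A and B as families of reversals\<close>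

locale setup_A = standard_setup I' M' I M \<Phi> K V + labelled_A I M n \<iota>
  for I' :: "'a set" and M' and I :: "'b set" and M and \<Phi> and K and V and n and \<iota> +
  assumes V_rising: "i \<in> I' \<Longrightarrow> rising id (map \<iota> (V i))"
    and V_descent: "i \<in> I' \<Longrightarrow> b \<in> K i \<Longrightarrow> perm (map \<iota> (V i)) (Suc (\<iota> b)) < perm (map \<iota> (V i)) (\<iota> b)"
begin

sublocale fam: reversal_family I' M' n "\<lambda>i. \<iota> ` K i" "\<lambda>i. map \<iota> (V i)"
proof
  show "\<iota> ` K i \<noteq> {}" if "i \<in> I'" for i using K_nonempty[OF that] by blast
  show "disjoint_family_on (\<lambda>i. \<iota> ` K i) I'"
    unfolding disjoint_family_on_def
  proof (intro ballI impI)
    fix i j assume ij: "i \<in> I'" "j \<in> I'" "i \<noteq> j"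
    show "\<iota> ` K i \<inter> \<iota> ` K j = {}"
    proof (rule ccontr)
      assume "\<iota> ` K i \<inter> \<iota> ` K j \<noteq> {}"
      then obtain a b where ab: "a \<in> K i" "b \<in> K j" "\<iota> a = \<iota> b" by blast
      then have "a = b" using label_eq_iff K_sub ij by blast
      then show False using ab K_unique ij by blast
    qed
  qed
  have "(\<Union>i\<in>I'. \<iota> ` K i) = \<iota> ` (\<Union>i\<in>I'. K i)" by blast
  then show "(\<Union>i\<in>I'. \<iota> ` K i) = {1..n}" unfolding cover using bij by (simp add: bij_betw_def)
  show "map \<iota> (V i) \<in> lists (\<iota> ` K i)" if "i \<in> I'" for i using V_K[OF that] by auto
  show "(alternating_concat m (map \<iota> (V i)) (map \<iota> (V j)), alternating_concat m (map \<iota> (V j)) (map \<iota> (V i)))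
      \<in> acong_A n" if "i \<in> I'" "j \<in> I'" "i \<noteq> j" "M' i j = enat m" for i j m
    using acong_A_map[OF V_relation[OF that]] by (simp only: alternating_concat_map)
  fix i j assume ij: "i \<in> I'" "j \<in> I'" "i \<noteq> j" "3 \<le> M' i j"
  then obtain a b where ab: "a \<in> K i" "b \<in> K j" "a \<noteq> b" "M a b \<noteq> 2" using edge_ex by blast
  then have abI: "a \<in> I" "b \<in> I" using K_sub ij by blast+
  from abI ab(3) have "\<iota> b = Suc (\<iota> a) \<or> \<iota> a = Suc (\<iota> b)"
  proof (cases rule: label_cases)
    case 3
    then show ?thesis using ab(4) by (simp add: numeral_eq_enat)
  qed simp_all
  then show "\<exists>x\<in>\<iota> ` K i. \<exists>y\<in>\<iota> ` K j. y = Suc x \<or> x = Suc y" using ab by blast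
next
  show "rising id (map \<iota> (V i))" if "i \<in> I'" for i using V_rising[OF that] .
  show "perm (map \<iota> (V i)) (Suc x) < perm (map \<iota> (V i)) x" if "i \<in> I'" "x \<in> \<iota> ` K i" for i x
    using V_descent that by blast
qed (rule cox' irr' fin' card')+

lemma in_K_iff: "i \<in> I' \<Longrightarrow> b \<in> I \<Longrightarrow> b \<in> K i \<longleftrightarrow> fam.col (\<iota> b) = i"
proof -
  assume i: "i \<in> I'" and b: "b \<in> I"
  have "b \<in> K i \<longleftrightarrow> \<iota> b \<in> \<iota> ` K i"
    using label_eq_iff[OF b] K_sub[OF i] by blast
  then show ?thesis using fam.in_K_iff[OF i, of "\<iota> b"] label_range[OF b] by simp
qed

end

locale setup_B = standard_setup I' M' I M \<Phi> K V + labelled_B I M r "2 * r" \<iota>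
  for I' :: "'a set" and M' and I :: "'b set" and M and \<Phi> and K and V and r and \<iota> +
  assumes V_red: "i \<in> I' \<Longrightarrow> red (V i)"
    and V_descent: "i \<in> I' \<Longrightarrow> b \<in> K i \<Longrightarrow> \<not> basc (state (V i)) b"
begin

lemma set_unfold_letter: "1 \<le> i \<Longrightarrow> i \<le> r \<Longrightarrow> set (unfold_letter r (2 * r) i) = {i, 2 * r - i}"
  by (auto simp: unfold_letter_def)

lemma mem_unfold_set:
  assumes "J \<subseteq> I"
  shows "x \<in> unfold_set J \<longleftrightarrow> (\<exists>b\<in>J. x = \<iota> b \<or> x = 2 * r - \<iota> b)"
proof -
  have "x \<in> set (unfold_letter r (2 * r) (\<iota> b)) \<longleftrightarrow> x = \<iota> b \<or> x = 2 * r - \<iota> b" if "b \<in> J" for b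
    using set_unfold_letter[of "\<iota> b"] label_range[of b] that assms by blast
  then show ?thesis unfolding unfold_set_def by blast
qed

sublocale fam: reversal_family I' M' "2 * r - 1" "\<lambda>i. unfold_set (K i)" "\<lambda>i. unf (V i)"
proof
  show "unfold_set (K i) \<noteq> {}" if "i \<in> I'" for i
    using K_nonempty[OF that] mem_unfold_set[OF K_sub[OF that]] by blast
  show "disjoint_family_on (\<lambda>i. unfold_set (K i)) I'"
    unfolding disjoint_family_on_def
  proof (intro ballI impI)
    fix i j assume ij: "i \<in> I'" "j \<in> I'" "i \<noteq> j"
    show "unfold_set (K i) \<inter> unfold_set (K j) = {}"
    proof (rule ccontr)
      assume "unfold_set (K i) \<inter> unfold_set (K j) \<noteq> {}"
      then obtain x where "x \<in> unfold_set (K i)" "x \<in> unfold_set (K j)" by blast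
      then obtain a b where ab: "a \<in> K i" "b \<in> K j" "x = \<iota> a \<or> x = 2 * r - \<iota> a" "x = \<iota> b \<or> x = 2 * r - \<iota> b"
        using mem_unfold_set[OF K_sub[OF ij(1)]] mem_unfold_set[OF K_sub[OF ij(2)]] by blast
      then have abI: "a \<in> I" "b \<in> I" using K_sub ij by blast+
      have "\<iota> a = \<iota> b" using ab(3,4) label_range[OF abI(1)] label_range[OF abI(2)] by linarith
      then have "a = b" using label_eq_iff abI by blast
      then show False using ab K_unique ij by blast
    qed
  qed
  show "(\<Union>i\<in>I'. unfold_set (K i)) = {1..2 * r - 1}"
  proof
    show "(\<Union>i\<in>I'. unfold_set (K i)) \<subseteq> {1..2 * r - 1}"
      using unfold_set_sub K_sub by blast
    show "{1..2 * r - 1} \<subseteq> (\<Union>i\<in>I'. unfold_set (K i))"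
    proof
      fix x assume x: "x \<in> {1..2 * r - 1}"
      define y where "y = (if x \<le> r then x else 2 * r - x)"
      have y: "y \<in> {1..r}" "x = y \<or> x = 2 * r - y" using x by (auto simp: y_def)
      have "y \<in> \<iota> ` I" using y(1) bij by (simp add: bij_betw_def)
      then obtain b where "b \<in> I" "y = \<iota> b" by blast
      then have b: "b \<in> I" "x = \<iota> b \<or> x = 2 * r - \<iota> b" using y(2) by simp_all
      then obtain i where "i \<in> I'" "b \<in> K i" using cover by blast
      then show "x \<in> (\<Union>i\<in>I'. unfold_set (K i))" using b mem_unfold_set[OF K_sub] by blast
    qed
  qed
  show "unf (V i) \<in> lists (unfold_set (K i))" if "i \<in> I'" for i by (rule unf_unfold_set[OF V_K[OF that]])
  show "rising id (unf (V i))" if "i \<in> I'" for i using V_I[OF that] V_red[OF that] by (rule rising_unf)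
  show "perm (unf (V i)) (Suc x) < perm (unf (V i)) x" if "i \<in> I'" "x \<in> unfold_set (K i)" for i x
    using unf_descent[OF K_sub[OF that(1)] V_K[OF that(1)] V_red[OF that(1)] V_descent[OF that(1)] that(2)] .
  show "(alternating_concat m (unf (V i)) (unf (V j)), alternating_concat m (unf (V j)) (unf (V i)))
      \<in> acong_A (2 * r - 1)" if "i \<in> I'" "j \<in> I'" "i \<noteq> j" "M' i j = enat m" for i j m
    using acong_A_unf[OF V_relation[OF that]] by (simp only: subst_alternating_concat)
  fix i j assume ij: "i \<in> I'" "j \<in> I'" "i \<noteq> j" "3 \<le> M' i j"
  then obtain a b where ab: "a \<in> K i" "b \<in> K j" "a \<noteq> b" "M a b \<noteq> 2" using edge_ex by blast
  then have abI: "a \<in> I" "b \<in> I" using K_sub ij by blast+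
  from abI ab(3) have "\<iota> b = Suc (\<iota> a) \<or> \<iota> a = Suc (\<iota> b)"
  proof (cases rule: label_cases)
    case 5
    then show ?thesis using ab(4) by (simp add: numeral_eq_enat)
  next
    case 6
    then show ?thesis using ab(4) by (simp add: numeral_eq_enat)
  qed simp_all
  moreover have "\<iota> a \<in> unfold_set (K i)" "\<iota> b \<in> unfold_set (K j)"
    using mem_unfold_set[OF K_sub] ij ab by blast+
  ultimately show "\<exists>x\<in>unfold_set (K i). \<exists>y\<in>unfold_set (K j). y = Suc x \<or> x = Suc y" by blast
qed (rule cox' irr' fin' card')+

lemma in_K_iff:
  assumes "i \<in> I'" "b \<in> I"
  shows "b \<in> K i \<longleftrightarrow> fam.col (\<iota> b) = i"
proof -
  have b: "1 \<le> \<iota> b" "\<iota> b \<le> r" using label_range[OF assms(2)] by auto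
  have "b \<in> K i" if h: "\<iota> b \<in> unfold_set (K i)"
  proof -
    obtain a where a: "a \<in> K i" "\<iota> b = \<iota> a \<or> \<iota> b = 2 * r - \<iota> a"
      using h unfolding mem_unfold_set[OF K_sub[OF assms(1)]] by blast
    have aI: "a \<in> I" using a(1) K_sub[OF assms(1)] by (rule subsetD[rotated])
    have "\<iota> a = \<iota> b" using a(2) b label_range[OF aI] by linarith
    then show ?thesis using label_eq_iff[OF aI assms(2)] a(1) by simp
  qed
  moreover have "\<iota> b \<in> unfold_set (K i)" if "b \<in> K i"
    unfolding mem_unfold_set[OF K_sub[OF assms(1)]] using that by blast
  moreover have "\<iota> b \<in> unfold_set (K i) \<longleftrightarrow> fam.col (\<iota> b) = i"
    unfolding fam.in_K_iff[OF assms(1)] using b r by auto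
  ultimately show ?thesis by blast
qed

lemma col_mirror: "b \<in> I \<Longrightarrow> fam.col (2 * r - \<iota> b) = fam.col (\<iota> b)"
proof -
  assume b: "b \<in> I"
  then obtain i where i: "i \<in> I'" "b \<in> K i" using cover by blast
  have "\<iota> b \<in> unfold_set (K i)" "2 * r - \<iota> b \<in> unfold_set (K i)"
    unfolding mem_unfold_set[OF K_sub[OF i(1)]] using i(2) by blast+
  then show ?thesis using fam.col_eq[OF i(1)] by simp
qed

text \<open>The outer nodes 1 and \<open>2 * r - 1\<close> of the unfolded diagram are mirror images
  and share their colour.\<close>

lemma not_bijective: "\<not> fam.bijective"
proof
  assume "fam.bijective"
  then have inj: "inj_on fam.col {1..2 * r - 1}" unfolding fam.bijective_def by blast
  have "1 \<in> \<iota> ` I" using bij r by (simp add: bij_betw_def)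
  then obtain b where "b \<in> I" "\<iota> b = 1" by (metis imageE)
  then have "fam.col (2 * r - 1) = fam.col 1" using col_mirror[of b] by simp
  then have "2 * r - 1 = 1" using inj_onD[OF inj, of "2 * r - 1" 1] r by simp
  then show False using r by simp
qed

end

section \<open>Explicit longest words of type B\<close>

context labelled_B
begin

text \<open>\<open>w\<close> is increasing on the strands touched by labels at least
  \<open>k\<close>, so it is of minimal length in its coset of the corresponding parabolic subgroup,
  and reduced words of that subgroup can be appended.\<close>

lemma red_from_increasing:
  assumes w: "w \<in> bstates" and k: "1 \<le> k" "k \<le> r"
    and inc: "\<And>x y. k \<le> x \<Longrightarrow> x < y \<Longrightarrow> y \<le> Suc N - k \<Longrightarrow> w x < w y"
    and v: "v \<in> lists I" "red v" "\<And>b. b \<in> set v \<Longrightarrow> k \<le> \<iota> b"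
  shows "red_from w v"
  using v
proof (induction v rule: rev_induct)
  case (snoc b v)
  have b: "b \<in> I" "v \<in> lists I" "k \<le> \<iota> b" "\<And>b. b \<in> set v \<Longrightarrow> k \<le> \<iota> b" using snoc.prems by auto
  have rv: "red v" "basc (state v) b" using snoc.prems(2) unfolding red_from_append red_from.simps by blast+
  have IH: "red_from w v" using snoc.IH b rv by blast
  have rb: "\<iota> b \<le> r" "1 \<le> \<iota> b" using label_range[OF b(1)] by auto
  define J where "J = {k..N - k}"
  have letters: "unfold_letter r N (\<iota> c) \<in> lists J" if "c \<in> set v" for c
  proof -
    have "c \<in> I" using that b(2) by auto
    then have "k \<le> \<iota> c" "\<iota> c \<le> r" using b(4)[OF that] label_range[of c] by auto
    then show ?thesis using N k by (auto simp: unfold_letter_def J_def)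
  qed
  have u: "unf v \<in> lists J"
    by (rule subst_in_lists[of "set v"]) (use letters in auto)
  have "k - 1 \<notin> J" "Suc N - k \<notin> J" using k N by (auto simp: J_def)
  then have cut: "perm (unf v) x \<le> k - 1 \<longleftrightarrow> x \<le> k - 1" "perm (unf v) x \<le> Suc N - k \<longleftrightarrow> x \<le> Suc N - k" for x
    using perm_cut[OF u] by blast+
  have st: "state v = perm (unf v)" using state_unf[OF b(2) rv(1)] .
  define y where "y = (if \<iota> b = r then Suc N - r else Suc (\<iota> b))"
  have y: "k \<le> y" "y \<le> Suc N - k" "k \<le> \<iota> b" "\<iota> b \<le> Suc N - k"
    using b(3) rb k N by (auto simp: y_def)
  have "state v (\<iota> b) < state v y" using rv(2) by (simp add: y_def)
  moreover have "k \<le> state v (\<iota> b)" "state v y \<le> Suc N - k"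
    unfolding st using cut(1)[of "\<iota> b"] cut(2)[of y] y k by linarith+
  ultimately have "w (state v (\<iota> b)) < w (state v y)" using inc by blast
  moreover have "foldl bact w v = w \<circ> state v"
    unfolding st using red_from_unf[OF w b(2) IH] by blast
  ultimately have "basc (foldl bact w v) b" unfolding y_def by (simp only: comp_apply)
  then show ?case using IH unfolding red_from_append red_from.simps by blast
next
  case Nil
  show ?case unfolding red_from.simps by blast
qed

end

text \<open>In signed permutations, the sign change of the coordinate \<open>k\<close>.\<close>

definition cword :: "nat \<Rightarrow> nat \<Rightarrow> nat list" where
  "cword r k = [k..<r] @ [r] @ rev [k..<r]"

text \<open>The product of the sign changes of the coordinates \<open>m..r\<close>: minus the
  identity on them, which is the longest element.\<close>

definition dword :: "nat \<Rightarrow> nat \<Rightarrow> nat list" where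
  "dword r m = concat (map (cword r) [m..<Suc r])"

lemma cword_top: "cword r r = [r]" by (simp add: cword_def)

lemma cword_step: "k < r \<Longrightarrow> cword r k = [k] @ cword r (Suc k) @ [k]"
  by (simp add: cword_def upt_conv_Cons)

lemma set_cword: "k \<le> r \<Longrightarrow> set (cword r k) = {k..r}"
  by (auto simp: cword_def)

lemma dword_top: "dword r (Suc r) = []" by (simp add: dword_def)

lemma dword_step: "k \<le> r \<Longrightarrow> dword r k = cword r k @ dword r (Suc k)"
  by (simp add: dword_def upt_conv_Cons del: upt_Suc)

lemma set_dword: "m \<le> r \<Longrightarrow> set (dword r m) \<subseteq> {m..r}"
  by (auto simp: dword_def set_cword simp del: upt_Suc)

lemma coxeter_matrix_B: "2 \<le> r \<Longrightarrow> coxeter_matrix {1..r} (matrix_B r)"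
  by (auto simp: coxeter_matrix_def matrix_B_def numeral_eq_enat one_enat_def insert_commute)

locale labelled_B_nat =
  fixes r N :: nat
  assumes r2: "2 \<le> r" and NN: "N = 2 * r \<or> N = Suc (2 * r)"
begin

sublocale labelled_B "{1..r}" "matrix_B r" r N "\<lambda>x. x"
proof
  show "coxeter_matrix {1..r} (matrix_B r)" using r2 by (rule coxeter_matrix_B)
  show "bij_betw (\<lambda>x. x) {1..r} {1..r}" by (simp add: bij_betw_def inj_on_def)
qed (use r2 NN in auto)

lemma cword_lists: "1 \<le> k \<Longrightarrow> k \<le> r \<Longrightarrow> cword r k \<in> lists {1..r}"
  using set_cword[of k r] by auto

lemma dword_lists: "1 \<le> m \<Longrightarrow> m \<le> Suc r \<Longrightarrow> dword r m \<in> lists {1..r}"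
  using set_dword[of m r] dword_top[of r] by (cases "m = Suc r") auto

text \<open>Downward induction on \<open>k\<close>: the flip of \<open>k\<close> is increasing on
  the strands that the inner word moves, and conjugation by it turns the swap of
  \<open>Suc k\<close> and its mirror image into that of \<open>k\<close>.\<close>

lemma cword_red:
  assumes "1 \<le> k" "k \<le> r"
  shows "red (cword r k) \<and> state (cword r k) = transpose k (Suc N - k)"
  using assms(2,1)
proof (induction k rule: inc_induct)
  case base
  have "basc id r" using asc_e[of r] r2 by simp
  moreover have "id \<circ> flip r N r = transpose r (Suc N - r)" by (simp add: flip_def)
  ultimately show ?case unfolding cword_top red_from.simps foldl.simps by blast
next
  case (step k)
  define z where "z = N - k"
  have z: "N - k = z" "Suc N - k = Suc z" "Suc N - Suc k = z" "Suc k < z" "k < r" "Suc z \<le> N"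
    using step.hyps step.prems NN by (auto simp: z_def)
  have fk: "flip r N k = adj k \<circ> adj z" using z by (simp add: flip_def)
  have "1 \<le> Suc k" by simp
  note IH' = step.IH[OF this]
  have IH: "red (cword r (Suc k))" "state (cword r (Suc k)) = transpose (Suc k) z"
    using IH' unfolding z(3) by blast+
  have kI: "k \<in> {1..r}" using step.prems z by simp
  have fS: "flip r N k \<in> bstates" using act_in_S[OF e_in_S kI] unfolding id_comp .
  have rk: "red ([k] @ v) \<longleftrightarrow> red_from (flip r N k) v" for v
    unfolding red_from_append red_from.simps foldl.simps id_comp using asc_e[OF kI] by blast
  have sk: "state ([k] @ v) = foldl bact (flip r N k) v" for v
    unfolding foldl_append foldl.simps id_comp by (rule HOL.refl)
  have c: "red_from (flip r N k) (cword r (Suc k))"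
  proof (rule red_from_increasing[OF fS, of "Suc k"])
    show "1 \<le> Suc k" "Suc k \<le> r" using z by auto
    show "cword r (Suc k) \<in> lists {1..r}" using cword_lists[of "Suc k"] z by simp
    show "red (cword r (Suc k))" by (rule IH)
    show "Suc k \<le> b" if "b \<in> set (cword r (Suc k))" for b using that set_cword[of "Suc k" r] z by simp
    fix x y assume xy: "Suc k \<le> x" "x < y" "y \<le> Suc N - Suc k"
    have val: "flip r N k x = (if x = Suc k then k else if x = z then Suc z else x)"
      if "Suc k \<le> x" "x \<le> z" for x using that z(4) unfolding fk by simp
    show "flip r N k x < flip r N k y" using xy z(3,4) val[of x] val[of y] by simp
  qed
  have s1: "state ([k] @ cword r (Suc k)) = flip r N k \<circ> transpose (Suc k) z"
  proof -
    have cl: "cword r (Suc k) \<in> lists {1..r}" using cword_lists[of "Suc k"] z(5) by simp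
    have "foldl bact (flip r N k) (cword r (Suc k)) = flip r N k \<circ> state (cword r (Suc k))"
      unfolding state_unf[OF cl IH(1)] using red_from_unf[OF fS cl c] by blast
    then show ?thesis unfolding sk IH(2) .
  qed
  have rc: "red ([k] @ cword r (Suc k))" unfolding rk by (rule c)
  have "basc (state ([k] @ cword r (Suc k))) k"
    unfolding s1 fk using z(4,5) by simp
  then have red: "red (cword r k)"
    unfolding cword_step[OF z(5)] append_assoc[symmetric] red_from_append[of _ "[k] @ cword r (Suc k)"] red_from.simps
    using rc by blast
  have "state (cword r k) = state ([k] @ cword r (Suc k)) \<circ> flip r N k"
    unfolding cword_step[OF z(5)] append_assoc[symmetric] foldl_append[of _ _ "[k] @ cword r (Suc k)"] foldl.simps
    by (rule HOL.refl)
  also have "\<dots> = transpose k (Suc z)"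
    unfolding s1 fk
  proof
    fix x
    consider "x = k" | "x = Suc k" | "x = z" | "x = Suc z" | "x \<noteq> k" "x \<noteq> Suc k" "x \<noteq> z" "x \<noteq> Suc z" by blast
    then show "((adj k \<circ> adj z) \<circ> transpose (Suc k) z \<circ> (adj k \<circ> adj z)) x = transpose k (Suc z) x"
      using z(4) by cases simp_all
  qed
  finally show ?case using red unfolding z(2) by blast
qed

text \<open>The sign change of \<open>m\<close> is the identity strictly between \<open>m\<close>
  and its mirror image, so the inner word can be appended and stays reduced. On the middle strand of
  odd \<open>N\<close> both branches of the formula agree.\<close>

lemma dword_red:
  assumes "1 \<le> m" "m \<le> Suc r"
  shows "red (dword r m) \<and> (\<forall>x. state (dword r m) x =
    (if m \<le> x \<and> x \<le> Suc N - m \<and> (x \<le> r \<or> Suc N - r \<le> x) then Suc N - x else x))"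
  using assms(2,1)
proof (induction m rule: inc_induct)
  case base
  have "state (dword r (Suc r)) x =
    (if Suc r \<le> x \<and> x \<le> Suc N - Suc r \<and> (x \<le> r \<or> Suc N - r \<le> x) then Suc N - x else x)" for x
    using NN by (auto simp: dword_top)
  then show ?case unfolding dword_top red_from.simps by blast
next
  case (step m)
  then have m: "1 \<le> m" "m \<le> r" by auto
  have "1 \<le> Suc m" by simp
  note IH' = step.IH[OF this]
  have IH1: "red (dword r (Suc m))" using IH' by (rule conjunct1)
  have IH2: "state (dword r (Suc m)) x =
    (if Suc m \<le> x \<and> x \<le> Suc N - Suc m \<and> (x \<le> r \<or> Suc N - r \<le> x) then Suc N - x else x)" for x
    using IH'[THEN conjunct2] by (rule spec)
  note IH = IH1 IH2
  have cl: "cword r m \<in> lists {1..r}" and dl: "dword r (Suc m) \<in> lists {1..r}"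
    using cword_lists dword_lists m by auto
  have c: "red (cword r m)" "state (cword r m) = transpose m (Suc N - m)" using cword_red m by blast+
  have cS: "state (cword r m) \<in> bstates" by (rule foldl_act_in_S[OF e_in_S cl])
  have d: "red_from (state (cword r m)) (dword r (Suc m))"
  proof (cases "m = r")
    case True
    show ?thesis unfolding True dword_top red_from.simps by blast
  next
    case False
    show ?thesis
    proof (rule red_from_increasing[OF cS, of "Suc m"])
      show "1 \<le> Suc m" "Suc m \<le> r" using m False by auto
      show "dword r (Suc m) \<in> lists {1..r}" by (rule dl)
      show "red (dword r (Suc m))" by (rule IH)
      show "Suc m \<le> b" if "b \<in> set (dword r (Suc m))" for b
        using that set_dword[of "Suc m" r] m False by auto
      fix x y assume xy: "Suc m \<le> x" "x < y" "y \<le> Suc N - Suc m"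
      then have "x \<noteq> m" "x \<noteq> Suc N - m" "y \<noteq> m" "y \<noteq> Suc N - m" using m NN by auto
      then show "state (cword r m) x < state (cword r m) y" unfolding c(2) using xy by simp
    qed
  qed
  have red: "red (dword r m)" unfolding dword_step[OF m(2)] red_from_append using c d by blast
  have comp: "state (dword r m) = transpose m (Suc N - m) \<circ> state (dword r (Suc m))"
  proof -
    have "foldl bact (state (cword r m)) (dword r (Suc m)) = state (cword r m) \<circ> state (dword r (Suc m))"
      unfolding state_unf[OF dl IH(1)] using red_from_unf[OF cS dl d] by blast
    then show ?thesis unfolding dword_step[OF m(2)] foldl_append c(2) .
  qed
  have "state (dword r m) x =
    (if m \<le> x \<and> x \<le> Suc N - m \<and> (x \<le> r \<or> Suc N - r \<le> x) then Suc N - x else x)" for x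
  proof -
    have mN: "m < Suc N - m" "m \<le> N" using m NN by auto
    consider "x = m" | "x = Suc N - m" | "Suc m \<le> x" "x \<le> Suc N - Suc m" | "x < m \<or> Suc N - m < x"
      by linarith
    then show ?thesis
    proof cases
      case 1
      then have "state (dword r (Suc m)) x = x" using IH(2)[of x] by simp
      then show ?thesis unfolding comp using 1 m mN by simp
    next
      case 2
      then have "\<not> x \<le> Suc N - Suc m" using mN by simp
      then have "state (dword r (Suc m)) x = x" using IH(2)[of x] by simp
      moreover have "Suc N - r \<le> x" "Suc N - x = m" using 2 m mN by auto
      ultimately show ?thesis unfolding comp using 2 mN by simp
    next
      case 3
      define v where "v = state (dword r (Suc m)) x"
      have v: "v = (if x \<le> r \<or> Suc N - r \<le> x then Suc N - x else x)" using IH(2)[of x] 3 by (simp add: v_def)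
      have "v \<noteq> m" "v \<noteq> Suc N - m" unfolding v using 3 mN by auto
      then have "state (dword r m) x = v" unfolding comp by (simp add: v_def)
      moreover have "m \<le> x" "x \<le> Suc N - m" using 3 by auto
      ultimately show ?thesis using v by simp
    next
      case 4
      then have n: "\<not> (Suc m \<le> x \<and> x \<le> Suc N - Suc m \<and> (x \<le> r \<or> Suc N - r \<le> x))" by auto
      have "state (dword r (Suc m)) x = x" unfolding IH(2)[of x] using n by (rule if_not_P)
      moreover have "x \<noteq> m" "x \<noteq> Suc N - m" using 4 mN by auto
      ultimately have e: "state (dword r m) x = x" unfolding comp by simp
      have n': "\<not> (m \<le> x \<and> x \<le> Suc N - m \<and> (x \<le> r \<or> Suc N - r \<le> x))" using 4 by auto
      show ?thesis unfolding if_not_P[OF n'] by (rule e)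
    qed
  qed
  then show ?case using red by blast
qed

lemma dword_reversal:
  assumes "1 \<le> m" "m \<le> r" "m \<le> x" "x \<le> Suc N - m"
  shows "state (dword r m) x = Suc N - x"
proof (cases "x \<le> r \<or> Suc N - r \<le> x")
  case True
  then show ?thesis using dword_red[of m] assms by simp
next
  case False
  then have "x = Suc r" "N = Suc (2 * r)" using NN by auto
  then show ?thesis using dword_red[of m] assms False by simp
qed

lemma dword_descent:
  assumes "1 \<le> m" "m \<le> r" "b \<in> {m..r}"
  shows "\<not> basc (state (dword r m)) b"
proof -
  define y where "y = (if b = r then Suc N - r else Suc b)"
  have "m \<le> y" "y \<le> Suc N - m" "b \<le> y" "b \<le> Suc N - m" using assms NN by (auto simp: y_def)
  then have "state (dword r m) b = Suc N - b" "state (dword r m) y = Suc N - y"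
    using dword_reversal assms by auto
  then have "\<not> state (dword r m) b < state (dword r m) y" using \<open>b \<le> y\<close> by simp
  then show ?thesis by (simp add: y_def)
qed

text \<open>By Matsumoto's theorem a class is determined by its state, a permutation of a finite
  set.\<close>

lemma finite_parabolic:
  assumes "J \<subseteq> {1..r}"
  shows "finite (parabolic {1..r} (matrix_B r) J)"
proof -
  let ?c = "word_class {1..r} (coxeter_relations {1..r} (matrix_B r))"
  define word where "word w u \<longleftrightarrow> u \<in> lists {1..r} \<and> red u \<and> state u = w" for w u
  define g where "g w = ?c (Eps (word w))" for w
  have "parabolic {1..r} (matrix_B r) J \<subseteq> g ` {w. w permutes {1..N}}"
    unfolding parabolic_eq[OF assms]
  proof (rule image_subsetI)
    fix u assume "u \<in> lists J"
    then have uI: "u \<in> lists {1..r}" using assms by auto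
    then obtain v where v: "v \<in> lists {1..r}" "red v" "(u, v) \<in> ccong" using reduce[of u "{1..r}"] by auto
    define t where "t = Eps (word (state v))"
    have "word (state v) v" unfolding word_def using v by blast
    then have "word (state v) t" unfolding t_def by (rule someI)
    then have t: "t \<in> lists {1..r}" "red t" "state t = state v" unfolding word_def by blast+
    have "(v, t) \<in> acong" by (rule matsumoto[OF v(1) t(1) v(2) t(2) t(3)[symmetric]])
    then have "(v, t) \<in> ccong" by (rule artin_cong_imp_coxeter_cong[OF coxeter])
    then have "(u, t) \<in> ccong" by (rule word_cong.trans[OF v(3)])
    then have "?c u = g (state v)"
      unfolding g_def t_def[symmetric] using word_class_eq_iff[OF uI t(1)] by simp
    moreover have "state v \<in> {w. w permutes {1..N}}" using foldl_act_in_S[OF e_in_S v(1)] by blast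
    ultimately show "?c u \<in> g ` {w. w permutes {1..N}}" by blast
  qed
  moreover have "finite {w. w permutes {1..N}}" by (rule finite_permutations) simp
  ultimately show ?thesis using finite_surj by blast
qed

lemma artin_lift_dword:
  assumes "1 \<le> m" "m \<le> r"
  shows "artin_lift {1..r} (matrix_B r) (longest_element {1..r} (matrix_B r) {m..r})
    = artin_class {1..r} (matrix_B r) (dword r m)"
proof (rule artin_lift_longest)
  show J: "{m..r} \<subseteq> {1..r}" using assms by auto
  show "finite (parabolic {1..r} (matrix_B r) {m..r})" by (rule finite_parabolic[OF J])
  show "dword r m \<in> lists {m..r}" using set_dword[OF assms(2)] by auto
  show "red (dword r m)" using dword_red[of m] assms le_SucI by blast
qed (rule dword_descent[OF assms])

lemma letters_commute:
  assumes "1 \<le> i" "Suc i < j" "j \<le> r"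
  shows "([i, j], [j, i]) \<in> acong" "([j, i], [i, j]) \<in> acong"
proof -
  show "([i, j], [j, i]) \<in> acong"
    by (rule artin_commute) (use assms in \<open>simp_all add: matrix_B_entries numeral_eq_enat\<close>)
  then show "([j, i], [i, j]) \<in> acong" by (rule word_cong.sym)
qed

lemma context_step:
  assumes "(u, v) \<in> acong" "a \<in> lists {1..r}" "b \<in> lists {1..r}" "x = a @ u @ b" "y = a @ v @ b"
  shows "(x, y) \<in> acong"
  unfolding assms(4,5) by (rule word_cong_in_context[OF assms(1-3)])

text \<open>The sign change of the coordinate \<open>k\<close> commutes with the generators on later
  coordinates. As an identity of positive words this goes by induction on \<open>r - k\<close>,
  peeling off the outer letters \<open>k\<close>.\<close>

lemma cword_commutes_letter:
  assumes "1 \<le> k" "k < l" "l \<le> r"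
  shows "(cword r k @ [l], [l] @ cword r k) \<in> acong"
proof -
  have "k \<le> r \<Longrightarrow> 1 \<le> k \<Longrightarrow> \<forall>l. k < l \<and> l \<le> r \<longrightarrow> (cword r k @ [l], [l] @ cword r k) \<in> acong" for k
  proof (induction "r - k" arbitrary: k rule: less_induct)
    case less
    show ?case
    proof (intro allI impI)
      note [trans] = word_cong.trans
      fix l assume l: "k < l \<and> l \<le> r"
      have kr: "k < r" using l by simp
      let ?c = "cword r (Suc k)"
      have kI: "[k] \<in> lists {1..r}" and lI: "[l] \<in> lists {1..r}" using l less.prems by auto
      have cI: "?c \<in> lists {1..r}" using cword_lists[of "Suc k"] kr by simp
      consider "Suc k < l" | "l = Suc k" "l < r" | "l = Suc k" "l = r" using l by linarith
      then show "(cword r k @ [l], [l] @ cword r k) \<in> acong"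
      proof cases
        case 1
        have IH: "(?c @ [l], [l] @ ?c) \<in> acong" using less.hyps[of "Suc k"] kr 1 l by simp
        have kl: "([k, l], [l, k]) \<in> acong" using letters_commute less.prems 1 l by blast
        have "([k] @ ?c @ [k, l], [k] @ ?c @ [l, k]) \<in> acong"
          by (rule context_step[OF kl, of "[k] @ ?c" "[]"]) (use kI cI in \<open>simp_all del: in_lists_conv_set add: append_in_lists_conv\<close>)
        also have "([k] @ ?c @ [l, k], [k] @ [l] @ ?c @ [k]) \<in> acong"
          by (rule context_step[OF IH, of "[k]" "[k]"]) (use kI in simp_all)
        also have "([k] @ [l] @ ?c @ [k], [l] @ [k] @ ?c @ [k]) \<in> acong"
          by (rule context_step[OF kl, of "[]" "?c @ [k]"]) (use kI cI in \<open>simp_all del: in_lists_conv_set add: append_in_lists_conv\<close>)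
        finally show ?thesis unfolding cword_step[OF kr] by simp
      next
        case 2
        let ?d = "cword r (Suc l)"
        have dI: "?d \<in> lists {1..r}" using cword_lists[of "Suc l"] 2 by simp
        \<comment> \<open>With \<open>d = cword r (Suc l)\<close>, the word
          \<open>k l d l k l\<close> becomes \<open>k l d k l k\<close>, then
          \<open>k l k d l k\<close> since \<open>d\<close> commutes with \<open>k\<close>, then
          \<open>l k l d l k\<close>.\<close>
        have c: "?c = [l] @ ?d @ [l]" using cword_step[of l r] 2 by simp
        have "(alternating_word 3 k l, alternating_word 3 l k) \<in> acong"
          by (rule artin_relation) (use 2 less.prems in \<open>simp_all add: matrix_B_entries\<close>)
        then have br: "([k, l, k], [l, k, l]) \<in> acong" by (simp add: alternating_word_numeral)
        have dk: "(?d @ [k], [k] @ ?d) \<in> acong"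
        proof (rule commuting_words[OF dI kI])
          fix a b assume "a \<in> set ?d" "b \<in> set [k]"
          then have "Suc l \<le> a" "a \<le> r" "b = k" using set_cword[of "Suc l" r] 2 by auto
          then show "([a, b], [b, a]) \<in> acong" using letters_commute[of k a] 2 less.prems by simp
        qed
        have "([k, l] @ ?d @ [l, k, l], [k, l] @ ?d @ [k, l, k]) \<in> acong"
          by (rule context_step[OF word_cong.sym[OF br], of "[k, l] @ ?d" "[]"])
            (use kI lI dI in \<open>simp_all del: in_lists_conv_set add: append_in_lists_conv\<close>)
        also have "([k, l] @ ?d @ [k, l, k], [k, l] @ [k] @ ?d @ [l, k]) \<in> acong"
          by (rule context_step[OF dk, of "[k, l]" "[l, k]"]) (use kI lI in simp_all)
        also have "([k, l] @ [k] @ ?d @ [l, k], [l, k, l] @ ?d @ [l, k]) \<in> acong"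
          by (rule context_step[OF br, of "[]" "?d @ [l, k]"])
            (use kI lI dI in \<open>simp_all del: in_lists_conv_set add: append_in_lists_conv\<close>)
        finally show ?thesis unfolding cword_step[OF kr] c by simp
      next
        case 3
        \<comment> \<open>At the top the claim is the braid relation of length 4 itself.\<close>
        have "(alternating_word 4 k l, alternating_word 4 l k) \<in> acong"
        proof (rule artin_relation)
          have "k = r - 1" using 3 by simp
          then show "matrix_B r k l = enat 4" using matrix_B_entries(1)[OF r2] 3 by simp
        qed (use 3 less.prems in auto)
        moreover have "cword r k = [k, l, k]" using cword_step[OF kr] cword_top[of r] 3 by simp
        ultimately show ?thesis by (simp add: alternating_word_numeral)
      qed
    qed
  qed
  then show ?thesis using assms by simp
qed

lemma cword_commutes:
  assumes "1 \<le> k" "k \<le> r" "v \<in> lists {Suc k..r}"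
  shows "(cword r k @ v, v @ cword r k) \<in> acong"
proof (rule commuting_word_letters[OF cword_lists[OF assms(1,2)]])
  show "v \<in> lists {1..r}" using assms by auto
  show "(cword r k @ [b], [b] @ cword r k) \<in> acong" if "b \<in> set v" for b
    using assms that by (intro cword_commutes_letter) auto
qed

text \<open>Writing \<open>\<Delta> = c \<cdot> d\<close> with \<open>c = cword r (Suc p)\<close>, both sides become \<open>c' c d d\<close> for
  \<open>c' = p c p = cword r p\<close>.\<close>

lemma dword_braid:
  assumes "1 \<le> p" "Suc p \<le> r"
  defines "D \<equiv> dword r (Suc p)"
  shows "([p] @ D @ [p] @ D, D @ [p] @ D @ [p]) \<in> acong"
proof -
  define c d where "c = cword r (Suc p)" and "d = dword r (Suc (Suc p))"
  have D: "D = c @ d" unfolding D_def c_def d_def using dword_step[OF assms(2)] .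
  have pI: "[p] \<in> lists {1..r}" using assms by simp
  have cI: "c \<in> lists {1..r}" unfolding c_def using assms cword_lists by simp
  have dI: "d \<in> lists {1..r}" unfolding d_def using assms dword_lists by simp
  have dset: "d \<in> lists {Suc (Suc p)..r}"
  proof (cases "Suc p = r")
    case True
    then show ?thesis by (simp add: d_def dword_top)
  next
    case False
    then show ?thesis using set_dword[of "Suc (Suc p)" r] assms by (auto simp: d_def)
  qed
  have c': "cword r p = [p] @ c @ [p]" unfolding c_def using cword_step[of p r] assms by simp
  have dp: "(d @ [p], [p] @ d) \<in> acong"
  proof (rule commuting_words[OF dI pI])
    fix a b assume "a \<in> set d" "b \<in> set [p]"
    then have "Suc (Suc p) \<le> a" "a \<le> r" "b = p" using dset by auto
    then show "([a, b], [b, a]) \<in> acong" using letters_commute[of p a] assms by simp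
  qed
  have cd: "(c @ d, d @ c) \<in> acong" unfolding c_def by (rule cword_commutes) (use assms dset in auto)
  have c'd: "(cword r p @ d, d @ cword r p) \<in> acong"
    by (rule cword_commutes) (use assms dset in auto)
  have c'c: "(cword r p @ c, c @ cword r p) \<in> acong"
    by (rule cword_commutes) (use assms set_cword[of "Suc p" r] in \<open>auto simp: c_def\<close>)
  note ls = append_in_lists_conv
  note [trans] = word_cong.trans
  have "([p] @ (c @ d) @ [p] @ (c @ d), [p] @ c @ [p] @ d @ c @ d) \<in> acong"
    by (rule context_step[OF dp, of "[p] @ c" "c @ d"]) (use pI cI dI in \<open>simp_all add: ls del: in_lists_conv_set\<close>)
  also have "([p] @ c @ [p] @ d @ c @ d, [p] @ c @ [p] @ c @ d @ d) \<in> acong"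
    by (rule context_step[OF word_cong.sym[OF cd], of "[p] @ c @ [p]" d]) (use pI cI dI in \<open>simp_all add: ls del: in_lists_conv_set\<close>)
  also have "([p] @ c @ [p] @ c @ d @ d, c @ [p] @ c @ [p] @ d @ d) \<in> acong"
    by (rule context_step[OF c'c, of "[]" "d @ d"]) (use pI cI dI in \<open>simp_all add: ls c' del: in_lists_conv_set\<close>)
  also have "(c @ [p] @ c @ [p] @ d @ d, c @ d @ [p] @ c @ [p] @ d) \<in> acong"
    by (rule context_step[OF c'd, of c d]) (use pI cI dI in \<open>simp_all add: ls c' del: in_lists_conv_set\<close>)
  also have "(c @ d @ [p] @ c @ [p] @ d, (c @ d) @ [p] @ (c @ d) @ [p]) \<in> acong"
    by (rule context_step[OF word_cong.sym[OF dp], of "c @ d @ [p] @ c" "[]"]) (use pI cI dI in \<open>simp_all add: ls del: in_lists_conv_set\<close>)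
  finally show ?thesis unfolding D .
qed

end

context braid_model
begin

lemma red_single_letter:
  assumes "u \<in> lists {b}" "red u" "b \<in> I" "u \<noteq> []"
  shows "u = [b]"
proof -
  obtain u' where u: "u = b # u'" "u' \<in> lists {b}" using assms(1,4) by (cases u) auto
  have "u' = []"
  proof (rule ccontr)
    assume "u' \<noteq> []"
    then obtain v where "u' = b # v" using u(2) by (cases u') auto
    then have "asc e b" "asc (act e b) b" using assms(2) unfolding u(1) by simp_all
    then show False using asc_act[OF e_in_S assms(3)] by blast
  qed
  then show ?thesis using u by simp
qed

end

section \<open>Reading off the classes of a folded colouring\<close>

context colouring
begin

lemma folded_col:
  assumes f: folded and m: "m = card I'"
  shows "1 \<le> p \<Longrightarrow> p < m \<Longrightarrow> x \<in> {1..n} \<Longrightarrow> col x = col p \<longleftrightarrow> x = p \<or> x = Suc n - p"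
    and "x \<in> {1..n} \<Longrightarrow> col x = col m \<longleftrightarrow> m \<le> x \<and> x \<le> Suc n - m"
proof -
  have F: "2 * m \<le> Suc n" "\<And>p. p \<in> {1..n} \<Longrightarrow> col (Suc n - p) = col p"
    "\<And>p. p \<in> {m..Suc n - m} \<Longrightarrow> col p = col m" "inj_on col {1..m}"
    using f unfolding folded_def Let_def m[symmetric] bij_betw_def by blast+
  have m2: "2 < m" using card_gt_2 m by simp
  \<comment> \<open>The representative of \<open>x\<close> among \<open>1..m\<close>: the left part
    is kept, the middle run collapses to \<open>m\<close>, the right part is reflected.\<close>
  define y where "y x = (if x < m then x else if x \<le> Suc n - m then m else Suc n - x)" for x
  have y: "y x \<in> {1..m} \<and> col x = col (y x)" if x: "x \<in> {1..n}" for x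
  proof -
    consider "x < m" | "m \<le> x" "x \<le> Suc n - m" | "Suc n - m < x" by linarith
    then show ?thesis
    proof cases
      case 1
      then show ?thesis using x by (simp add: y_def)
    next
      case 2
      then show ?thesis using F(3)[of x] m2 by (simp add: y_def)
    next
      case 3
      then have "y x = Suc n - x" "Suc n - x \<in> {1..m}" using x F(1) by (auto simp: y_def)
      then show ?thesis using F(2)[OF x] by simp
    qed
  qed
  have eq: "col x = col p \<longleftrightarrow> y x = p" if "x \<in> {1..n}" "p \<in> {1..m}" for x p
    using y[OF that(1)] inj_onD[OF F(4), of "y x" p] that(2) by auto
  show "col x = col p \<longleftrightarrow> x = p \<or> x = Suc n - p" if p: "1 \<le> p" "p < m" and x: "x \<in> {1..n}"
  proof -
    have "p \<in> {1..m}" using p by simp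
    then have "col x = col p \<longleftrightarrow> y x = p" using eq[OF x] by blast
    also have "\<dots> \<longleftrightarrow> x = p \<or> x = Suc n - p" using p x F(1) by (auto simp: y_def)
    finally show ?thesis .
  qed
  show "col x = col m \<longleftrightarrow> m \<le> x \<and> x \<le> Suc n - m" if x: "x \<in> {1..n}"
  proof -
    have "m \<in> {1..m}" using m2 by simp
    then have "col x = col m \<longleftrightarrow> y x = m" using eq[OF x] by blast
    also have "\<dots> \<longleftrightarrow> m \<le> x \<and> x \<le> Suc n - m" using x F(1) by (auto simp: y_def)
    finally show ?thesis .
  qed
qed

lemma folded_labelling_B:
  assumes folded
  shows "labelling_B (card I') col I' M'"
  using assms card_gt_2 unfolding folded_def Let_def labelling_B_def by auto

lemma bijective_labelling_A:
  assumes bijective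
  shows "labelling_A n col I' M'"
proof -
  have "1 \<le> n"
  proof (rule ccontr)
    assume "\<not> 1 \<le> n"
    then have "I' = {}" using surj by auto
    then show False using card_gt_2 by simp
  qed
  then show ?thesis using assms surj unfolding bijective_def labelling_A_def bij_betw_def by blast
qed

end

lemma matrix_B_ge_3:
  assumes "x \<noteq> y"
  shows "matrix_B m x y = enat 4 \<Longrightarrow> {x, y} = {m - 1, m}"
    and "matrix_B m x y = enat 3 \<Longrightarrow> (x = Suc y \<or> y = Suc x) \<and> {x, y} \<noteq> {m - 1, m}"
  using assms by (auto simp: matrix_B_def numeral_eq_enat split: if_splits)

text \<open>For \<open>m > 2\<close> the diagram \<open>B_m\<close> has no symmetry: the edge
  labelled 4 is preserved, its end \<open>m - 1\<close> is the one with a further neighbour, and the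
  rest of the path follows downwards. In \<open>B_2\<close> the two nodes could be
  exchanged.\<close>

lemma labelling_B_unique:
  assumes \<sigma>: "labelling_B m \<sigma> I M" and \<tau>: "labelling_B m \<tau> I M" and m: "2 < m" and p: "p \<in> {1..m}"
  shows "\<sigma> p = \<tau> p"
proof -
  have bs: "bij_betw \<sigma> {1..m} I" and bt: "bij_betw \<tau> {1..m} I"
    and Ms: "\<And>i j. i \<in> {1..m} \<Longrightarrow> j \<in> {1..m} \<Longrightarrow> M (\<sigma> i) (\<sigma> j) = matrix_B m i j"
    and Mt: "\<And>i j. i \<in> {1..m} \<Longrightarrow> j \<in> {1..m} \<Longrightarrow> M (\<tau> i) (\<tau> j) = matrix_B m i j"
    using \<sigma> \<tau> unfolding labelling_B_def by blast+
  define f where "f p = the_inv_into {1..m} \<tau> (\<sigma> p)" for p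
  have it: "inj_on \<tau> {1..m}" "\<tau> ` {1..m} = I" and isg: "inj_on \<sigma> {1..m}" "\<sigma> ` {1..m} = I"
    using bs bt by (auto simp: bij_betw_def)
  have f: "f p \<in> {1..m}" "\<tau> (f p) = \<sigma> p" if "p \<in> {1..m}" for p
  proof -
    have s: "\<sigma> p \<in> \<tau> ` {1..m}" using isg it that by blast
    show "f p \<in> {1..m}" unfolding f_def using it(1) s by (rule the_inv_into_into) simp
    show "\<tau> (f p) = \<sigma> p" unfolding f_def using it(1) s by (rule f_the_inv_into_f)
  qed
  have inj: "f p = f q \<Longrightarrow> p = q" if "p \<in> {1..m}" "q \<in> {1..m}" for p q
    using f(2)[OF that(1)] f(2)[OF that(2)] inj_onD[OF isg(1) _ that] by metis
  have mat: "matrix_B m (f p) (f q) = matrix_B m p q" if "p \<in> {1..m}" "q \<in> {1..m}" for p q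
    using Ms[OF that] Mt[OF f(1)[OF that(1)] f(1)[OF that(2)]] f(2)[OF that(1)] f(2)[OF that(2)] by simp
  have mm: "m \<in> {1..m}" "m - 1 \<in> {1..m}" "m - 2 \<in> {1..m}" using m by auto
  have "matrix_B m (f (m - 1)) (f m) = enat 4"
    using mat[OF mm(2,1)] matrix_B_entries(1)[of m] m by simp
  moreover have "f (m - 1) \<noteq> f m" using inj[OF mm(2,1)] m by auto
  ultimately have pair: "{f (m - 1), f m} = {m - 1, m}" using matrix_B_ge_3(1) by blast
  have fm: "f (m - 1) = m - 1 \<and> f m = m"
  proof (rule ccontr)
    assume "\<not> ?thesis"
    \<comment> \<open>Exchanging the ends would send \<open>m - 2\<close> to a neighbour of
      \<open>m\<close> with label 3, and \<open>m\<close> has none.\<close>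
    then have fm1: "f (m - 1) = m" using pair by (auto simp: doubleton_eq_iff)
    have "Suc (m - 2) = m - 1" "Suc (m - 2) < m" using m by auto
    then have "matrix_B m (m - 2) (m - 1) = enat 3" using matrix_B_entries(3)[of "m - 2" m] by simp
    then have "matrix_B m (f (m - 2)) m = enat 3" using mat[OF mm(3,2)] fm1 by simp
    moreover have "f (m - 2) \<noteq> m" using inj[OF mm(3,2)] fm1 m by auto
    ultimately have "(f (m - 2) = Suc m \<or> m = Suc (f (m - 2))) \<and> {f (m - 2), m} \<noteq> {m - 1, m}"
      using matrix_B_ge_3(2) by blast
    then show False using f(1)[OF mm(3)] by auto
  qed
  have "k < m \<Longrightarrow> f (m - k) = m - k" for k
  proof (induction k rule: less_induct)
    case (less k)
    consider "k = 0" | "k = 1" | l where "k = Suc (Suc l)" by (metis One_nat_def not0_implies_Suc)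
    then show ?case
    proof cases
      case (3 l)
      define q where "q = m - k"
      have q: "q \<in> {1..m}" "Suc q \<in> {1..m}" "Suc (Suc q) \<in> {1..m}" "m - Suc l = Suc q" "m - l = Suc (Suc q)"
        using less.prems 3 by (auto simp: q_def)
      have fq: "f (Suc q) = Suc q" "f (Suc (Suc q)) = Suc (Suc q)"
        using less.IH[of "Suc l"] less.IH[of l] 3 less.prems q(4,5) by auto
      have "Suc q < m" using q(3) by simp
      then have "matrix_B m (f q) (Suc q) = enat 3"
        using mat[OF q(1,2)] fq(1) matrix_B_entries(3)[of q m] by simp
      moreover have "f q \<noteq> Suc q" using inj[OF q(1,2)] fq(1) by auto
      ultimately have "f q = Suc (Suc q) \<or> Suc q = Suc (f q)" using matrix_B_ge_3(2) by blast
      moreover have "f q \<noteq> Suc (Suc q)" using inj[OF q(1,3)] fq(2) by auto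
      ultimately show ?thesis by (simp add: q_def)
    qed (use fm in auto)
  qed
  from this[of "m - p"] have "f p = p" using p by auto
  then show ?thesis using f(2)[OF p] by simp
qed

lemma labelled_A_of_labelling:
  assumes "coxeter_matrix I M" "labelling_A n \<tau> I M"
  shows "labelled_A I M n (the_inv_into {1..n} \<tau>)"
    and "\<And>p. p \<in> {1..n} \<Longrightarrow> the_inv_into {1..n} \<tau> (\<tau> p) = p"
    and "\<And>b. b \<in> I \<Longrightarrow> the_inv_into {1..n} \<tau> b \<in> {1..n} \<and> \<tau> (the_inv_into {1..n} \<tau> b) = b"
proof -
  have b: "bij_betw \<tau> {1..n} I" and M: "\<And>i j. i \<in> {1..n} \<Longrightarrow> j \<in> {1..n} \<Longrightarrow> M (\<tau> i) (\<tau> j) = matrix_A i j"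
    using assms(2) unfolding labelling_A_def by blast+
  have i: "inj_on \<tau> {1..n}" "\<tau> ` {1..n} = I" using b by (auto simp: bij_betw_def)
  show inv: "the_inv_into {1..n} \<tau> b \<in> {1..n} \<and> \<tau> (the_inv_into {1..n} \<tau> b) = b" if h: "b \<in> I" for b
  proof -
    have b: "b \<in> \<tau> ` {1..n}" unfolding i(2) by (rule h)
    show ?thesis using the_inv_into_into[OF i(1) b subset_refl] f_the_inv_into_f[OF i(1) b] by blast
  qed
  show "the_inv_into {1..n} \<tau> (\<tau> p) = p" if "p \<in> {1..n}" for p
    by (rule the_inv_into_f_f[OF i(1) that])
  show "labelled_A I M n (the_inv_into {1..n} \<tau>)"
  proof
    show "bij_betw (the_inv_into {1..n} \<tau>) I {1..n}" using b by (rule bij_betw_the_inv_into)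
    show "M a b = matrix_A (the_inv_into {1..n} \<tau> a) (the_inv_into {1..n} \<tau> b)" if "a \<in> I" "b \<in> I" for a b
      using M[of "the_inv_into {1..n} \<tau> a" "the_inv_into {1..n} \<tau> b"] inv[OF that(1)] inv[OF that(2)] by simp
  qed (rule assms(1))
qed

lemma labelled_B_of_labelling:
  assumes "coxeter_matrix I M" "labelling_B n \<tau> I M"
  shows "labelled_B I M n (2 * n) (the_inv_into {1..n} \<tau>)"
    and "\<And>p. p \<in> {1..n} \<Longrightarrow> the_inv_into {1..n} \<tau> (\<tau> p) = p"
    and "\<And>b. b \<in> I \<Longrightarrow> the_inv_into {1..n} \<tau> b \<in> {1..n} \<and> \<tau> (the_inv_into {1..n} \<tau> b) = b"
proof -
  have b: "bij_betw \<tau> {1..n} I" and M: "\<And>i j. i \<in> {1..n} \<Longrightarrow> j \<in> {1..n} \<Longrightarrow> M (\<tau> i) (\<tau> j) = matrix_B n i j"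
    and n: "2 \<le> n" using assms(2) unfolding labelling_B_def by blast+
  have i: "inj_on \<tau> {1..n}" "\<tau> ` {1..n} = I" using b by (auto simp: bij_betw_def)
  show inv: "the_inv_into {1..n} \<tau> b \<in> {1..n} \<and> \<tau> (the_inv_into {1..n} \<tau> b) = b" if h: "b \<in> I" for b
  proof -
    have b: "b \<in> \<tau> ` {1..n}" unfolding i(2) by (rule h)
    show ?thesis using the_inv_into_into[OF i(1) b subset_refl] f_the_inv_into_f[OF i(1) b] by blast
  qed
  show "the_inv_into {1..n} \<tau> (\<tau> p) = p" if "p \<in> {1..n}" for p
    by (rule the_inv_into_f_f[OF i(1) that])
  show "labelled_B I M n (2 * n) (the_inv_into {1..n} \<tau>)"
  proof
    show "bij_betw (the_inv_into {1..n} \<tau>) I {1..n}" using b by (rule bij_betw_the_inv_into)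
    show "M a b = matrix_B n (the_inv_into {1..n} \<tau> a) (the_inv_into {1..n} \<tau> b)" if "a \<in> I" "b \<in> I" for a b
      using M[of "the_inv_into {1..n} \<tau> a" "the_inv_into {1..n} \<tau> b"] inv[OF that(1)] inv[OF that(2)] by simp
  qed (use assms(1) n in simp_all)
qed


section \<open>Disjoint standard homomorphisms\<close>

locale standard_disjoint =
  fixes I' :: "'a set" and M' :: "'a \<Rightarrow> 'a \<Rightarrow> enat" and I :: "'b set" and M :: "'b \<Rightarrow> 'b \<Rightarrow> enat"
    and \<Phi> :: "'a list set \<Rightarrow> 'b list set" and K :: "'a \<Rightarrow> 'b set"
  assumes cox': "coxeter_matrix I' M'" and irr': "irreducible_coxeter I' M'"
    and fin': "finite_type I' M'" and card': "2 < card I'"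
    and cox: "coxeter_matrix I M" and std: "standard_hom I' M' I M \<Phi> K"
    and disjoint: "disjoint_family_on K I'" and cover: "(\<Union>i\<in>I'. K i) = I"
    and optimal: "optimal_hom I' M' I M \<Phi>"
begin

lemma hom: "\<Phi> \<in> monoid_hom (artin_monoid I' M') (artin_monoid I M)"
  using std by (simp add: standard_hom_def)

lemma K_parabolic:
  "i \<in> I' \<Longrightarrow> K i \<subseteq> I" "i \<in> I' \<Longrightarrow> finite (parabolic I M (K i))"
  "i \<in> I' \<Longrightarrow> \<Phi> (artin_gen I' M' i) = artin_lift I M (longest_element I M (K i))"
  using std by (simp_all add: standard_hom_def)

lemma ex_setup_A:
  assumes \<tau>: "labelling_A n \<tau> I M"
  obtains V where "setup_A I' M' I M \<Phi> K V n (the_inv_into {1..n} \<tau>)"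
proof -
  interpret labelled_A I M n "the_inv_into {1..n} \<tau>" by (rule labelled_A_of_labelling(1)[OF cox \<tau>])
  let ?\<iota> = "the_inv_into {1..n} \<tau>"
  have "\<forall>i\<in>I'. \<exists>u. u \<in> lists (K i) \<and> red u \<and> (\<forall>j\<in>K i. \<not> state u (?\<iota> j) < state u (Suc (?\<iota> j))) \<and>
      \<Phi> (artin_gen I' M' i) = artin_class I M u"
  proof
    fix i assume i: "i \<in> I'"
    show "\<exists>u. u \<in> lists (K i) \<and> red u \<and> (\<forall>j\<in>K i. \<not> state u (?\<iota> j) < state u (Suc (?\<iota> j))) \<and>
      \<Phi> (artin_gen I' M' i) = artin_class I M u"
      by (rule longest_element_word[OF K_parabolic(1,2)[OF i]]) (use K_parabolic(3)[OF i] in blast)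
  qed
  from bchoice[OF this] obtain V where V: "\<forall>i\<in>I'. V i \<in> lists (K i) \<and> red (V i) \<and>
      (\<forall>j\<in>K i. \<not> state (V i) (?\<iota> j) < state (V i) (Suc (?\<iota> j))) \<and>
      \<Phi> (artin_gen I' M' i) = artin_class I M (V i)" ..
  have VK: "V i \<in> lists (K i)" and Vred: "red (V i)" and VH: "\<Phi> (artin_gen I' M' i) = artin_class I M (V i)"
    if "i \<in> I'" for i by (rule bspec[OF V that, THEN conjunct1] bspec[OF V that, THEN conjunct2, THEN conjunct1]
      bspec[OF V that, THEN conjunct2, THEN conjunct2, THEN conjunct2])+
  have desc: "perm (map ?\<iota> (V i)) (Suc (?\<iota> b)) < perm (map ?\<iota> (V i)) (?\<iota> b)" if h: "i \<in> I'" "b \<in> K i" for i b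
  proof -
    have b: "b \<in> I" using K_parabolic(1)[OF h(1)] h(2) by (rule subsetD)
    have "\<not> state (V i) (?\<iota> b) < state (V i) (Suc (?\<iota> b))"
      by (rule bspec[OF bspec[OF V h(1), THEN conjunct2, THEN conjunct2, THEN conjunct1] h(2)])
    then show ?thesis unfolding descent_iff[OF b] .
  qed
  have "1 \<le> n" using \<tau> by (simp add: labelling_A_def)
  then have "I \<noteq> {}" using bij by (auto simp: bij_betw_def)
  have "setup_A I' M' I M \<Phi> K V n ?\<iota>"
  proof
    \<comment> \<open>The empty word has no descents, whereas the longest element has all of
      \<open>K i\<close>.\<close>
    show "V i \<noteq> []" if "i \<in> I'" "K i \<noteq> {}" for i
    proof
      assume "V i = []"
      then show False using desc[OF that(1)] that(2) by auto
    qed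
    show "rising id (map ?\<iota> (V i))" if "i \<in> I'" for i using Vred[OF that] unfolding red_from_rising .
  qed (rule cox' irr' fin' card' cox \<open>I \<noteq> {}\<close> hom disjoint cover optimal VK VH desc | assumption)+
  then show thesis by (rule that)
qed

lemma ex_setup_B:
  assumes \<tau>: "labelling_B n \<tau> I M"
  obtains V where "setup_B I' M' I M \<Phi> K V n (the_inv_into {1..n} \<tau>)"
proof -
  interpret labelled_B I M n "2 * n" "the_inv_into {1..n} \<tau>" by (rule labelled_B_of_labelling(1)[OF cox \<tau>])
  have "\<forall>i\<in>I'. \<exists>u. u \<in> lists (K i) \<and> red u \<and> (\<forall>j\<in>K i. \<not> basc (state u) j) \<and>
      \<Phi> (artin_gen I' M' i) = artin_class I M u"
  proof
    fix i assume i: "i \<in> I'"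
    show "\<exists>u. u \<in> lists (K i) \<and> red u \<and> (\<forall>j\<in>K i. \<not> basc (state u) j) \<and>
      \<Phi> (artin_gen I' M' i) = artin_class I M u"
      by (rule longest_element_word[OF K_parabolic(1,2)[OF i]]) (use K_parabolic(3)[OF i] in blast)
  qed
  from bchoice[OF this] obtain V where V: "\<forall>i\<in>I'. V i \<in> lists (K i) \<and> red (V i) \<and> (\<forall>j\<in>K i. \<not> basc (state (V i)) j) \<and>
      \<Phi> (artin_gen I' M' i) = artin_class I M (V i)" ..
  have VK: "V i \<in> lists (K i)" and Vred: "red (V i)" and VH: "\<Phi> (artin_gen I' M' i) = artin_class I M (V i)"
    if "i \<in> I'" for i by (rule bspec[OF V that, THEN conjunct1] bspec[OF V that, THEN conjunct2, THEN conjunct1]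
      bspec[OF V that, THEN conjunct2, THEN conjunct2, THEN conjunct2])+
  have Vdesc: "\<not> basc (state (V i)) b" if h: "i \<in> I'" "b \<in> K i" for i b
    by (rule bspec[OF bspec[OF V h(1), THEN conjunct2, THEN conjunct2, THEN conjunct1] h(2)])
  have "I \<noteq> {}" using bij r by (auto simp: bij_betw_def)
  have "setup_B I' M' I M \<Phi> K V n (the_inv_into {1..n} \<tau>)"
  proof
    show "V i \<noteq> []" if i: "i \<in> I'" "K i \<noteq> {}" for i
    proof
      assume nil: "V i = []"
      obtain b where b: "b \<in> K i" using i by blast
      have bI: "b \<in> I" using K_parabolic(1)[OF i(1)] b by (rule subsetD)
      have "\<not> basc (state (V i)) b" by (rule Vdesc[OF i(1) b])
      moreover have "basc id b" by (rule asc_e[OF bI])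
      ultimately show False unfolding nil foldl.simps by blast
    qed
  qed (rule cox' irr' fin' card' cox \<open>I \<noteq> {}\<close> hom disjoint cover optimal VK VH Vred Vdesc | assumption)+
  then show thesis by (rule that)
qed

end

context setup_A
begin

lemma single_V:
  assumes "i \<in> I'" "K i = {b}"
  shows "V i = [b]"
proof (rule red_single_letter)
  show "V i \<in> lists {b}" using V_K[OF assms(1)] assms(2) by simp
  show "red (V i)" unfolding red_from_rising by (rule V_rising[OF assms(1)])
  show "b \<in> I" using K_sub assms by blast
  show "V i \<noteq> []" using V_nonempty[OF assms(1)] assms(2) by blast
qed

text \<open>Every class is a single node, so \<Phi> renames generators by \<open>f\<close>;
  colouring a node gives the inverse renaming \<open>g\<close>, and both respect the Coxeter
  matrices.\<close>

lemma bijective_iso: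
  assumes fam.bijective
  shows "\<Phi> \<in> iso (artin_monoid I' M') (artin_monoid I M)"
proof -
  have colinj: "inj_on fam.col {1..n}" and
    mat: "\<And>p q. p \<in> {1..n} \<Longrightarrow> q \<in> {1..n} \<Longrightarrow> M' (fam.col p) (fam.col q) = matrix_A p q"
    using assms unfolding fam.bijective_def by blast+
  define g where "g b = fam.col (\<iota> b)" for b
  have lab: "\<iota> b \<in> {1..n}" if "b \<in> I" for b using label_range[OF that] by simp
  have gI: "g b \<in> I'" if "b \<in> I" for b using fam.col_in[of "\<iota> b"] lab[OF that] by (simp add: g_def)
  have ginj: "inj_on g I"
  proof (rule inj_onI)
    fix a b assume ab: "a \<in> I" "b \<in> I" "g a = g b"
    then have "\<iota> a = \<iota> b" using inj_onD[OF colinj] lab by (simp add: g_def)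
    then show "a = b" using label_eq_iff ab by simp
  qed
  have gimg: "g ` I = I'"
  proof
    show "I' \<subseteq> g ` I"
    proof
      fix i assume i: "i \<in> I'"
      obtain b where "b \<in> K i" using K_nonempty[OF i] by blast
      then have "b \<in> I" "g b = i" using K_sub[OF i] in_K_iff[OF i] by (auto simp: g_def)
      then show "i \<in> g ` I" by blast
    qed
  qed (use gI in blast)
  define f where "f = the_inv_into I g"
  have fg: "f (g b) = b" if "b \<in> I" for b unfolding f_def using ginj that by (rule the_inv_into_f_f)
  have f: "f i \<in> I" "g (f i) = i" if "i \<in> I'" for i
    unfolding f_def using the_inv_into_into[OF ginj] f_the_inv_into_f[OF ginj] that gimg by blast+
  have finj: "inj_on f I'" using f(2) by (metis inj_onI)
  have Mg: "M' (g a) (g b) = M a b" if "a \<in> I" "b \<in> I" for a b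
    using mat[OF lab[OF that(1)] lab[OF that(2)]] M_eq[OF that] by (simp add: g_def)
  have Mf: "M (f i) (f j) = M' i j" if "i \<in> I'" "j \<in> I'" for i j
    using Mg[OF f(1)[OF that(1)] f(1)[OF that(2)]] f(2)[OF that(1)] f(2)[OF that(2)] by simp
  have Vf: "V i = [f i]" if i: "i \<in> I'" for i
  proof (rule single_V[OF i])
    have "b \<in> K i \<longleftrightarrow> b = f i" if "b \<in> I" for b
      using in_K_iff[OF i that] fg[OF that] f(2)[OF i] by (auto simp: g_def)
    then show "K i = {f i}" using K_sub[OF i] f(1)[OF i] by blast
  qed
  have \<Phi>: "\<Phi> (artin_class I' M' u) = artin_class I M (map f u)" if "u \<in> lists I'" for u
  proof -
    have "\<Phi> (artin_class I' M' u) = artin_class I M (subst V u)" by (rule hom_word[OF hom V_I V_hom that])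
    also have "subst V u = map f u" using that Vf by (induction u) auto
    finally show ?thesis .
  qed
  have gf: "map g (map f u) = u" if "u \<in> lists I'" for u using that f(2) by (induction u) auto
  have fgw: "map f (map g u) = u" if "u \<in> lists I" for u using that fg by (induction u) auto
  have mapf: "map f u \<in> lists I" if "u \<in> lists I'" for u using that f(1) by (induction u) auto
  have mapg: "map g u \<in> lists I'" if "u \<in> lists I" for u using that gI by (induction u) auto
  have "inj_on \<Phi> (carrier (artin_monoid I' M'))"
  proof (rule inj_onI)
    fix x y assume "x \<in> carrier (artin_monoid I' M')" "y \<in> carrier (artin_monoid I' M')" "\<Phi> x = \<Phi> y"
    then obtain u v where uv: "x = artin_class I' M' u" "u \<in> lists I'" "y = artin_class I' M' v" "v \<in> lists I'"
      "\<Phi> x = \<Phi> y" unfolding carrier_artin by blast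
    then have "artin_class I M (map f u) = artin_class I M (map f v)" using \<Phi> by simp
    then have "(map f u, map f v) \<in> artin_cong I M" using word_class_eq_iff[OF mapf mapf, OF uv(2,4)] by blast
    then have "(map g (map f u), map g (map f v)) \<in> artin_cong I' M'"
      by (rule artin_cong_map) (use gI ginj Mg in blast)+
    then have "(u, v) \<in> artin_cong I' M'" unfolding gf[OF uv(2)] gf[OF uv(4)] .
    then show "x = y" unfolding uv(1,3) by (rule artin_class_eqI)
  qed
  moreover have "\<Phi> ` carrier (artin_monoid I' M') = carrier (artin_monoid I M)"
  proof
    show "\<Phi> ` carrier (artin_monoid I' M') \<subseteq> carrier (artin_monoid I M)"
      unfolding carrier_artin using \<Phi> mapf by blast
    show "carrier (artin_monoid I M) \<subseteq> \<Phi> ` carrier (artin_monoid I' M')"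
    proof
      fix x assume "x \<in> carrier (artin_monoid I M)"
      then obtain u where u: "x = artin_class I M u" "u \<in> lists I" unfolding carrier_artin by blast
      then have "x = \<Phi> (artin_class I' M' (map g u))" using \<Phi>[OF mapg[OF u(2)]] fgw[OF u(2)] by simp
      then show "x \<in> \<Phi> ` carrier (artin_monoid I' M')" unfolding carrier_artin using mapg[OF u(2)] by blast
    qed
  qed
  ultimately show ?thesis using hom by (simp add: iso_def bij_betw_def monoid_hom_def)
qed

end

lemma alternating_concat_singleton: "alternating_concat k [i] [j] = alternating_word k i j"
  by (induction k arbitrary: i j) auto

context setup_B
begin

lemma single_V:
  assumes "i \<in> I'" "K i = {b}"
  shows "V i = [b]"
proof (rule red_single_letter)
  show "V i \<in> lists {b}" using V_K[OF assms(1)] assms(2) by simp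
  show "red (V i)" by (rule V_red[OF assms(1)])
  show "b \<in> I" using K_sub assms by blast
  show "V i \<noteq> []" using V_nonempty[OF assms(1)] assms(2) by blast
qed

lemma folded: "fam.folded"
  using fam.bijective_or_folded not_bijective by blast

end

section \<open>The homomorphism between monoids of type B\<close>

context labelled_B_nat
begin

text \<open>Three kinds of pairs occur: two kept generators, whose label is the same in
  \<open>B_m\<close> and \<open>B_r\<close>; the edge of label 4, which is
  \<open>dword_braid\<close>; and a generator far from the block \<open>[m, r]\<close>, which
  commutes with all its letters.\<close>

lemma folding_relation_less:
  assumes m: "2 < m" "m \<le> r" and p: "1 \<le> p" "p < q" "q \<le> m" and k: "matrix_B m p q = enat k"
    and W: "W = (\<lambda>p. if p < m then [p] else dword r m)"
  shows "(alternating_concat k (W p) (W q), alternating_concat k (W q) (W p)) \<in> acong"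
proof -
  have Wp: "W p = [p]" using p W by simp
  consider "q < m" | "q = m" "Suc p = m" | "q = m" "Suc p < m" using p by linarith
  then show ?thesis
  proof cases
    case 1
    have "Suc p < m" using 1 p by simp
    then have "matrix_B r p q = enat k"
    proof (cases "q = Suc p")
      case True
      have "matrix_B m p q = enat 3" "matrix_B r p q = enat 3"
        unfolding True by (rule matrix_B_entries(3); use 1 True m in simp)+
      then show ?thesis using k by simp
    next
      case False
      then have "Suc p < q" using p by simp
      then show ?thesis using k matrix_B_entries(5)[of p q] by simp
    qed
    then have "(alternating_word k p q, alternating_word k q p) \<in> acong"
      by (intro artin_relation) (use p m 1 in auto)
    moreover have "W q = [q]" using 1 W by simp
    ultimately show ?thesis unfolding Wp by (simp only: alternating_concat_singleton)
  next
    case 2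
    have "matrix_B m p q = enat 4" using matrix_B_entries(1)[of m] 2 m by auto
    then have k4: "k = 4" using k by simp
    have Wq: "W q = dword r (Suc p)" using 2 W by simp
    have "([p] @ W q @ [p] @ W q, W q @ [p] @ W q @ [p]) \<in> acong"
      unfolding Wq by (rule dword_braid) (use p m 2 in auto)
    then show ?thesis unfolding k4 Wp by (simp add: alternating_concat_numeral)
  next
    case 3
    have k2: "k = 2" using k matrix_B_entries(5)[of p q m] 3 by simp
    have Wq: "W q = dword r m" using 3 W by simp
    have "([p] @ W q, W q @ [p]) \<in> acong"
      unfolding Wq
    proof (rule commuting_words)
      show "[p] \<in> lists {1..r}" using p m by simp
      show "dword r m \<in> lists {1..r}" by (rule dword_lists) (use m in auto)
      fix a b assume "a \<in> set [p]" "b \<in> set (dword r m)"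
      then have "a = p" "m \<le> b" "b \<le> r" using set_dword[OF m(2)] by auto
      then show "([a, b], [b, a]) \<in> acong" using letters_commute(1)[of p b] p 3 by simp
    qed
    then show ?thesis unfolding k2 Wp by (simp add: alternating_concat_numeral)
  qed
qed

lemma folding_relation:
  assumes m: "2 < m" "m \<le> r" and p: "p \<in> {1..m}" "q \<in> {1..m}" "p \<noteq> q" and k: "matrix_B m p q = enat k"
    and W: "W = (\<lambda>p. if p < m then [p] else dword r m)"
  shows "(alternating_concat k (W p) (W q), alternating_concat k (W q) (W p)) \<in> acong"
proof (cases "p < q")
  case True
  show ?thesis by (rule folding_relation_less[OF m _ True _ k W]) (use p in auto)
next
  case False
  then have qp: "q < p" using p by simp
  have "matrix_B m q p = enat k"
    using coxeter_matrix_B[of m] m p k unfolding coxeter_matrix_def by auto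
  then have "(alternating_concat k (W q) (W p), alternating_concat k (W p) (W q)) \<in> acong"
    by (intro folding_relation_less[OF m _ qp _ _ W]) (use p in auto)
  then show ?thesis by (rule word_cong.sym)
qed

lemma unf_single:
  assumes "1 \<le> p" "p < m" "m \<le> r"
  defines "z \<equiv> subst (unfold_letter r N) [p]"
  shows "z = [p, N - p]" and "rising id z"
    and "x = p \<or> x = N - p \<Longrightarrow> perm z (Suc x) < perm z x"
proof -
  have q: "Suc p < N - p" using assms(1-3) NN by auto
  show z: "z = [p, N - p]" using assms(2,3) by (simp add: z_def unfold_letter_def)
  show "rising id z" unfolding z using q by simp
  show "perm z (Suc x) < perm z x" if "x = p \<or> x = N - p"
    using that unfolding z by (rule disjE) (use q in simp_all)
qed

text \<open>What \<open>longest_word_unique\<close> asks of the unfolded block: its letters lie in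
  the middle run, and it is reduced with a descent at every node there.\<close>

lemma unf_dword:
  assumes m: "1 \<le> m" "m \<le> r"
  defines "z \<equiv> subst (unfold_letter r N) (dword r m)"
  shows "set z \<subseteq> {m..N - m}" and "rising id z"
    and "m \<le> x \<Longrightarrow> x \<le> N - m \<Longrightarrow> perm z (Suc x) < perm z x"
proof -
  have d: "dword r m \<in> lists {1..r}" "red (dword r m)"
    using dword_lists[of m] dword_red[of m] m by auto
  show "set z \<subseteq> {m..N - m}"
  proof
    fix y assume "y \<in> set z"
    then obtain c where c: "c \<in> set (dword r m)" "y \<in> set (unfold_letter r N c)" by (auto simp: z_def)
    then have "m \<le> c" "c \<le> r" using set_dword[OF m(2)] by auto
    then show "y \<in> {m..N - m}" using c(2) NN m by (auto simp: unfold_letter_def split: if_splits)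
  qed
  show "rising id z" unfolding z_def by (rule rising_unf[OF d])
  have pz: "perm z = state (dword r m)" unfolding z_def by (rule state_unf[OF d, symmetric])
  show "perm z (Suc x) < perm z x" if x: "m \<le> x" "x \<le> N - m"
  proof -
    have "state (dword r m) x = Suc N - x" "state (dword r m) (Suc x) = Suc N - Suc x"
      by (rule dword_reversal[OF m]; use x m NN in auto)+
    then show ?thesis unfolding pz using x m NN by auto
  qed
qed

end

context standard_disjoint
begin

text \<open>A folded colouring labels the source as type B, and a target of type B is always folded;
  so only a bijective colouring of a path remains.\<close>

lemma not_type_B:
  assumes "type_A I M \<or> type_B I M" "\<not> type_B I' M'"
  shows "type_A I' M' \<and> type_A I M \<and> \<Phi> \<in> iso (artin_monoid I' M') (artin_monoid I M)"
  using assms(1)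
proof
  assume A: "type_A I M"
  then obtain n \<tau> where \<tau>: "labelling_A n \<tau> I M" unfolding type_A_def by blast
  obtain V where V: "setup_A I' M' I M \<Phi> K V n (the_inv_into {1..n} \<tau>)" using ex_setup_A[OF \<tau>] .
  interpret s: setup_A I' M' I M \<Phi> K V n "the_inv_into {1..n} \<tau>" by (rule V)
  have "\<not> s.fam.folded" using s.fam.folded_labelling_B assms(2) unfolding type_B_def by blast
  then have b: "s.fam.bijective" using s.fam.bijective_or_folded by blast
  have "type_A I' M'" unfolding type_A_def using s.fam.bijective_labelling_A[OF b] by blast
  then show ?thesis using A s.bijective_iso[OF b] by blast
next
  assume "type_B I M"
  then obtain n \<tau> where \<tau>: "labelling_B n \<tau> I M" unfolding type_B_def by blast
  obtain V where V: "setup_B I' M' I M \<Phi> K V n (the_inv_into {1..n} \<tau>)" using ex_setup_B[OF \<tau>] .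
  interpret s: setup_B I' M' I M \<Phi> K V n "the_inv_into {1..n} \<tau>" by (rule V)
  have "type_B I' M'" unfolding type_B_def using s.fam.folded_labelling_B[OF s.folded] by blast
  then show ?thesis using assms(2) by contradiction
qed

text \<open>By rigidity of \<open>B_m\<close> the given labelling agrees with the colouring on
  \<open>1..m\<close>, so the sets \<open>K\<close> are read off from the folded colouring of
  \<open>A_{2n-1}\<close>, restricted to the half \<open>1..n\<close> that carries the labels of the
  target.\<close>

lemma B_to_B:
  assumes m: "m = card I'" and \<sigma>: "labelling_B m \<sigma> I' M'" and \<tau>: "labelling_B n \<tau> I M"
  shows "m \<le> n"
    and "i \<in> {1..m - 1} \<Longrightarrow> \<Phi> (artin_gen I' M' (\<sigma> i)) = artin_gen I M (\<tau> i)"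
    and "\<Phi> (artin_gen I' M' (\<sigma> m)) = artin_lift I M (longest_element I M (\<tau> ` {m..n}))"
proof -
  define \<iota> where "\<iota> = the_inv_into {1..n} \<tau>"
  obtain V where V: "setup_B I' M' I M \<Phi> K V n \<iota>" unfolding \<iota>_def using ex_setup_B[OF \<tau>] .
  interpret s: setup_B I' M' I M \<Phi> K V n \<iota> by (rule V)
  note lab = labelled_B_of_labelling(2,3)[OF cox \<tau>, folded \<iota>_def]
  have m2: "2 < m" using card' m by simp
  have n: "2 \<le> n" "Suc (2 * n - 1) = 2 * n" using \<tau> by (auto simp: labelling_B_def)
  have f: "s.fam.folded" by (rule s.folded)
  have "2 * m \<le> Suc (2 * n - 1)" using f unfolding s.fam.folded_def Let_def m by (rule conjunct1)
  then show mn: "m \<le> n" using n(2) by simp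
  have \<sigma>col: "\<sigma> p = s.fam.col p" if "p \<in> {1..m}" for p
    by (rule labelling_B_unique[OF \<sigma> _ m2 that]) (use s.fam.folded_labelling_B[OF f] m in simp)
  have \<tau>I: "\<tau> p \<in> I" if "p \<in> {1..n}" for p using \<tau> that unfolding labelling_B_def bij_betw_def by blast
  have \<sigma>I: "\<sigma> p \<in> I'" if "p \<in> {1..m}" for p using \<sigma> that unfolding labelling_B_def bij_betw_def by blast
  have K: "b \<in> K (\<sigma> p) \<longleftrightarrow> s.fam.col (\<iota> b) = s.fam.col p" if "p \<in> {1..m}" "b \<in> I" for p b
    using s.in_K_iff[OF \<sigma>I[OF that(1)] that(2)] unfolding \<sigma>col[OF that(1)] .
  have x: "\<iota> b \<in> {1..n}" "\<tau> (\<iota> b) = b" "\<iota> b \<in> {1..2 * n - 1}" if "b \<in> I" for b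
    using lab(2)[OF that] by auto
  have K1: "K (\<sigma> p) = {\<tau> p}" if p: "p \<in> {1..m - 1}" for p
  proof -
    have p': "1 \<le> p" "p < m" "p \<in> {1..m}" "p \<in> {1..n}" using p m2 mn by auto
    have *: "b \<in> K (\<sigma> p) \<longleftrightarrow> b = \<tau> p" if b: "b \<in> I" for b
    proof -
      note K[OF p'(3) b]
      also have "s.fam.col (\<iota> b) = s.fam.col p \<longleftrightarrow> \<iota> b = p \<or> \<iota> b = Suc (2 * n - 1) - p"
        by (rule s.fam.folded_col(1)[OF f m p'(1,2) x(3)[OF b]])
      also have "\<dots> \<longleftrightarrow> \<iota> b = p" using x(1)[OF b] p' mn n(2) by auto
      \<comment> \<open>The mirror image \<open>2 * n - p\<close> exceeds \<open>n\<close>, so it is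
        no label.\<close>
      also have "\<dots> \<longleftrightarrow> b = \<tau> p" using x(2)[OF b] lab(1)[OF p'(4)] by metis
      finally show ?thesis .
    qed
    have "{\<tau> p} \<subseteq> I" using \<tau>I[OF p'(4)] by simp
    then show ?thesis using * K_parabolic(1)[OF \<sigma>I[OF p'(3)]] by blast
  qed
  have mm: "m \<in> {1..m}" using m2 by simp
  have Km: "K (\<sigma> m) = \<tau> ` {m..n}"
  proof -
    have *: "b \<in> K (\<sigma> m) \<longleftrightarrow> b \<in> \<tau> ` {m..n}" if b: "b \<in> I" for b
    proof -
      note K[OF mm b]
      also have "s.fam.col (\<iota> b) = s.fam.col m \<longleftrightarrow> m \<le> \<iota> b \<and> \<iota> b \<le> Suc (2 * n - 1) - m"
        by (rule s.fam.folded_col(2)[OF f m x(3)[OF b]])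
      also have "\<dots> \<longleftrightarrow> \<iota> b \<in> {m..n}" using x(1)[OF b] mn n(2) by auto
      also have "\<dots> \<longleftrightarrow> b \<in> \<tau> ` {m..n}"
      proof
        show "\<iota> b \<in> {m..n} \<Longrightarrow> b \<in> \<tau> ` {m..n}" using x(2)[OF b] by (metis imageI)
        assume "b \<in> \<tau> ` {m..n}"
        then obtain y where "b = \<tau> y" "y \<in> {m..n}" by blast
        then show "\<iota> b \<in> {m..n}" using lab(1)[of y] m2 by auto
      qed
      finally show ?thesis .
    qed
    have "\<tau> ` {m..n} \<subseteq> I" using \<tau>I m2 by auto
    then show ?thesis using * K_parabolic(1)[OF \<sigma>I[OF mm]] by blast
  qed
  show "\<Phi> (artin_gen I' M' (\<sigma> i)) = artin_gen I M (\<tau> i)" if i: "i \<in> {1..m - 1}"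
  proof -
    have "\<sigma> i \<in> I'" using \<sigma>I i by auto
    then show ?thesis using s.V_hom s.single_V K1[OF i] unfolding artin_gen_def by metis
  qed
  show "\<Phi> (artin_gen I' M' (\<sigma> m)) = artin_lift I M (longest_element I M (\<tau> ` {m..n}))"
    using K_parabolic(3)[OF \<sigma>I[OF mm]] unfolding Km .
qed

end

lemma nat_ceiling_half: "nat \<lceil>real n / 2\<rceil> = Suc n div 2"
proof -
  have "\<lceil>real n / 2\<rceil> = int (Suc n div 2)"
  proof (rule ceiling_unique)
    obtain k where "n = 2 * k \<or> n = Suc (2 * k)" by (metis evenE oddE Suc_eq_plus1)
    then show "of_int (int (Suc n div 2)) - 1 < real n / 2" "real n / 2 \<le> of_int (int (Suc n div 2))"
      by (elim disjE; simp)+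
  qed
  then show ?thesis by simp
qed

text \<open>The relations hold by \<open>acong_A_unf\<close> with \<open>N = Suc n\<close>, whose
  two values give the two cases of the definition.\<close>

lemma ex_standard_unfolding:
  assumes cox: "coxeter_matrix I M" and \<tau>: "labelling_A n \<tau> I M" and r: "2 \<le> r" "Suc n = 2 * r \<or> Suc n = Suc (2 * r)"
  obtains U where "is_standard_unfolding r n \<tau> I M U"
    "\<forall>u\<in>lists {1..r}. U (artin_class {1..r} (matrix_B r) u)
      = artin_class I M (subst (\<lambda>x. map \<tau> (unfold_letter r (Suc n) x)) u)"
proof -
  interpret b: labelled_B_nat r "Suc n" by unfold_locales (rule r)+
  have bij: "bij_betw \<tau> {1..n} I" and M: "\<And>i j. i \<in> {1..n} \<Longrightarrow> j \<in> {1..n} \<Longrightarrow> M (\<tau> i) (\<tau> j) = matrix_A i j"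
    using \<tau> unfolding labelling_A_def by blast+
  have \<tau>I: "\<tau> p \<in> I" if "p \<in> {1..n}" for p using bij that unfolding bij_betw_def by blast
  have inj: "inj_on \<tau> {1..n}" using bij by (rule bij_betw_imp_inj_on)
  let ?V = "\<lambda>x. map \<tau> (unfold_letter r (Suc n) x)"
  have ul: "unfold_letter r (Suc n) i \<in> lists {1..n}" if "i \<in> {1..r}" for i
    using b.unfold_letter_in_lists[of i] that unfolding diff_Suc_1 by simp
  have VI: "?V i \<in> lists I" if "i \<in> {1..r}" for i using ul[OF that] \<tau>I by auto
  have rel: "(alternating_concat k (?V i) (?V j), alternating_concat k (?V j) (?V i)) \<in> artin_cong I M"
    if ij: "i \<in> {1..r}" "j \<in> {1..r}" "i \<noteq> j" "matrix_B r i j = enat k" for i j k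
  proof -
    have "(alternating_concat k (unfold_letter r (Suc n) i) (unfold_letter r (Suc n) j),
        alternating_concat k (unfold_letter r (Suc n) j) (unfold_letter r (Suc n) i)) \<in> artin_cong {1..n} matrix_A"
      using b.acong_A_unf[OF artin_relation[where M = "matrix_B r", OF ij]]
      unfolding subst_alternating_word diff_Suc_1 .
    then have "(map \<tau> (alternating_concat k (unfold_letter r (Suc n) i) (unfold_letter r (Suc n) j)),
        map \<tau> (alternating_concat k (unfold_letter r (Suc n) j) (unfold_letter r (Suc n) i))) \<in> artin_cong I M"
      by (rule artin_cong_map[where f = \<tau>]) (rule \<tau>I inj M | assumption)+
    then show ?thesis unfolding alternating_concat_map .
  qed
  obtain U where U: "U \<in> monoid_hom (artin_monoid {1..r} (matrix_B r)) (artin_monoid I M)"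
    "\<And>u. u \<in> lists {1..r} \<Longrightarrow> U (artin_class {1..r} (matrix_B r) u) = artin_class I M (subst ?V u)"
    by (rule ex_artin_hom[where I' = "{1..r}" and M' = "matrix_B r" and V = ?V and I = I and M = M])
      (rule VI rel that | assumption)+
  have gen: "U (artin_gen {1..r} (matrix_B r) i) = artin_class I M (?V i)" if "i \<in> {1..r}" for i
    unfolding artin_gen_def using U(2)[of "[i]"] that by simp
  have mult: "artin_gen I M (\<tau> p) \<otimes>\<^bsub>artin_monoid I M\<^esub> artin_gen I M (\<tau> q) = artin_class I M [\<tau> p, \<tau> q]"
    if "p \<in> {1..n}" "q \<in> {1..n}" for p q
    unfolding artin_gen_def using mult_artin[of "[\<tau> p]" I "[\<tau> q]" M] \<tau>I that by simp
  have rr: "r \<in> {1..r}" "r \<in> {1..n}" using r by auto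
  have small: "U (artin_gen {1..r} (matrix_B r) i)
      = artin_gen I M (\<tau> i) \<otimes>\<^bsub>artin_monoid I M\<^esub> artin_gen I M (\<tau> (Suc n - i))" if i: "i \<in> {1..r - 1}" for i
  proof -
    have i': "i \<in> {1..r}" "i < r" "i \<in> {1..n}" "Suc n - i \<in> {1..n}" using i r by auto
    then have "?V i = [\<tau> i, \<tau> (Suc n - i)]" by (simp add: unfold_letter_def)
    then show ?thesis unfolding gen[OF i'(1)] mult[OF i'(3,4)] by simp
  qed
  have "is_standard_unfolding r n \<tau> I M U"
    using r(2)
  proof
    assume N: "Suc n = 2 * r"
    have "?V r = [\<tau> r]" using N by (simp add: unfold_letter_def)
    then have "U (artin_gen {1..r} (matrix_B r) r) = artin_gen I M (\<tau> r)"
      unfolding gen[OF rr(1)] by (simp add: artin_gen_def)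
    moreover have "n = 2 * r - 1" using N by simp
    ultimately show ?thesis unfolding is_standard_unfolding_def Let_def
      using U(1) small unfolding N by blast
  next
    assume N: "Suc n = Suc (2 * r)"
    then have N': "Suc n = 2 * r + 1" by simp
    have s: "r + 1 \<in> {1..n}" using N r by simp
    have "?V r = [\<tau> r, \<tau> (r + 1), \<tau> r]" using N by (simp add: unfold_letter_def)
    moreover have "artin_class I M [\<tau> r, \<tau> (r + 1)] \<otimes>\<^bsub>artin_monoid I M\<^esub> artin_gen I M (\<tau> r)
        = artin_class I M [\<tau> r, \<tau> (r + 1), \<tau> r]"
      unfolding artin_gen_def using mult_artin[of "[\<tau> r, \<tau> (r + 1)]" I "[\<tau> r]" M] \<tau>I[OF rr(2)] \<tau>I[OF s] by simp
    ultimately have "U (artin_gen {1..r} (matrix_B r) r) = artin_gen I M (\<tau> r) \<otimes>\<^bsub>artin_monoid I M\<^esub>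
        artin_gen I M (\<tau> (r + 1)) \<otimes>\<^bsub>artin_monoid I M\<^esub> artin_gen I M (\<tau> r)"
      unfolding gen[OF rr(1)] mult[OF rr(2) s] by simp
    moreover have "n = 2 * r" using N by simp
    ultimately show ?thesis unfolding is_standard_unfolding_def Let_def
      using U(1) small unfolding N' by blast
  qed
  then show thesis by (rule that) (rule ballI, rule U(2))
qed

context standard_disjoint
begin

text \<open>The colouring cannot be bijective, because the label 4 between
  \<open>\<sigma> (m - 1)\<close> and \<open>\<sigma> m\<close> does not occur in type A.\<close>

lemma folded_A:
  assumes m: "m = card I'" and \<sigma>: "labelling_B m \<sigma> I' M'" and \<tau>: "labelling_A n \<tau> I M"
  obtains V where "setup_A I' M' I M \<Phi> K V n (the_inv_into {1..n} \<tau>)" "2 * m \<le> Suc n"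
    "\<forall>p. 1 \<le> p \<and> p < m \<longrightarrow> K (\<sigma> p) = {\<tau> p, \<tau> (Suc n - p)}" "K (\<sigma> m) = \<tau> ` {m..Suc n - m}"
proof -
  define \<iota> where "\<iota> = the_inv_into {1..n} \<tau>"
  obtain V where V: "setup_A I' M' I M \<Phi> K V n \<iota>" unfolding \<iota>_def using ex_setup_A[OF \<tau>] .
  interpret s: setup_A I' M' I M \<Phi> K V n \<iota> by (rule V)
  note lab = labelled_A_of_labelling(2,3)[OF cox \<tau>, folded \<iota>_def]
  have m2: "2 < m" using card' m by simp
  have \<sigma>I: "\<sigma> p \<in> I'" if "p \<in> {1..m}" for p using \<sigma> that unfolding labelling_B_def bij_betw_def by blast
  have \<tau>I: "\<tau> p \<in> I" if "p \<in> {1..n}" for p using \<tau> that unfolding labelling_A_def bij_betw_def by blast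
  have "\<not> s.fam.bijective"
  proof
    assume b: "s.fam.bijective"
    have mm: "m \<in> {1..m}" "m - 1 \<in> {1..m}" using m2 by auto
    have "\<sigma> (m - 1) \<in> s.fam.col ` {1..n}" "\<sigma> m \<in> s.fam.col ` {1..n}"
      unfolding s.fam.surj using \<sigma>I mm by simp_all
    then obtain p q where pq: "p \<in> {1..n}" "q \<in> {1..n}" "\<sigma> (m - 1) = s.fam.col p" "\<sigma> m = s.fam.col q"
      by (elim imageE) (rule that)
    have "M' (\<sigma> (m - 1)) (\<sigma> m) = matrix_B m (m - 1) m" using \<sigma> mm unfolding labelling_B_def by blast
    then have "M' (\<sigma> (m - 1)) (\<sigma> m) = enat 4" using matrix_B_entries(1)[of m] m2 by simp
    moreover have "M' (s.fam.col p) (s.fam.col q) = matrix_A p q"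
      using b pq(1,2) unfolding s.fam.bijective_def by blast
    ultimately have "matrix_A p q = enat 4" unfolding pq(3,4) by simp
    then show False by (simp add: matrix_A_def numeral_eq_enat one_enat_def split: if_splits)
  qed
  then have f: "s.fam.folded" using s.fam.bijective_or_folded by blast
  have mn: "2 * m \<le> Suc n" using f unfolding s.fam.folded_def Let_def m by (rule conjunct1)
  have \<sigma>col: "\<sigma> p = s.fam.col p" if "p \<in> {1..m}" for p
    by (rule labelling_B_unique[OF \<sigma> _ m2 that]) (use s.fam.folded_labelling_B[OF f] m in simp)
  have K: "b \<in> K (\<sigma> p) \<longleftrightarrow> s.fam.col (\<iota> b) = s.fam.col p" if "p \<in> {1..m}" "b \<in> I" for p b
    using s.in_K_iff[OF \<sigma>I[OF that(1)] that(2)] unfolding \<sigma>col[OF that(1)] .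
  have x: "\<iota> b \<in> {1..n}" "\<tau> (\<iota> b) = b" if "b \<in> I" for b using lab(2)[OF that] by blast+
  have K1: "K (\<sigma> p) = {\<tau> p, \<tau> (Suc n - p)}" if p: "1 \<le> p" "p < m" for p
  proof -
    have p': "p \<in> {1..m}" "p \<in> {1..n}" "Suc n - p \<in> {1..n}" using p mn by auto
    have *: "b \<in> K (\<sigma> p) \<longleftrightarrow> b \<in> {\<tau> p, \<tau> (Suc n - p)}" if b: "b \<in> I" for b
    proof -
      note K[OF p'(1) b]
      also have "s.fam.col (\<iota> b) = s.fam.col p \<longleftrightarrow> \<iota> b = p \<or> \<iota> b = Suc n - p"
        by (rule s.fam.folded_col(1)[OF f m p x(1)[OF b]])
      also have "\<dots> \<longleftrightarrow> b \<in> {\<tau> p, \<tau> (Suc n - p)}"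
        using x(2)[OF b] lab(1)[OF p'(2)] lab(1)[OF p'(3)] by (metis insert_iff singletonD)
      finally show ?thesis .
    qed
    have "{\<tau> p, \<tau> (Suc n - p)} \<subseteq> I" using \<tau>I[OF p'(2)] \<tau>I[OF p'(3)] by simp
    then show ?thesis using * K_parabolic(1)[OF \<sigma>I[OF p'(1)]] by blast
  qed
  have mm: "m \<in> {1..m}" using m2 by simp
  have *: "b \<in> K (\<sigma> m) \<longleftrightarrow> b \<in> \<tau> ` {m..Suc n - m}" if b: "b \<in> I" for b
  proof -
    note K[OF mm b]
    also have "s.fam.col (\<iota> b) = s.fam.col m \<longleftrightarrow> m \<le> \<iota> b \<and> \<iota> b \<le> Suc n - m"
      by (rule s.fam.folded_col(2)[OF f m x(1)[OF b]])
    also have "\<dots> \<longleftrightarrow> \<iota> b \<in> {m..Suc n - m}" by simp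
    also have "\<dots> \<longleftrightarrow> b \<in> \<tau> ` {m..Suc n - m}"
    proof
      show "\<iota> b \<in> {m..Suc n - m} \<Longrightarrow> b \<in> \<tau> ` {m..Suc n - m}" using x(2)[OF b] by (metis imageI)
      assume "b \<in> \<tau> ` {m..Suc n - m}"
      then obtain y where "b = \<tau> y" "y \<in> {m..Suc n - m}" by blast
      then show "\<iota> b \<in> {m..Suc n - m}" using lab(1)[of y] m2 by auto
    qed
    finally show ?thesis .
  qed
  have "\<tau> ` {m..Suc n - m} \<subseteq> I" using \<tau>I m2 by auto
  then have Km: "K (\<sigma> m) = \<tau> ` {m..Suc n - m}" using * K_parabolic(1)[OF \<sigma>I[OF mm]] by blast
  show thesis by (rule that[OF V[unfolded \<iota>_def] mn _ Km]) (use K1 in blast)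
qed

text \<open>\<Phi> and the composite are compared on generators: \<open>V (\<sigma> p)\<close> and
  the unfolding of \<open>W p\<close> are reduced, use only letters of \<open>K (\<sigma> p)\<close>
  and have all of them as descents. So they are words of the same longest element.\<close>

lemma B_to_A:
  assumes m: "m = card I'" and \<sigma>: "labelling_B m \<sigma> I' M'" and \<tau>: "labelling_A n \<tau> I M"
    and r: "r = nat \<lceil>real n / 2\<rceil>"
  shows "m \<le> r \<and> (\<exists>\<Psi> U. is_B_to_B m \<sigma> I' M' r id {1..r} (matrix_B r) \<Psi> \<and>
    is_standard_unfolding r n \<tau> I M U \<and> (\<forall>x\<in>carrier (artin_monoid I' M'). \<Phi> x = U (\<Psi> x)))"
proof -
  define \<iota> where "\<iota> = the_inv_into {1..n} \<tau>"
  obtain V where V: "setup_A I' M' I M \<Phi> K V n \<iota>" and mn: "2 * m \<le> Suc n"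
    and K1': "\<forall>p. 1 \<le> p \<and> p < m \<longrightarrow> K (\<sigma> p) = {\<tau> p, \<tau> (Suc n - p)}" and Km: "K (\<sigma> m) = \<tau> ` {m..Suc n - m}"
    unfolding \<iota>_def using folded_A[OF m \<sigma> \<tau>] .
  interpret s: setup_A I' M' I M \<Phi> K V n \<iota> by (rule V)
  note lab = labelled_A_of_labelling(2,3)[OF cox \<tau>, folded \<iota>_def]
  have m2: "2 < m" using card' m by simp
  \<comment> \<open>\<open>Suc n\<close> is the number of strands; with \<open>r\<close> half of it,
    rounded down, both parities of \<open>n\<close> fit the model.\<close>
  have N: "Suc n = 2 * r \<or> Suc n = Suc (2 * r)" unfolding r nat_ceiling_half by presburger
  have mr: "m \<le> r" using mn N by auto
  have r2: "2 \<le> r" using mr m2 by simp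
  interpret b: labelled_B_nat r "Suc n" by unfold_locales (rule r2 N)+
  have K1: "K (\<sigma> p) = {\<tau> p, \<tau> (Suc n - p)}" if "1 \<le> p" "p < m" for p using K1' that by blast
  have \<tau>I: "\<tau> p \<in> I" if "p \<in> {1..n}" for p using \<tau> that unfolding labelling_A_def bij_betw_def by blast
  define \<pi> where "\<pi> = the_inv_into {1..m} \<sigma>"
  note \<pi> = labelled_B_of_labelling(2,3)[OF cox' \<sigma>, folded \<pi>_def]
  have \<sigma>M: "M' (\<sigma> p) (\<sigma> q) = matrix_B m p q" if "p \<in> {1..m}" "q \<in> {1..m}" for p q
    using \<sigma> that unfolding labelling_B_def by blast
  have \<sigma>I: "\<sigma> p \<in> I'" if "p \<in> {1..m}" for p using \<sigma> that unfolding labelling_B_def bij_betw_def by blast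
  \<comment> \<open>Words for the images of the generators in type B; \<open>dword r m\<close> is a
    word of the longest element of the block \<open>[m, r]\<close>.\<close>
  define W where "W = (\<lambda>p. if p < m then [p] else dword r m)"
  have WI: "W p \<in> lists {1..r}" if "p \<in> {1..m}" for p
    using b.dword_lists[of m] m2 mr that unfolding W_def by simp
  let ?T = "artin_class {1..r} (matrix_B r)"
  have W\<pi>: "W (\<pi> i) \<in> lists {1..r}" if "i \<in> I'" for i using WI \<pi>(2)[OF that] by blast
  have rel: "(alternating_concat k (W (\<pi> i)) (W (\<pi> j)), alternating_concat k (W (\<pi> j)) (W (\<pi> i)))
      \<in> artin_cong {1..r} (matrix_B r)" if ij: "i \<in> I'" "j \<in> I'" "i \<noteq> j" "M' i j = enat k" for i j k
  proof (rule b.folding_relation[OF m2 mr _ _ _ _ W_def])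
    show "\<pi> i \<in> {1..m}" "\<pi> j \<in> {1..m}" using \<pi>(2) ij by blast+
    then show "matrix_B m (\<pi> i) (\<pi> j) = enat k" using \<sigma>M[of "\<pi> i" "\<pi> j"] \<pi>(2) ij by simp
    show "\<pi> i \<noteq> \<pi> j" using \<pi>(2)[OF ij(1)] \<pi>(2)[OF ij(2)] ij(3) by metis
  qed
  obtain \<Psi> where \<Psi>: "\<Psi> \<in> monoid_hom (artin_monoid I' M') (artin_monoid {1..r} (matrix_B r))"
    "\<And>u. u \<in> lists I' \<Longrightarrow> \<Psi> (artin_class I' M' u) = ?T (subst (\<lambda>i. W (\<pi> i)) u)"
    by (rule ex_artin_hom[where I' = I' and M' = M' and V = "\<lambda>i. W (\<pi> i)" and I = "{1..r}" and M = "matrix_B r"])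
      (rule W\<pi> rel that | assumption)+
  have gen: "\<Psi> (artin_gen I' M' (\<sigma> p)) = ?T (W p)" if "p \<in> {1..m}" for p
    unfolding artin_gen_def using \<Psi>(2)[of "[\<sigma> p]"] \<sigma>I[OF that] \<pi>(1)[OF that] by simp
  have BB: "is_B_to_B m \<sigma> I' M' r id {1..r} (matrix_B r) \<Psi>"
    unfolding is_B_to_B_def
  proof (intro conjI ballI)
    show "\<Psi> (artin_gen I' M' (\<sigma> i)) = artin_gen {1..r} (matrix_B r) (id i)" if i: "i \<in> {1..m - 1}" for i
    proof -
      have "i \<in> {1..m}" "i < m" using i m2 by auto
      then show ?thesis using gen[of i] by (simp add: W_def artin_gen_def)
    qed
    have "\<Psi> (artin_gen I' M' (\<sigma> m)) = ?T (dword r m)" using gen[of m] m2 by (simp add: W_def)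
    moreover have "artin_lift {1..r} (matrix_B r) (longest_element {1..r} (matrix_B r) {m..r}) = ?T (dword r m)"
      by (rule b.artin_lift_dword) (use m2 mr in auto)
    ultimately show "\<Psi> (artin_gen I' M' (\<sigma> m))
        = artin_lift {1..r} (matrix_B r) (longest_element {1..r} (matrix_B r) (id ` {m..r}))"
      unfolding image_id by (simp only: id_apply)
  qed (rule \<Psi>(1))
  obtain U where U: "is_standard_unfolding r n \<tau> I M U"
    "\<forall>u\<in>lists {1..r}. U (?T u) = artin_class I M (subst (\<lambda>x. map \<tau> (unfold_letter r (Suc n) x)) u)"
    using ex_standard_unfolding[OF cox \<tau> r2 N] .
  have point: "(V (\<sigma> p), subst (\<lambda>x. map \<tau> (unfold_letter r (Suc n) x)) (W p)) \<in> artin_cong I M"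
    if p: "p \<in> {1..m}" for p
  proof -
    define z where "z = subst (unfold_letter r (Suc n)) (W p)"
    have eq: "subst (\<lambda>x. map \<tau> (unfold_letter r (Suc n) x)) (W p) = map \<tau> z"
      by (simp add: z_def map_concat comp_def)
    have z: "set z \<subseteq> {1..n}" "set (map \<tau> z) \<subseteq> K (\<sigma> p)" "rising id z"
      "\<And>x. x \<in> {1..n} \<Longrightarrow> \<tau> x \<in> K (\<sigma> p) \<Longrightarrow> perm z (Suc x) < perm z x"
    proof -
      have zp: "set z \<subseteq> {1..n} \<and> set (map \<tau> z) \<subseteq> K (\<sigma> p) \<and> rising id z \<and>
        (\<forall>x. x \<in> {1..n} \<and> \<tau> x \<in> K (\<sigma> p) \<longrightarrow> perm z (Suc x) < perm z x)"
      proof (cases "p < m")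
        case True
        then have p': "1 \<le> p" "p < m" "p \<in> {1..n}" "Suc n - p \<in> {1..n}" using p mn by auto
        have zW: "z = subst (unfold_letter r (Suc n)) [p]" using True by (simp add: z_def W_def)
        note u = b.unf_single[OF p'(1,2) mr, folded zW]
        have "x = p \<or> x = Suc n - p" if "x \<in> {1..n}" "\<tau> x \<in> K (\<sigma> p)" for x
          using that(2) lab(1)[OF that(1)] lab(1)[OF p'(3)] lab(1)[OF p'(4)]
          unfolding K1[OF p'(1,2)] by (metis insert_iff singletonD)
        then show ?thesis using u(2,3) p' unfolding K1[OF p'(1,2)] by (simp add: u(1))
      next
        case False
        then have pm: "p = m" using p by simp
        have m1: "1 \<le> m" using m2 by simp
        have zW: "z = subst (unfold_letter r (Suc n)) (dword r m)" using False by (simp add: z_def W_def)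
        note u = b.unf_dword[OF m1 mr, folded zW]
        have sub: "{m..Suc n - m} \<subseteq> {1..n}" using m2 by auto
        have xm: "m \<le> x \<and> x \<le> Suc n - m" if x: "x \<in> {1..n}" "\<tau> x \<in> K (\<sigma> p)" for x
        proof -
          obtain y where y: "\<tau> x = \<tau> y" "y \<in> {m..Suc n - m}" using x(2) unfolding pm Km by blast
          have yn: "y \<in> {1..n}" using sub y(2) by (rule subsetD)
          have "x = y" using arg_cong[OF y(1), of \<iota>] unfolding lab(1)[OF x(1)] lab(1)[OF yn] .
          then show ?thesis using y(2) by simp
        qed
        show ?thesis
        proof (intro conjI allI impI)
          show "set z \<subseteq> {1..n}" using u(1) sub by (rule subset_trans)
          show "set (map \<tau> z) \<subseteq> K (\<sigma> p)" unfolding pm Km set_map using u(1) by (rule image_mono)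
          show "rising id z" by (rule u(2))
          show "perm z (Suc x) < perm z x" if h: "x \<in> {1..n} \<and> \<tau> x \<in> K (\<sigma> p)" for x
            by (rule u(3)[OF xm[OF h[THEN conjunct1] h[THEN conjunct2], THEN conjunct1]
              xm[OF h[THEN conjunct1] h[THEN conjunct2], THEN conjunct2]])
        qed
      qed
      show "set z \<subseteq> {1..n}" "set (map \<tau> z) \<subseteq> K (\<sigma> p)" "rising id z" using zp by blast+
      show "perm z (Suc x) < perm z x" if "x \<in> {1..n}" "\<tau> x \<in> K (\<sigma> p)" for x using zp that by blast
    qed
    have \<iota>z: "map \<iota> (map \<tau> z) = z"
      unfolding map_map by (rule map_idI) (use z(1) lab(1) in \<open>auto simp: subset_iff\<close>)
    have "(V (\<sigma> p), map \<tau> z) \<in> artin_cong I M"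
    proof (rule s.longest_word_unique[of "K (\<sigma> p)"])
      show KI: "K (\<sigma> p) \<subseteq> I" by (rule K_parabolic(1)[OF \<sigma>I[OF p]])
      show "V (\<sigma> p) \<in> lists (K (\<sigma> p))" by (rule s.V_K[OF \<sigma>I[OF p]])
      show "rising id (map \<iota> (V (\<sigma> p)))" by (rule s.V_rising[OF \<sigma>I[OF p]])
      show "perm (map \<iota> (V (\<sigma> p))) (Suc (\<iota> j)) < perm (map \<iota> (V (\<sigma> p))) (\<iota> j)" if "j \<in> K (\<sigma> p)" for j
        by (rule s.V_descent[OF \<sigma>I[OF p] that])
      show "map \<tau> z \<in> lists (K (\<sigma> p))" using z(2) by (simp only: lists_eq_set mem_Collect_eq)
      show "rising id (map \<iota> (map \<tau> z))" unfolding \<iota>z by (rule z(3))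
      show "perm (map \<iota> (map \<tau> z)) (Suc (\<iota> j)) < perm (map \<iota> (map \<tau> z)) (\<iota> j)" if j: "j \<in> K (\<sigma> p)" for j
      proof -
        have "j \<in> I" using KI j by (rule subsetD)
        then have "\<iota> j \<in> {1..n}" "\<tau> (\<iota> j) = j" using lab(2) by blast+
        then show ?thesis unfolding \<iota>z using z(4)[of "\<iota> j"] j by simp
      qed
    qed
    then show ?thesis unfolding eq .
  qed
  have words: "(subst V u, subst (\<lambda>x. map \<tau> (unfold_letter r (Suc n) x)) (subst (\<lambda>i. W (\<pi> i)) u)) \<in> artin_cong I M"
    if "set u \<subseteq> I'" for u
    using that
  proof (induction u)
    case Nil
    then show ?case by (simp add: word_cong.refl)
  next
    case (Cons i u)
    then have i: "\<pi> i \<in> {1..m}" "\<sigma> (\<pi> i) = i" and u: "set u \<subseteq> I'" using \<pi>(2)[of i] by auto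
    show ?case using word_cong.mult[OF point[OF i(1)] Cons.IH[OF u]] unfolding i(2) by simp
  qed
  have "\<Phi> x = U (\<Psi> x)" if h: "x \<in> carrier (artin_monoid I' M')" for x
  proof -
    obtain u where u: "x = artin_class I' M' u" "u \<in> lists I'" using h unfolding carrier_artin by blast
    have Wu: "subst (\<lambda>i. W (\<pi> i)) u \<in> lists {1..r}" by (rule subst_in_lists[OF W\<pi> u(2)])
    have "\<Phi> x = artin_class I M (subst V u)" unfolding u(1) by (rule hom_word[OF hom s.V_I s.V_hom u(2)])
    also have "\<dots> = artin_class I M (subst (\<lambda>x. map \<tau> (unfold_letter r (Suc n) x)) (subst (\<lambda>i. W (\<pi> i)) u))"
      by (rule artin_class_eqI, rule words) (use u(2) in auto)
    also have "\<dots> = U (\<Psi> x)" unfolding u(1) \<Psi>(2)[OF u(2)] bspec[OF U(2) Wu] by (rule HOL.refl)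
    finally show ?thesis .
  qed
  then show ?thesis using mr BB U(1) by blast
qed

end

theorem theorem5p50:
  fixes I' :: "'a set" and M' :: "'a \<Rightarrow> 'a \<Rightarrow> enat"
    and I :: "'b set" and M :: "'b \<Rightarrow> 'b \<Rightarrow> enat"
    and \<Phi> :: "'a list set \<Rightarrow> 'b list set"
    and K :: "'a \<Rightarrow> 'b set"
    and m :: nat
  assumes "coxeter_matrix I' M'"
    and "irreducible_coxeter I' M'"
    and "finite_type I' M'"
    and "m = card I'" and "m > 2"
    and "coxeter_matrix I M"
    and "standard_hom I' M' I M \<Phi> K"
    and "disjoint_family_on K I'"
    and "(\<Union>i\<in>I'. K i) = I"
    and "optimal_hom I' M' I M \<Phi>"
    and "type_A I M \<or> type_B I M"
  shows "(\<not> type_B I' M' \<longrightarrow>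
        type_A I' M' \<and> type_A I M \<and> \<Phi> \<in> iso (artin_monoid I' M') (artin_monoid I M))
    \<and> (\<forall>n \<sigma> \<tau>. labelling_B m \<sigma> I' M' \<and> labelling_B n \<tau> I M \<longrightarrow>
        m \<le> n \<and>
        (\<forall>i\<in>{1..m - 1}. \<Phi> (artin_gen I' M' (\<sigma> i)) = artin_gen I M (\<tau> i)) \<and>
        \<Phi> (artin_gen I' M' (\<sigma> m)) = artin_lift I M (longest_element I M (\<tau> ` {m..n})))
    \<and> (\<forall>n r \<sigma> \<tau>. labelling_B m \<sigma> I' M' \<and> labelling_A n \<tau> I M \<and> r = nat \<lceil>real n / 2\<rceil> \<longrightarrow>
        m \<le> r \<and>
        (\<exists>\<Psi> U. is_B_to_B m \<sigma> I' M' r id {1..r} (matrix_B r) \<Psi> \<and>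
               is_standard_unfolding r n \<tau> I M U \<and>
               (\<forall>x\<in>carrier (artin_monoid I' M'). \<Phi> x = U (\<Psi> x))))"
proof -
  interpret standard_disjoint I' M' I M \<Phi> K
    by unfold_locales (use assms in simp_all)
  show ?thesis
  proof (intro conjI allI impI)
    show "type_A I' M'" "type_A I M" "\<Phi> \<in> iso (artin_monoid I' M') (artin_monoid I M)"
      if "\<not> type_B I' M'" using not_type_B[OF assms(11) that] by blast+
  next
    fix n \<sigma> \<tau> assume h: "labelling_B m \<sigma> I' M' \<and> labelling_B n \<tau> I M"
    note B = B_to_B[OF assms(4) h[THEN conjunct1] h[THEN conjunct2]]
    show "m \<le> n" by (rule B(1))
    show "\<forall>i\<in>{1..m - 1}. \<Phi> (artin_gen I' M' (\<sigma> i)) = artin_gen I M (\<tau> i)" by (intro ballI B(2))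
    show "\<Phi> (artin_gen I' M' (\<sigma> m)) = artin_lift I M (longest_element I M (\<tau> ` {m..n}))" by (rule B(3))
  next
    fix n r \<sigma> \<tau> assume h: "labelling_B m \<sigma> I' M' \<and> labelling_A n \<tau> I M \<and> r = nat \<lceil>real n / 2\<rceil>"
    note C = B_to_A[OF assms(4) h[THEN conjunct1] h[THEN conjunct2, THEN conjunct1] h[THEN conjunct2, THEN conjunct2]]
    show "m \<le> r" using C by (rule conjunct1)
    show "\<exists>\<Psi> U. is_B_to_B m \<sigma> I' M' r id {1..r} (matrix_B r) \<Psi> \<and> is_standard_unfolding r n \<tau> I M U \<and>
        (\<forall>x\<in>carrier (artin_monoid I' M'). \<Phi> x = U (\<Psi> x))" using C by (rule conjunct2)
  qed
qed

end
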